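(* Let $N\geq 2$, let $\gamma>0$ and $\gamma_j>0$ for all $1\le j\le N$ with $\gamma_1=\gamma_2=\gamma$ (and rotational speed $\Omega=\gamma$). Then there is no minimizer for $I_\gamma(c)$, i.e. no $\phi\in S(c)$ with $E_\gamma(\phi)=I_\gamma(c)$, provided that one of the following conditions holds: (i) $p=1+\frac4N$ and $c\geq\|Q\|_{L^2}^2$, where $Q$ is the unique positive radial solution to $-\frac12\Delta Q+Q-|Q|^{\frac4N}Q=0$ on $\mathbb{R}^N$; (ii) $1+\frac4N<p<1+\frac4{N-2}$ and $c>0$.
   Context: If $N=2$, $1+\frac{4}{N-2}$ is read as $+\infty$. Functions are complex-valued on $\mathbb{R}^N$. Set $A(x):=\gamma(-x_2,x_1,0,\dots,0)$ and $V_\gamma(x):=\frac12\sum_{j=3}^N\gamma_j^2x_j^2$ (so $V_\gamma=0$ if $N=2$). Let $H^1_A(\mathbb{R}^N):=\{f\in L^2:\ |(\nabla-iA)f|\in L^2\}$, $\Sigma_\gamma:=\{f\in H^1_A(\mathbb{R}^N):\ \int V_\gamma|f|^2dx<\infty\}$, $M(f):=\|f\|_{L^2}^2$, and $$E_\gamma(f):=\tfrac12\|(\nabla-iA)f\|_{L^2}^2+\int_{\mathbb{R}^N}V_\gamma|f|^2dx-\tfrac{2}{p+1}\|f\|_{L^{p+1}}^{p+1}.$$ This is the energy of the rotating NLS $i\partial_t u+\frac12\Delta u=Vu-\gamma L_zu-|u|^{p-1}u$ with $V(x)=\frac12\sum_{j=1}^N\gamma_j^2x_j^2$ and $L_z=i(x_2\partial_{x_1}-x_1\partial_{x_2})$.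 For $c>0$: $S(c):=\{f\in\Sigma_\gamma:\ M(f)=c\}$ and $I_\gamma(c):=\inf\{E_\gamma(f):\ f\in S(c)\}\in[-\infty,\infty)$. *)

theory Defs
  imports "HOL-Analysis.Analysis"
begin

section \<open>Classical derivatives\<close>

definition partial_deriv :: "'n::finite \<Rightarrow> (real^'n \<Rightarrow> 'b::real_normed_vector) \<Rightarrow> real^'n \<Rightarrow> 'b" where
  "partial_deriv j f x = frechet_derivative f (at x) (axis j 1)"

primrec C_k :: "nat \<Rightarrow> (real^'n::finite \<Rightarrow> 'b::real_normed_vector) \<Rightarrow> bool" where
  "C_k 0 f \<longleftrightarrow> continuous_on UNIV f"
| "C_k (Suc k) f \<longleftrightarrow> (\<forall>x. f differentiable (at x)) \<and> (\<forall>j. C_k k (partial_deriv j f))"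

definition laplacian :: "(real^'n::finite \<Rightarrow> 'b::real_normed_vector) \<Rightarrow> real^'n \<Rightarrow> 'b" where
  "laplacian f x = (\<Sum>j\<in>UNIV. partial_deriv j (partial_deriv j f) x)"


section \<open>Weak derivatives\<close>

definition test_function :: "(real^'n::finite \<Rightarrow> complex) \<Rightarrow> bool" where
  "test_function \<phi> \<longleftrightarrow> (\<forall>k. C_k k \<phi>) \<and> compact (closure {x. \<phi> x \<noteq> 0})"

definition locally_integrable :: "(real^'n::finite \<Rightarrow> complex) \<Rightarrow> bool" where
  "locally_integrable f \<longleftrightarrow> (\<forall>K. compact K \<longrightarrow> set_integrable lebesgue K f)"

definition has_weak_pderiv ::
  "'n::finite \<Rightarrow> (real^'n \<Rightarrow> complex) \<Rightarrow> (real^'n \<Rightarrow> complex) \<Rightarrow> bool" where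
  "has_weak_pderiv j f g \<longleftrightarrow>
     locally_integrable f \<and> locally_integrable g \<and>
     (\<forall>\<phi>. test_function \<phi> \<longrightarrow>
        (LINT x|lebesgue. f x * partial_deriv j \<phi> x) = - (LINT x|lebesgue. g x * \<phi> x))"

text \<open>The weak derivative is determined only almost everywhere; everything below depends on the
  chosen representative only through Lebesgue integrals and Lebesgue measurability.\<close>

definition weak_pderiv :: "'n::finite \<Rightarrow> (real^'n \<Rightarrow> complex) \<Rightarrow> real^'n \<Rightarrow> complex" where
  "weak_pderiv j f = (SOME g. has_weak_pderiv j f g)"

definition square_integrable :: "('a::euclidean_space \<Rightarrow> 'b::euclidean_space) \<Rightarrow> bool" where
  "square_integrable f \<longleftrightarrow>
     f \<in> borel_measurable lebesgue \<and> integrable lebesgue (\<lambda>x. (norm (f x))\<^sup>2)"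

definition L2_norm_sq :: "('a::euclidean_space \<Rightarrow> 'b::euclidean_space) \<Rightarrow> real" where
  "L2_norm_sq f = (LINT x|lebesgue. (norm (f x))\<^sup>2)"


section \<open>The magnetic energy\<close>

text \<open>The space \<open>\<real>\<^sup>N\<close> is \<^typ>\<open>real^'n\<close> with \<open>N = CARD('n)\<close>. The distinct indices \<open>a\<close> and \<open>b\<close> play the
  roles of the first and second coordinate, the remaining indices those of \<open>3, \<dots>, N\<close>.\<close>

definition mag_potential :: "real \<Rightarrow> 'n::finite \<Rightarrow> 'n \<Rightarrow> real^'n \<Rightarrow> real^'n" where
  "mag_potential \<gamma> a b x =
     \<gamma> *\<^sub>R (\<chi> j. if j = a then - (x $ b) else if j = b then x $ a else 0)"

definition V_trap :: "('n::finite \<Rightarrow> real) \<Rightarrow> 'n \<Rightarrow> 'n \<Rightarrow> real^'n \<Rightarrow> real" where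
  "V_trap g a b x = 1/2 * (\<Sum>j\<in>UNIV - {a, b}. (g j)\<^sup>2 * (x $ j)\<^sup>2)"

definition mag_grad ::
  "real \<Rightarrow> 'n::finite \<Rightarrow> 'n \<Rightarrow> (real^'n \<Rightarrow> complex) \<Rightarrow> real^'n \<Rightarrow> complex^'n" where
  "mag_grad \<gamma> a b f x =
     (\<chi> j. weak_pderiv j f x - \<i> * complex_of_real (mag_potential \<gamma> a b x $ j) * f x)"

text \<open>As \<open>A\<close> is locally bounded, for \<open>f \<in> L\<^sup>2\<close> the distribution \<open>(\<nabla> - iA)f\<close> can only be a locally
  integrable function if the distributional gradient of \<open>f\<close> is one, that is, if \<open>f\<close> has weak
  partial derivatives.\<close>

definition H1_mag :: "real \<Rightarrow> 'n::finite \<Rightarrow> 'n \<Rightarrow> (real^'n \<Rightarrow> complex) set" where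
  "H1_mag \<gamma> a b =
     {f. square_integrable f \<and> (\<forall>j. \<exists>g. has_weak_pderiv j f g) \<and>
         square_integrable (mag_grad \<gamma> a b f)}"

definition Sigma_space ::
  "real \<Rightarrow> ('n::finite \<Rightarrow> real) \<Rightarrow> 'n \<Rightarrow> 'n \<Rightarrow> (real^'n \<Rightarrow> complex) set" where
  "Sigma_space \<gamma> g a b =
     {f \<in> H1_mag \<gamma> a b. integrable lebesgue (\<lambda>x. V_trap g a b x * (norm (f x))\<^sup>2)}"

definition energy ::
  "real \<Rightarrow> ('n::finite \<Rightarrow> real) \<Rightarrow> 'n \<Rightarrow> 'n \<Rightarrow> real \<Rightarrow> (real^'n \<Rightarrow> complex) \<Rightarrow> real" where
  "energy \<gamma> g a b p f =
     1/2 * L2_norm_sq (mag_grad \<gamma> a b f)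
     + (LINT x|lebesgue. V_trap g a b x * (norm (f x))\<^sup>2)
     - 2 / (p + 1) * (LINT x|lebesgue. norm (f x) powr (p + 1))"

definition mass_sphere ::
  "real \<Rightarrow> ('n::finite \<Rightarrow> real) \<Rightarrow> 'n \<Rightarrow> 'n \<Rightarrow> real \<Rightarrow> (real^'n \<Rightarrow> complex) set" where
  "mass_sphere \<gamma> g a b c = {f \<in> Sigma_space \<gamma> g a b. L2_norm_sq f = c}"

definition min_energy ::
  "real \<Rightarrow> ('n::finite \<Rightarrow> real) \<Rightarrow> 'n \<Rightarrow> 'n \<Rightarrow> real \<Rightarrow> real \<Rightarrow> ereal" where
  "min_energy \<gamma> g a b p c = (INF f\<in>mass_sphere \<gamma> g a b c. ereal (energy \<gamma> g a b p f))"


section \<open>Exponents and the ground state\<close>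

definition energy_critical_exponent :: "nat \<Rightarrow> ereal" where
  "energy_critical_exponent N = (if N = 2 then \<infinity> else ereal (1 + 4 / (real N - 2)))"

text \<open>Decay at infinity is part of the notion of solution on the whole space: without it the
  constant function \<open>1\<close> would be a second positive radial solution.\<close>

definition ground_state :: "(real^'n::finite \<Rightarrow> real) \<Rightarrow> bool" where
  "ground_state Q \<longleftrightarrow>
     C_k 2 Q \<and>
     (\<forall>x. Q x > 0) \<and>
     (\<forall>x y. norm x = norm y \<longrightarrow> Q x = Q y) \<and>
     (Q \<longlongrightarrow> 0) at_infinity \<and>
     (\<forall>x. - (1/2) * laplacian Q x + Q x - \<bar>Q x\<bar> powr (4 / real CARD('n)) * Q x = 0)"

end

theory Submission
  imports Defs
begin

text \<open>In both cases the energy is compared with that of concentrating real trial functions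
  \<open>\<lambda>\<^sup>N\<^sup>/\<^sup>2 v(\<lambda>x)\<close>, whose energy is \<open>\<lambda>\<^sup>2\<close> times the kinetic part minus \<open>\<lambda>\<close> to the power \<open>N(p-1)/2\<close> times
  the nonlinear part, up to a term of order \<open>\<lambda>\<^sup>-\<^sup>2\<close>. For supercritical \<open>p\<close> this is unbounded below.

  For critical \<open>p\<close> the Pohozaev identity says that the field-free energy of \<open>Q\<close> vanishes, so
  concentrating multiples of \<open>Q\<close> give \<open>I(c) \<le> 0\<close>, and a minimizer \<open>\<phi>\<close> has nonpositive energy. But the
  diamagnetic inequality is strict: the modulus of \<open>\<phi>\<close> has smaller kinetic energy, by an amount
  controlled by the commutator \<open>[D\<^sub>1, D\<^sub>2] = -2i\<gamma>\<close> of the covariant derivatives. Hence the field-free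
  energy of a regularized modulus is negative, and concentrating it makes the energy unbounded
  below. This way neither the sharp Gagliardo--Nirenberg inequality nor the uniqueness of \<open>Q\<close> enters.\<close>

section \<open>Directional derivatives\<close>

text \<open>Why the diamagnetic inequality is strict: if passing to the modulus cost no kinetic
  energy, all covariant derivatives of \<phi> would pointwise be real multiples of \<phi>, so
  \<open>Im (cnj (D_1 \<phi>) * D_2 \<phi>)\<close> would vanish; but by the commutator its integral
  is \<gamma> times the mass. The obstacle is regularity. A minimizer has only weak derivatives, and
  that integral is computed by parts, so it is evaluated for continuously differentiable, compactly
  supported approximations, and the gap has to survive the limit. Hence the quantitative form: the
  modulus loses at least \<open>(\<gamma> M)^2 / L\<close>, with M the mass and L a positive upper
  bound of the magnetic kinetic energy, the same for all late approximations. The limit then takes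
  an upper bound of the kinetic energies, which Jensen's inequality gives for convolutions, and
  lower semicontinuity of mass and nonlinear term, which is Fatou's lemma. The regularized moduli
  have mass at most c. Raising their amplitude to reach mass c is harmless: the nonlinear term
  carries the higher power \<open>p + 1\<close> of the amplitude.\<close>

lemma lborel_affine_integral:
  fixes f :: "'a::euclidean_space \<Rightarrow> 'b::euclidean_space" and t :: 'a
  assumes f: "f \<in> borel_measurable borel" and c: "c \<noteq> (0::real)"
  shows "integrable lborel (\<lambda>x. f (t + c *\<^sub>R x)) \<longleftrightarrow> integrable lborel f" (is ?A)
    and "(LINT x|lborel. f (t + c *\<^sub>R x)) = (LINT x|lborel. f x) /\<^sub>R \<bar>c\<bar> ^ DIM('a)" (is ?B)
proof -
  have *: "lborel = density (distr lborel borel (\<lambda>x::'a. t + c *\<^sub>R x)) (\<lambda>_. \<bar>c\<bar> ^ DIM('a))"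
    using lborel_affine[of c t] c by simp
  have m: "(\<lambda>x::'a. t + c *\<^sub>R x) \<in> borel_measurable borel" by measurable
  have "integrable lborel f \<longleftrightarrow> integrable (distr lborel borel (\<lambda>x::'a. t + c *\<^sub>R x)) (\<lambda>x. (\<bar>c\<bar> ^ DIM('a)) *\<^sub>R f x)"
    using c f by (subst *, subst integrable_density) auto
  also have "\<dots> \<longleftrightarrow> integrable lborel (\<lambda>x. f (t + c *\<^sub>R x))"
    using f c m integrable_scaleR_right[of "inverse (\<bar>c\<bar> ^ DIM('a))" lborel "\<lambda>x. (\<bar>c\<bar> ^ DIM('a)) *\<^sub>R f (t + c *\<^sub>R x)"]
    by (subst integrable_distr_eq) auto
  finally show ?A by simp
  have "(LINT x|lborel. f x) = (LINT x|distr lborel borel (\<lambda>x::'a. t + c *\<^sub>R x). (\<bar>c\<bar> ^ DIM('a)) *\<^sub>R f x)"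
    using c f by (subst *, subst integral_density) auto
  also have "\<dots> = \<bar>c\<bar> ^ DIM('a) *\<^sub>R (LINT x|lborel. f (t + c *\<^sub>R x))"
    using f c m by (subst integral_distr) auto
  finally show ?B using c by simp
qed

lemma lborel_translate_integral:
  fixes f :: "'a::euclidean_space \<Rightarrow> 'b::euclidean_space" and t :: 'a
  assumes f: "f \<in> borel_measurable borel"
  shows "integrable lborel (\<lambda>x. f (x + t)) \<longleftrightarrow> integrable lborel f"
    and "(LINT x|lborel. f (x + t)) = (LINT x|lborel. f x)"
  using lborel_affine_integral[OF f, of 1 t] by (simp_all add: add.commute)

text \<open>Only the derivative along one axis, at every point, is asked for. This is what
  difference quotients of convolutions deliver and all that integration by parts uses; total
  differentiability would be a detour.\<close>

definition has_pd :: "'n::finite \<Rightarrow> (real^'n \<Rightarrow> 'b::real_normed_vector) \<Rightarrow> (real^'n \<Rightarrow> 'b) \<Rightarrow> bool" where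
  "has_pd j f f' \<longleftrightarrow> (\<forall>x. ((\<lambda>t. f (x + t *\<^sub>R axis j 1)) has_vector_derivative f' x) (at 0))"

lemma has_pd_at:
  assumes "has_pd j f f'"
  shows "((\<lambda>t. f (x + t *\<^sub>R axis j 1)) has_vector_derivative f' (x + t *\<^sub>R axis j 1)) (at t within S)"
proof -
  let ?y = "x + t *\<^sub>R axis j 1"
  have 1: "((\<lambda>s::real. s - t) has_vector_derivative 1) (at t)"
    by (auto intro!: derivative_eq_intros)
  have 2: "((\<lambda>s. f (?y + s *\<^sub>R axis j 1)) has_vector_derivative f' ?y) (at (t - t))"
    using assms by (simp add: has_pd_def)
  have "((\<lambda>s. f (?y + s *\<^sub>R axis j 1)) \<circ> (\<lambda>s. s - t) has_vector_derivative 1 *\<^sub>R f' ?y) (at t)"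
    by (rule vector_diff_chain_at[OF 1 2])
  moreover have "(\<lambda>s. f (?y + s *\<^sub>R axis j 1)) \<circ> (\<lambda>s. s - t) = (\<lambda>t. f (x + t *\<^sub>R axis j 1))"
    by (auto simp: fun_eq_iff algebra_simps)
  ultimately show ?thesis by (simp add: has_vector_derivative_at_within)
qed

lemma has_pd_partial_deriv:
  assumes "\<And>x. f differentiable (at x)"
  shows "has_pd j f (partial_deriv j f)"
  unfolding has_pd_def
proof
  fix x
  have 1: "(f has_derivative frechet_derivative f (at x)) (at x)"
    using assms frechet_derivative_works by blast
  have 2: "((\<lambda>t::real. x + t *\<^sub>R axis j 1) has_vector_derivative axis j 1) (at 0)"
    by (auto intro!: derivative_eq_intros)
  have 3: "(f has_derivative frechet_derivative f (at x)) (at ((\<lambda>t::real. x + t *\<^sub>R axis j 1) 0))"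
    using 1 by simp
  show "((\<lambda>t. f (x + t *\<^sub>R axis j 1)) has_vector_derivative partial_deriv j f x) (at 0)"
    using vector_derivative_diff_chain_within[OF 2 has_derivative_at_withinI[OF 3]]
    by (simp add: o_def partial_deriv_def)
qed

lemma has_pd_mult:
  fixes f g :: "real^'n::finite \<Rightarrow> 'b::real_normed_algebra"
  assumes "has_pd j f f'" "has_pd j g g'"
  shows "has_pd j (\<lambda>x. f x * g x) (\<lambda>x. f' x * g x + f x * g' x)"
  unfolding has_pd_def
proof
  fix x
  show "((\<lambda>t. f (x + t *\<^sub>R axis j 1) * g (x + t *\<^sub>R axis j 1)) has_vector_derivative f' x * g x + f x * g' x) (at 0)"
    using has_vector_derivative_mult[OF has_pd_at[OF assms(1), of x 0 UNIV] has_pd_at[OF assms(2), of x 0 UNIV]]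
    by (simp add: add.commute)
qed

lemma has_pd_bounded_linear:
  assumes "bounded_linear h" "has_pd j f f'"
  shows "has_pd j (\<lambda>x. h (f x)) (\<lambda>x. h (f' x))"
  using assms(2) bounded_linear.has_vector_derivative[OF assms(1)] unfolding has_pd_def by blast

text \<open>Integrating \<open>f'\<close> over a unit step in direction j gives
  \<open>f (x + e) - f x\<close>. Integrate this in x: by Fubini and translation invariance one side
  is the integral of \<open>f'\<close>, the other is 0. No boundary terms occur, so integrability of
  both functions replaces compact support.\<close>

lemma integral_has_pd_eq_0:
  fixes f :: "real^'n::finite \<Rightarrow> 'b::euclidean_space"
  assumes d: "has_pd j f f'" and cf: "continuous_on UNIV f" and cf': "continuous_on UNIV f'"
    and i: "integrable lborel f" "integrable lborel f'"
  shows "(LINT x|lborel. f' x) = 0"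
proof -
  let ?e = "axis j (1::real) :: real^'n"
  let ?F = "\<lambda>(s::real) x. indicator {0..1::real} s *\<^sub>R f' (x + s *\<^sub>R ?e)"
  have bf: "f \<in> borel_measurable borel" "f' \<in> borel_measurable borel"
    using cf cf' by (auto intro: borel_measurable_continuous_onI)
  have int1: "integrable lborel (\<lambda>x. f' (x + s *\<^sub>R ?e))" for s
    using lborel_translate_integral(1)[OF bf(2)] i by blast
  have nbf: "(\<lambda>x. norm (f' x)) \<in> borel_measurable borel" using bf by measurable
  have nint: "(LINT x|lborel. norm (f' (x + s *\<^sub>R ?e))) = (LINT x|lborel. norm (f' x))" for s
    using lborel_translate_integral(2)[OF nbf] .
  have contp: "continuous_on UNIV (\<lambda>p::real \<times> (real^'n). f' (snd p + fst p *\<^sub>R ?e))"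
    by (intro continuous_on_compose2[OF cf'] continuous_intros) auto
  have mp: "(\<lambda>p::real \<times> (real^'n). f' (snd p + fst p *\<^sub>R ?e)) \<in> borel_measurable (lborel \<Otimes>\<^sub>M lborel)"
    using borel_measurable_continuous_onI[OF contp] by (simp add: lborel_prod)
  have mF: "case_prod ?F \<in> borel_measurable (lborel \<Otimes>\<^sub>M lborel)"
    unfolding case_prod_beta by (intro borel_measurable_scaleR mp) measurable
  have intF: "integrable (lborel \<Otimes>\<^sub>M lborel) (case_prod ?F)"
  proof (rule lborel_pair.Fubini_integrable[OF mF])
    have "(\<lambda>s. LINT y|lborel. norm (case (s, y) of (s, x) \<Rightarrow> ?F s x)) = (\<lambda>s. indicator {0..1::real} s *\<^sub>R (LINT x|lborel. norm (f' x)))"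
      by (auto simp: fun_eq_iff nint)
    then show "integrable lborel (\<lambda>s. LINT y|lborel. norm (case (s, y) of (s, x) \<Rightarrow> ?F s x))" by simp
    show "AE s in lborel. integrable lborel (\<lambda>y. case (s, y) of (s, x) \<Rightarrow> ?F s x)"
      using int1 by auto
  qed
  have inner: "(LINT s|lborel. ?F s x) = f (x + ?e) - f x" for x
  proof -
    have "(LINT s|lborel. indicator {0..1} s *\<^sub>R f' (x + s *\<^sub>R ?e)) = f (x + 1 *\<^sub>R ?e) - f (x + 0 *\<^sub>R ?e)"
      by (rule integral_FTC_Icc, simp, rule has_pd_at[OF d])
         (intro continuous_on_compose2[OF cf'] continuous_intros, auto)
    then show ?thesis by simp
  qed
  have "(LINT x|lborel. LINT s|lborel. ?F s x) = (LINT s|lborel. LINT x|lborel. ?F s x)"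
    using lborel_pair.Fubini_integral[OF intF] by simp
  also have "(LINT s|lborel. LINT x|lborel. ?F s x) = (LINT s|lborel. indicator {0..1::real} s *\<^sub>R (LINT x|lborel. f' x))"
    by (simp add: lborel_translate_integral(2)[OF bf(2)])
  also have "\<dots> = (LINT x|lborel. f' x)" by simp
  finally have "(LINT x|lborel. f' x) = (LINT x|lborel. f (x + ?e) - f x)" using inner by simp
  also have "\<dots> = 0"
    using i lborel_translate_integral[OF bf(1), of ?e] by (subst Bochner_Integration.integral_diff) auto
  finally show ?thesis .
qed

section \<open>Compact support and weak derivatives of classical functions\<close>

definition cpt_supp :: "('a::euclidean_space \<Rightarrow> 'b::real_normed_vector) \<Rightarrow> bool" where
  "cpt_supp f \<longleftrightarrow> (\<exists>R. \<forall>x. norm x > R \<longrightarrow> f x = 0)"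

lemma cpt_supp_mult [intro]:
  fixes f g :: "'a::euclidean_space \<Rightarrow> 'b::real_normed_algebra"
  shows "cpt_supp f \<Longrightarrow> cpt_supp (\<lambda>x. g x * f x)" "cpt_supp f \<Longrightarrow> cpt_supp (\<lambda>x. f x * g x)"
  by (auto simp: cpt_supp_def; metis mult_zero_right mult_zero_left)+

lemma integrable_cpt_supp:
  fixes f :: "'a::euclidean_space \<Rightarrow> 'b::euclidean_space"
  assumes "continuous_on UNIV f" "cpt_supp f"
  shows "integrable lborel f"
proof -
  obtain R where R: "\<And>x. norm x > R \<Longrightarrow> f x = 0" using assms(2) by (auto simp: cpt_supp_def)
  have "integrable lborel (\<lambda>x. indicator (cball 0 R) x *\<^sub>R f x)"
    by (rule borel_integrable_compact) (auto intro: continuous_on_subset[OF assms(1)])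
  moreover have "(\<lambda>x. indicator (cball 0 R) x *\<^sub>R f x) = f"
    using R by (auto simp: fun_eq_iff indicator_def not_le)
  ultimately show ?thesis by simp
qed

text \<open>The exterior of a ball is open, so a function vanishing there also vanishes on a short
  segment through each of its points.\<close>

lemma cpt_supp_has_pd:
  assumes "has_pd j f f'" "cpt_supp f"
  shows "cpt_supp f'"
proof -
  obtain R where R: "\<And>x. norm x > R \<Longrightarrow> f x = 0" using assms(2) by (auto simp: cpt_supp_def)
  have "f' x = 0" if x: "norm x > R" for x
  proof -
    have c: "((\<lambda>t. norm (x + t *\<^sub>R axis j 1)) \<longlongrightarrow> norm (x + 0 *\<^sub>R axis j 1)) (at 0)"
      by (intro tendsto_intros)
    have "\<forall>\<^sub>F t in at 0. norm (x + t *\<^sub>R axis j 1) > R"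
      using order_tendstoD(1)[OF c, of R] x by simp
    then have "\<forall>\<^sub>F t in at 0. f (x + t *\<^sub>R axis j 1) = 0" by eventually_elim (rule R)
    then have ev: "\<forall>\<^sub>F t in nhds 0. f (x + t *\<^sub>R axis j 1) = 0"
      using R[OF x] by (simp add: eventually_at_filter eventually_mono) (auto elim: eventually_mono)
    have "((\<lambda>t. f (x + t *\<^sub>R axis j 1)) has_vector_derivative f' x) (at 0)"
      using assms(1) by (auto simp: has_pd_def)
    then have "((\<lambda>t::real. 0) has_vector_derivative f' x) (at 0)"
      using R[OF x] ev by (subst has_vector_derivative_cong_ev[where g="\<lambda>t. f (x + t *\<^sub>R axis j 1)"])  (auto elim: eventually_mono)
    then show ?thesis using vector_derivative_unique_at has_vector_derivative_const by blast
  qed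
  then show ?thesis by (auto simp: cpt_supp_def)
qed

lemma test_functionD:
  assumes "test_function (\<phi> :: real^'n::finite \<Rightarrow> complex)"
  shows "has_pd j \<phi> (partial_deriv j \<phi>)" "continuous_on UNIV \<phi>" "continuous_on UNIV (partial_deriv j \<phi>)"
    "cpt_supp \<phi>" "cpt_supp (partial_deriv j \<phi>)"
proof -
  have C: "C_k k \<phi>" for k using assms by (simp add: test_function_def)
  show d: "has_pd j \<phi> (partial_deriv j \<phi>)" using C[of "Suc 0"] by (intro has_pd_partial_deriv) auto
  show "continuous_on UNIV \<phi>" using C[of 0] by simp
  show "continuous_on UNIV (partial_deriv j \<phi>)" using C[of "Suc 0"] by simp
  have "bounded (closure {x. \<phi> x \<noteq> 0})"
    using assms by (auto simp: test_function_def intro: compact_imp_bounded)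
  then obtain R where R: "\<forall>x\<in>closure {x. \<phi> x \<noteq> 0}. norm x \<le> R"
    unfolding bounded_iff by blast
  have "\<phi> x = 0" if "norm x > R" for x
    using R that closure_subset[of "{x. \<phi> x \<noteq> 0}"] by (metis (mono_tags, lifting) mem_Collect_eq not_le subsetD)
  then show s: "cpt_supp \<phi>" by (auto simp: cpt_supp_def)
  show "cpt_supp (partial_deriv j \<phi>)" using cpt_supp_has_pd[OF d s] .
qed

lemma locally_integrable_continuous:
  assumes "continuous_on UNIV (f :: real^'n::finite \<Rightarrow> complex)"
  shows "locally_integrable f"
  unfolding locally_integrable_def set_integrable_def
proof (intro allI impI)
  fix K :: "(real^'n) set" assume "compact K"
  then have "integrable lborel (\<lambda>x. indicator K x *\<^sub>R f x)"
    by (rule borel_integrable_compact) (auto intro: continuous_on_subset[OF assms])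
  then show "integrable lebesgue (\<lambda>x. indicator K x *\<^sub>R f x)"
    by (subst integrable_completion) auto
qed

lemma integral_lebesgue_continuous:
  assumes "continuous_on UNIV (f :: 'a::euclidean_space \<Rightarrow> 'b::euclidean_space)"
  shows "(LINT x|lebesgue. f x) = (LINT x|lborel. f x)"
  using borel_measurable_continuous_onI[OF assms] by (subst integral_completion) auto

text \<open>Integration by parts: the product with a test function is compactly supported, and its
  derivative integrates to 0.\<close>

lemma has_weak_pderiv_classical:
  fixes f :: "real^'n::finite \<Rightarrow> complex"
  assumes d: "has_pd j f f'" and cf: "continuous_on UNIV f" and cf': "continuous_on UNIV f'"
  shows "has_weak_pderiv j f f'"
  unfolding has_weak_pderiv_def
proof (intro conjI allI impI locally_integrable_continuous cf cf')
  fix \<phi> :: "real^'n \<Rightarrow> complex" assume t: "test_function \<phi>"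
  note T = test_functionD[OF t]
  have c1: "continuous_on UNIV (\<lambda>x. f x * partial_deriv j \<phi> x)" "continuous_on UNIV (\<lambda>x. f' x * \<phi> x)"
    "continuous_on UNIV (\<lambda>x. f x * \<phi> x)"
    using cf cf' T(2,3) by (auto intro!: continuous_intros)
  have i1: "integrable lborel (\<lambda>x. f x * partial_deriv j \<phi> x)" "integrable lborel (\<lambda>x. f' x * \<phi> x)"
    "integrable lborel (\<lambda>x. f x * \<phi> x)"
    by (auto intro!: integrable_cpt_supp c1 T)
  have "(LINT x|lborel. f' x * \<phi> x + f x * partial_deriv j \<phi> x) = 0"
    by (rule integral_has_pd_eq_0[OF has_pd_mult[OF d T(1)]])
       (auto intro!: continuous_intros c1 i1)
  then show "(LINT x|lebesgue. f x * partial_deriv j \<phi> x) = - (LINT x|lebesgue. f' x * \<phi> x)"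
    using i1 by (simp add: integral_lebesgue_continuous c1 add_eq_0_iff2)
qed

section \<open>Smooth bump functions\<close>

text \<open>The extra denominator \<open>t ^ m\<close> makes the family closed under differentiation
  up to linear combinations, so smoothness becomes an induction without formulas for higher
  derivatives.\<close>

definition flat :: "nat \<Rightarrow> real \<Rightarrow> real" where
  "flat m t = (if t > 0 then exp (- 1 / t) / t ^ m else 0)"

lemma flat_nonneg: "flat m t \<ge> 0" by (simp add: flat_def)

text \<open>Under \<open>s = 1 / t\<close> the claim from the right is that
  \<open>s ^ m / exp s\<close> tends to 0 at infinity.\<close>

lemma flat_tendsto_0: "(flat m \<longlongrightarrow> 0) (at 0)"
proof -
  have "((\<lambda>t. t ^ m / exp t) \<longlongrightarrow> 0) (at_top :: real filter)" by (rule tendsto_power_div_exp_0)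
  then have "((\<lambda>t. inverse t ^ m / exp (inverse t)) \<longlongrightarrow> 0) (at_right (0::real))"
    by (rule filterlim_compose[OF _ filterlim_inverse_at_top_right])
  moreover have "\<forall>\<^sub>F t in at_right (0::real). inverse t ^ m / exp (inverse t) = flat m t"
    by (auto simp: eventually_at_right_less flat_def field_simps exp_minus eventually_at_filter power_inverse intro!: always_eventually)
  ultimately have R: "(flat m \<longlongrightarrow> 0) (at_right 0)" by (rule Lim_transform_eventually)
  have "\<forall>\<^sub>F t in at_left (0::real). 0 = flat m t"
    by (auto simp: flat_def eventually_at_filter intro!: always_eventually)
  then have "(flat m \<longlongrightarrow> 0) (at_left 0)" by (rule Lim_transform_eventually[OF tendsto_const])
  with R show ?thesis by (simp add: filterlim_at_split)
qed

lemma flat_has_derivative: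
  "(flat m has_real_derivative flat (m+2) t - real m * flat (m+1) t) (at t)"
proof -
  consider "t > 0" | "t < 0" | "t = 0" by linarith
  then show ?thesis
  proof cases
    case 1
    have "((\<lambda>t. exp (- 1 / t) / t ^ m) has_real_derivative flat (m+2) t - real m * flat (m+1) t) (at t)"
    proof (cases m)
      case 0
      then show ?thesis using 1
        by (auto intro!: derivative_eq_intros simp: flat_def field_simps power2_eq_square)
    next
      case (Suc k)
      then show ?thesis using 1
        apply (auto intro!: derivative_eq_intros simp: flat_def field_simps power2_eq_square)
        by (metis One_nat_def power_eq_if mult_1_right power_0)
    qed
    moreover have "\<forall>\<^sub>F s in nhds t. flat m s = exp (- 1 / s) / s ^ m"
      using eventually_nhds_in_open[of "{0<..}" t] 1 by (auto simp: flat_def elim: eventually_mono)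
    ultimately show ?thesis by (subst DERIV_cong_ev[OF refl _ refl])
  next
    case 2
    have "\<forall>\<^sub>F s in nhds t. flat m s = 0"
      using eventually_nhds_in_open[of "{..<0}" t] 2 by (auto simp: flat_def elim: eventually_mono)
    then have "(flat m has_real_derivative 0) (at t) \<longleftrightarrow> ((\<lambda>_. 0) has_real_derivative 0) (at t)"
      by (intro DERIV_cong_ev) auto
    then show ?thesis using 2 by (simp add: flat_def)
  next
    case 3
    \<comment> \<open>As \<open>flat m 0\<close> is 0, the difference quotient at the origin merely
      raises m by one, and its limit is again that of a \<open>flat\<close> function.\<close>
    have "(flat m (0 + s) - flat m 0) / s = flat (m+1) s" for s
      by (simp add: flat_def)
    then have "(flat m has_real_derivative 0) (at 0)"
      using flat_tendsto_0[of "m+1"] by (simp add: DERIV_def)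
    then show ?thesis using 3 by (simp add: flat_def)
  qed
qed

lemma continuous_flat: "continuous_on S (flat m)"
  using flat_has_derivative[THEN DERIV_isCont] continuous_at_imp_continuous_on by blast

lemma partial_deriv_eqI:
  assumes "\<And>x. (f has_derivative D x) (at x)"
  shows "partial_deriv j f = (\<lambda>x. D x (axis j 1))"
  using frechet_derivative_at[OF assms] by (simp add: partial_deriv_def fun_eq_iff)

text \<open>Contains the bump functions centred at \<open>z\<close> and is closed under partial derivatives.\<close>

inductive_set bumps :: "real^'n::finite \<Rightarrow> real \<Rightarrow> (real^'n \<Rightarrow> complex) set" for z r where
  base: "(\<lambda>x. complex_of_real (flat m (r\<^sup>2 - (norm (x - z))\<^sup>2))) \<in> bumps z r"
| coord: "f \<in> bumps z r \<Longrightarrow> (\<lambda>x. complex_of_real ((x - z) $ j) * f x) \<in> bumps z r"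
| add: "f \<in> bumps z r \<Longrightarrow> g \<in> bumps z r \<Longrightarrow> (\<lambda>x. f x + g x) \<in> bumps z r"
| cmul: "f \<in> bumps z r \<Longrightarrow> (\<lambda>x. w * f x) \<in> bumps z r"

text \<open>A total derivative is produced, since \<open>C_k\<close> asks for differentiability, and
  its values on all axes lie in the class again. Iterating this gives derivatives of every
  order.\<close>

lemma bumps_derivative:
  fixes f :: "real^'n::finite \<Rightarrow> complex"
  assumes "f \<in> bumps z r"
  shows "\<exists>D. (\<forall>x. (f has_derivative D x) (at x)) \<and> (\<forall>j. (\<lambda>x. D x (axis j 1)) \<in> bumps z r)"
  using assms
proof induction
  case (base m)
  let ?t = "\<lambda>x. r\<^sup>2 - (norm (x - z))\<^sup>2"
  let ?c = "\<lambda>x. flat (m+2) (?t x) - real m * flat (m+1) (?t x)"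
  have 1: "(?t has_derivative (\<lambda>v. - (2 * ((x - z) \<bullet> v)))) (at x)" for x
    unfolding power2_norm_eq_inner
    by (auto intro!: derivative_eq_intros simp: inner_commute)
  have 2: "((\<lambda>x. flat m (?t x)) has_derivative (\<lambda>v. ?c x * (- (2 * ((x - z) \<bullet> v))))) (at x)" for x
    using has_derivative_compose[OF 1 has_field_derivative_imp_has_derivative[OF flat_has_derivative[of m "?t x"]]]
    by simp
  have 3: "((\<lambda>x. complex_of_real (flat m (?t x))) has_derivative (\<lambda>v. of_real (?c x * (- (2 * ((x - z) \<bullet> v)))))) (at x)" for x
    using has_derivative_of_real[OF 2] .
  have 4: "(\<lambda>x. complex_of_real (?c x * (- (2 * ((x - z) \<bullet> axis j 1))))) \<in> bumps z r" for j
  proof -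
    have "(\<lambda>x. (-2) * (of_real ((x - z) $ j) * (complex_of_real (flat (m+2) (?t x)) + (- of_nat m) * of_real (flat (m+1) (?t x))))) \<in> bumps z r"
      by (intro bumps.intros)
    moreover have "(\<lambda>x. (-2) * (of_real ((x - z) $ j) * (complex_of_real (flat (m+2) (?t x)) + (- of_nat m) * of_real (flat (m+1) (?t x)))))
      = (\<lambda>x. complex_of_real (?c x * (- (2 * ((x - z) \<bullet> axis j 1)))))"
      by (auto simp: fun_eq_iff inner_axis algebra_simps)
    ultimately show ?thesis by simp
  qed
  show ?case
    by (rule exI[of _ "\<lambda>x v. complex_of_real (?c x * (- (2 * ((x - z) \<bullet> v))))"]) (use 3 4 in simp)
next
  case (coord f j)
  then obtain D where D: "\<And>x. (f has_derivative D x) (at x)" "\<And>j. (\<lambda>x. D x (axis j 1)) \<in> bumps z r" by blast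
  have 0: "((\<lambda>x. (x - z) $ j) has_derivative (\<lambda>v. v $ j)) (at x)" for x
    using has_derivative_diff[OF bounded_linear_imp_has_derivative[OF bounded_linear_vec_nth[of j]] has_derivative_const[of "z $ j"]]
    by simp
  have 1: "((\<lambda>x. complex_of_real ((x - z) $ j) * f x) has_derivative (\<lambda>v. of_real ((x - z) $ j) * D x v + of_real (v $ j) * f x)) (at x)" for x
    by (rule has_derivative_mult[OF has_derivative_of_real[OF 0] D(1)])
  have 2: "(\<lambda>x. of_real ((x - z) $ j) * D x (axis i 1) + complex_of_real ((axis i 1 :: real^'n) $ j) * f x) \<in> bumps z r" for i
    by (intro bumps.intros D(2) coord)
  show ?case
    by (rule exI[of _ "\<lambda>x v. of_real ((x - z) $ j) * D x v + of_real (v $ j) * f x"]) (use 1 2 in simp)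
next
  case (add f g)
  then obtain D E where D: "\<And>x. (f has_derivative D x) (at x)" "\<And>j. (\<lambda>x. D x (axis j 1)) \<in> bumps z r"
    and E: "\<And>x. (g has_derivative E x) (at x)" "\<And>j. (\<lambda>x. E x (axis j 1)) \<in> bumps z r" by metis
  show ?case
    by (rule exI[of _ "\<lambda>x v. D x v + E x v"]) (auto intro!: has_derivative_add D E bumps.add)
next
  case (cmul f w)
  then obtain D where D: "\<And>x. (f has_derivative D x) (at x)" "\<And>j. (\<lambda>x. D x (axis j 1)) \<in> bumps z r" by blast
  show ?case
    by (rule exI[of _ "\<lambda>x v. w * D x v"]) (auto intro!: has_derivative_mult_right D bumps.cmul)
qed

lemma bumps_C_k: "f \<in> bumps z r \<Longrightarrow> C_k k f"
proof (induction k arbitrary: f)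
  case 0
  then obtain D where "\<And>x. (f has_derivative D x) (at x)" using bumps_derivative by blast
  then show ?case by (auto intro!: continuous_at_imp_continuous_on has_derivative_continuous)
next
  case (Suc k)
  then obtain D where D: "\<And>x. (f has_derivative D x) (at x)" "\<And>j. (\<lambda>x. D x (axis j 1)) \<in> bumps z r"
    using bumps_derivative by blast
  then show ?case using Suc.IH partial_deriv_eqI[of f D] by (auto simp: differentiable_def)
qed

lemma bumps_supp: "f \<in> bumps z r \<Longrightarrow> r \<ge> 0 \<Longrightarrow> norm (x - z) \<ge> r \<Longrightarrow> f x = 0"
proof (induction rule: bumps.induct)
  case (base m)
  then have "r\<^sup>2 \<le> (norm (x - z))\<^sup>2" by (intro power_mono) auto
  then show ?case by (simp add: flat_def)
qed auto

lemma bumps_test_function: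
  assumes "f \<in> bumps z r" "r \<ge> 0"
  shows "test_function f"
proof -
  have "{x. f x \<noteq> 0} \<subseteq> cball z r"
    using bumps_supp[OF assms] by (auto simp: dist_norm norm_minus_commute) (meson le_cases)
  then have "closure {x. f x \<noteq> 0} \<subseteq> cball z r" by (simp add: closure_minimal)
  then have "compact (closure {x. f x \<noteq> 0})" by (meson bounded_cball bounded_subset closed_closure compact_eq_bounded_closed)
  then show ?thesis using bumps_C_k[OF assms(1)] by (simp add: test_function_def)
qed

section \<open>Radial bumps and mollifiers\<close>

definition bump :: "real \<Rightarrow> real^'n::finite \<Rightarrow> real" where
  "bump r x = flat 0 (r\<^sup>2 - (norm x)\<^sup>2)"

text \<open>The chain rule for \<open>bump\<close>: the derivative of \<open>flat 0\<close> is
  \<open>flat 2\<close>.\<close>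

definition bump_pd :: "real \<Rightarrow> 'n::finite \<Rightarrow> real^'n \<Rightarrow> real" where
  "bump_pd r j x = - (2 * x $ j * flat 2 (r\<^sup>2 - (norm x)\<^sup>2))"

lemma continuous_bump: "continuous_on S (bump r)" "continuous_on S (bump_pd r j)"
  unfolding bump_def bump_pd_def
  by (intro continuous_intros continuous_on_compose2[OF continuous_flat[of UNIV]]; simp)+

lemma bump_supp:
  assumes "r > 0" "norm x \<ge> r"
  shows "bump r x = 0" "bump_pd r j x = 0"
proof -
  have "\<not> r\<^sup>2 - (norm x)\<^sup>2 > 0" using power_mono[of r "norm x" 2] assms by (simp add: not_less)
  then show "bump r x = 0" "bump_pd r j x = 0" by (simp_all only: bump_def bump_pd_def flat_def if_False mult_zero_right minus_zero)
qed

lemma cpt_supp_bump: "r > 0 \<Longrightarrow> cpt_supp (bump r)" "r > 0 \<Longrightarrow> cpt_supp (bump_pd r j)"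
  by (auto simp: cpt_supp_def intro!: exI[of _ r] bump_supp)

lemma bump_nonneg: "bump r x \<ge> 0" by (simp add: bump_def flat_nonneg)

lemma bump_pos: "r > 0 \<Longrightarrow> bump r 0 > 0" by (simp add: bump_def flat_def)

lemma bump_has_derivative: "(bump r has_derivative (\<lambda>v. flat 2 (r\<^sup>2 - (norm x)\<^sup>2) * (- (2 * (x \<bullet> v))))) (at x)"
proof -
  have 1: "((\<lambda>x. r\<^sup>2 - (norm x)\<^sup>2) has_derivative (\<lambda>v. - (2 * (x \<bullet> v)))) (at x)"
    unfolding power2_norm_eq_inner
    by (auto intro!: derivative_eq_intros simp: inner_commute)
  show ?thesis unfolding bump_def
    using has_derivative_compose[OF 1 has_field_derivative_imp_has_derivative[OF flat_has_derivative[of 0 "r\<^sup>2 - (norm x)\<^sup>2"]]]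
    by (simp add: numeral_2_eq_2)
qed

lemma has_pd_bump: "has_pd j (bump r) (bump_pd r j)"
proof -
  have "bump_pd r j = partial_deriv j (bump r)"
    by (subst partial_deriv_eqI[OF bump_has_derivative]) (auto simp: fun_eq_iff bump_pd_def inner_axis)
  then show ?thesis
    using bump_has_derivative[of r] unfolding differentiable_def
    by (metis (no_types, lifting) differentiable_def has_pd_partial_deriv)
qed

text \<open>These reflected bumps are the test functions behind convolution: testing against one of
  them evaluates a mollification at x. The reflection is the source of the minus sign in the
  derivative.\<close>

lemma shifted_bump:
  fixes x :: "real^'n::finite"
  assumes "r > 0"
  shows "test_function (\<lambda>y. complex_of_real (k * bump r (x - y)))"
    and "partial_deriv j (\<lambda>y. complex_of_real (k * bump r (x - y))) = (\<lambda>y. - complex_of_real (k * bump_pd r j (x - y)))"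
proof -
  have "(\<lambda>y. of_real k * complex_of_real (flat 0 (r\<^sup>2 - (norm (y - x))\<^sup>2))) \<in> bumps x r"
    by (intro bumps.intros)
  then show "test_function (\<lambda>y. complex_of_real (k * bump r (x - y)))"
    using bumps_test_function[OF _ less_imp_le[OF assms]] by (simp add: bump_def norm_minus_commute of_real_mult)
  have 1: "((\<lambda>y. x - y) has_derivative (\<lambda>v. - v)) (at y)" for y
    by (auto intro!: derivative_eq_intros)
  have "((\<lambda>y. complex_of_real (k * bump r (x - y))) has_derivative
     (\<lambda>v. of_real (k * (flat 2 (r\<^sup>2 - (norm (x - y))\<^sup>2) * (- (2 * ((x - y) \<bullet> (- v)))))))) (at y)" for y
    by (intro has_derivative_of_real has_derivative_mult_right has_derivative_compose[OF 1 bump_has_derivative])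
  from partial_deriv_eqI[OF this]
  show "partial_deriv j (\<lambda>y. complex_of_real (k * bump r (x - y))) = (\<lambda>y. - complex_of_real (k * bump_pd r j (x - y)))"
    by (auto simp: fun_eq_iff bump_pd_def inner_axis)
qed

lemma integrable_bump: "r > 0 \<Longrightarrow> integrable lborel (bump r :: real^'n::finite \<Rightarrow> real)"
  by (intro integrable_cpt_supp continuous_bump cpt_supp_bump)

text \<open>The function stays positive on a ball around a, and balls have positive measure.\<close>

lemma integral_continuous_pos:
  fixes f :: "'a::euclidean_space \<Rightarrow> real"
  assumes c: "continuous_on UNIV f" and i: "integrable lborel f" and n: "\<And>x. f x \<ge> 0" and a: "f a > 0"
  shows "(LINT x|lborel. f x) > 0"
proof -
  have "(LINT x|lborel. f x) \<noteq> 0"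
  proof
    assume "(LINT x|lborel. f x) = 0"
    then have ae: "AE x in lborel. f x = 0"
      using integral_nonneg_eq_0_iff_AE[OF i] n by auto
    have "open {x. f x > 0}" using c by (intro open_Collect_less) auto
    then obtain e where e: "e > 0" "ball a e \<subseteq> {x. f x > 0}"
      using a open_contains_ball by (metis mem_Collect_eq)
    have "AE x in lborel. x \<notin> ball a e" using ae by eventually_elim (use e in auto)
    then have "emeasure lborel (ball a e) = 0"
      by (subst (asm) AE_iff_measurable[OF _ refl]) (auto simp: ball_def dist_norm)
    then show False using content_ball_pos[of e a] e by (simp add: measure_def)
  qed
  moreover have "(LINT x|lborel. f x) \<ge> 0" using n by (rule Bochner_Integration.integral_nonneg)
  ultimately show ?thesis by simp
qed

lemma integral_bump_pos: "r > 0 \<Longrightarrow> (LINT x|lborel. bump r (x :: real^'n::finite)) > 0"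
  by (rule integral_continuous_pos[where a=0]) (simp_all add: continuous_bump integrable_bump bump_nonneg bump_pos)

definition mollifier :: "real \<Rightarrow> real^'n::finite \<Rightarrow> real" where
  "mollifier r x = inverse (LINT y|lborel. bump r (y :: real^'n)) * bump r x"

definition mollifier_pd :: "real \<Rightarrow> 'n::finite \<Rightarrow> real^'n \<Rightarrow> real" where
  "mollifier_pd r j x = inverse (LINT y|lborel. bump r (y :: real^'n)) * bump_pd r j x"

lemma mollifier_props:
  fixes x :: "real^'n::finite"
  assumes "r > 0"
  shows "mollifier r x \<ge> 0" "norm x \<ge> r \<Longrightarrow> mollifier r x = 0"
    "continuous_on UNIV (mollifier r :: real^'n \<Rightarrow> real)" "continuous_on UNIV (mollifier_pd r j :: real^'n \<Rightarrow> real)"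
    "cpt_supp (mollifier r :: real^'n \<Rightarrow> real)" "cpt_supp (mollifier_pd r j :: real^'n \<Rightarrow> real)"
    "has_pd j (mollifier r) (mollifier_pd r j)"
    "(LINT x|lborel. mollifier r (x::real^'n)) = 1"
    "integrable lborel (mollifier r :: real^'n \<Rightarrow> real)"
proof -
  show "mollifier r x \<ge> 0"
    using integral_bump_pos[OF assms, where 'n='n] bump_nonneg[of r x] unfolding mollifier_def
    by (intro mult_nonneg_nonneg) auto
  show "norm x \<ge> r \<Longrightarrow> mollifier r x = 0" using bump_supp assms by (auto simp: mollifier_def)
  show c: "continuous_on UNIV (mollifier r :: real^'n \<Rightarrow> real)" "continuous_on UNIV (mollifier_pd r j :: real^'n \<Rightarrow> real)"
    unfolding mollifier_def mollifier_pd_def by (intro continuous_intros continuous_bump)+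
  show s: "cpt_supp (mollifier r :: real^'n \<Rightarrow> real)" "cpt_supp (mollifier_pd r j :: real^'n \<Rightarrow> real)"
    unfolding mollifier_def mollifier_pd_def by (intro cpt_supp_mult cpt_supp_bump assms)+
  show "has_pd j (mollifier r) (mollifier_pd r j)"
    unfolding mollifier_def mollifier_pd_def
    by (intro has_pd_bounded_linear[OF bounded_linear_mult_right has_pd_bump])
  show "(LINT x|lborel. mollifier r (x::real^'n)) = 1"
    using integral_bump_pos[OF assms, where 'n='n] by (simp add: mollifier_def)
  show "integrable lborel (mollifier r :: real^'n \<Rightarrow> real)" by (intro integrable_cpt_supp c s)
qed

section \<open>Convolution\<close>

definition cont_approx :: "('a::euclidean_space \<Rightarrow> 'b::euclidean_space) \<Rightarrow> bool" where
  "cont_approx f \<longleftrightarrow> (\<forall>e>0. \<exists>g. continuous_on UNIV g \<and> cpt_supp g \<and> (LINT x|lborel. norm (f x - g x)) < e)"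

text \<open>A triangle inequality. Integrability is carried along because the Bochner integral of a
  non-integrable difference is 0, which would make the required bound meaningless.\<close>

lemma cont_approx_L1_closed:
  fixes f :: "'a::euclidean_space \<Rightarrow> 'b::euclidean_space"
  assumes f: "integrable lborel f"
    and h: "\<And>e. e > 0 \<Longrightarrow> \<exists>h. integrable lborel h \<and> cont_approx h \<and> (LINT x|lborel. norm (f x - h x)) < e"
  shows "cont_approx f"
  unfolding cont_approx_def
proof (intro allI impI)
  fix e :: real assume "e > 0"
  then obtain h where h: "integrable lborel h" "cont_approx h" "(LINT x|lborel. norm (f x - h x)) < e / 2"
    using h[of "e/2"] by auto
  then obtain g where g: "continuous_on UNIV g" "cpt_supp g" "(LINT x|lborel. norm (h x - g x)) < e / 2"
    using \<open>e > 0\<close> unfolding cont_approx_def by (meson half_gt_zero)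
  note ig = integrable_cpt_supp[OF g(1,2)]
  have "(LINT x|lborel. norm (f x - g x)) \<le> (LINT x|lborel. norm (f x - h x) + norm (h x - g x))"
    using f h(1) ig by (intro integral_mono) (auto intro: norm_diff_triangle_le)
  also have "\<dots> = (LINT x|lborel. norm (f x - h x)) + (LINT x|lborel. norm (h x - g x))"
    using f h(1) ig by (intro Bochner_Integration.integral_add) auto
  finally have "(LINT x|lborel. norm (f x - g x)) < e" using h(3) g(3) by simp
  then show "\<exists>g. continuous_on UNIV g \<and> cpt_supp g \<and> (LINT x|lborel. norm (f x - g x)) < e"
    using g by blast
qed

text \<open>Dominated convergence turns the pointwise limit into an L^1 limit, under which
  approximability is closed.\<close>

lemma cont_approx_lim:
  fixes f :: "'a::euclidean_space \<Rightarrow> 'b::euclidean_space"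
  assumes f: "f \<in> borel_measurable borel"
    and s: "\<And>i::nat. cont_approx (s i)" "\<And>i. s i \<in> borel_measurable borel"
    and lim: "\<And>x. (\<lambda>i. s i x) \<longlonglongrightarrow> f x"
    and bd: "\<And>i x. norm (s i x) \<le> w x" "integrable lborel w"
  shows "cont_approx f"
proof (rule cont_approx_L1_closed)
  have fb: "norm (f x) \<le> w x" for x
    using Lim_bounded[OF tendsto_norm[OF lim]] bd(1) by blast
  show f': "integrable lborel f"
    by (rule Bochner_Integration.integrable_bound[OF bd(2)]) (use f in \<open>auto intro!: AE_I2 order_trans[OF fb abs_ge_self]\<close>)
  fix e :: real assume "e > 0"
  have si: "integrable lborel (s i)" for i
    by (rule Bochner_Integration.integrable_bound[OF bd(2)]) (use s in \<open>auto intro!: AE_I2 order_trans[OF bd(1) abs_ge_self]\<close>)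
  have "(\<lambda>i. LINT x|lborel. norm (f x - s i x)) \<longlonglongrightarrow> (LINT x|(lborel::'a measure). (0::real))"
  proof (rule integral_dominated_convergence[where w="\<lambda>x. 2 * w x"])
    show "integrable lborel (\<lambda>x. 2 * w x)" using bd by simp
    show "AE x in lborel. (\<lambda>i. norm (f x - s i x)) \<longlonglongrightarrow> 0"
      using tendsto_norm_zero[OF LIM_zero[OF lim]] by (simp add: norm_minus_commute)
    show "AE x in lborel. norm (norm (f x - s i x)) \<le> 2 * w x" for i
    proof (rule AE_I2)
      fix x show "norm (norm (f x - s i x)) \<le> 2 * w x"
        using norm_triangle_ineq4[of "f x" "s i x"] fb[of x] bd(1)[of i x] by simp
    qed
  qed (use f s in auto)
  then have "\<forall>\<^sub>F i in sequentially. (LINT x|lborel. norm (f x - s i x)) < e"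
    using \<open>e > 0\<close> by (intro order_tendstoD(2)) auto
  then obtain i where "(LINT x|lborel. norm (f x - s i x)) < e"
    by (meson eventually_happens trivial_limit_sequentially)
  then show "\<exists>h. integrable lborel h \<and> cont_approx h \<and> (LINT x|lborel. norm (f x - h x)) < e"
    using si s by blast
qed

lemma cont_approx_compact:
  fixes K :: "'a::euclidean_space set" and c :: "'b::euclidean_space"
  assumes "compact K"
  shows "cont_approx (\<lambda>x. indicator K x *\<^sub>R c)"
\<comment> \<open>The distance \<open>infdist\<close> to the empty set is 0 by convention, so the
  functions used below would be constant and not compactly supported.\<close>
proof (cases "K = {}")
  case True
  then show ?thesis unfolding cont_approx_def
    by (auto intro!: exI[of _ "\<lambda>_. 0"] simp: cpt_supp_def)
next
  case False
  obtain R where R: "\<And>x. x \<in> K \<Longrightarrow> norm x \<le> R"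
    using compact_imp_bounded[OF assms] by (auto simp: bounded_iff)
  \<comment> \<open>Tents of width \<open>1 / (i + 1)\<close> over K: they equal c on K, decrease
    pointwise to 0 off K, and all vanish at distance at least 1 from K.\<close>
  define s where "s i x = max 0 (1 - real (Suc i) * infdist x K) *\<^sub>R c" for i :: nat and x
  have cs: "continuous_on UNIV (s i)" for i
    unfolding s_def by (intro continuous_intros)
  have z: "norm x \<le> R + 1" if "infdist x K \<le> 1" for x
  proof -
    obtain y where "y \<in> K" "infdist x K = dist x y"
      using infdist_attains_inf[OF compact_imp_closed[OF assms] False] by blast
    then show ?thesis using that R[of y] norm_triangle_ineq2[of x y] by (simp add: dist_norm)
  qed
  have z2: "s i x = 0" if "norm x > R + 1" for i x
  proof -
    have "infdist x K > 1" using z[of x] that by linarith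
    then have "real (Suc i) * infdist x K \<ge> 1 * 1" by (intro mult_mono) auto
    then show ?thesis by (simp add: s_def)
  qed
  have ss: "cpt_supp (s i)" for i using z2 by (auto simp: cpt_supp_def)
  show ?thesis
  proof (rule cont_approx_lim[where s=s and w="\<lambda>x. indicator (cball 0 (R+1)) x * norm c"])
    show "cont_approx (s i)" for i unfolding cont_approx_def using cs ss by (intro allI impI exI[of _ "s i"]) auto
    show "s i \<in> borel_measurable borel" for i by (rule borel_measurable_continuous_onI[OF cs])
    show "(\<lambda>x. indicator K x *\<^sub>R c) \<in> borel_measurable borel"
      using borel_compact[OF assms] by measurable
    show "norm (s i x) \<le> indicator (cball 0 (R+1)) x * norm c" for i x
    proof (cases "norm x > R + 1")
      case True then show ?thesis using z2[of x i] by simp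
    next
      case False
      have "\<bar>max 0 (1 - real (Suc i) * infdist x K)\<bar> \<le> 1" using infdist_nonneg[of x K] by (auto simp: max_def)
      then have "\<bar>max 0 (1 - real (Suc i) * infdist x K)\<bar> * norm c \<le> 1 * norm c" by (intro mult_right_mono) auto
      then show ?thesis using False by (simp add: s_def)
    qed
    show "integrable lborel (\<lambda>x. indicator (cball (0::'a) (R+1)) x * norm c)"
      using emeasure_lborel_cball_finite[of "0::'a" "R+1"]
      by (auto intro!: integrable_mult_left integrable_real_indicator)
    show "(\<lambda>i. s i x) \<longlonglongrightarrow> indicator K x *\<^sub>R c" for x
    proof (cases "x \<in> K")
      case True then show ?thesis by (simp add: s_def)
    next
      case x: False
      then have d: "infdist x K > 0"
        using in_closed_iff_infdist_zero[OF compact_imp_closed[OF assms] False] infdist_nonneg[of x K] by fastforce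
      then obtain n where n: "real n * infdist x K > 1" using reals_Archimedean3 by blast
      have "s i x = 0" if "i \<ge> n" for i
      proof -
        have "real n * infdist x K \<le> real (Suc i) * infdist x K" using that d by (intro mult_right_mono) auto
        then show ?thesis using n by (simp add: s_def)
      qed
      then have "(\<lambda>i. s i x) \<longlonglongrightarrow> 0" by (intro tendsto_eventually eventually_sequentiallyI)
      then show ?thesis using x by simp
    qed
  qed
qed

text \<open>Induction over integrable functions. For an indicator, inner regularity supplies a
  closed subset of almost full measure, which is exhausted by its compact intersections with
  balls.\<close>

lemma cont_approx_integrable:
  fixes f :: "'a::euclidean_space \<Rightarrow> 'b::euclidean_space"
  assumes "integrable lborel f"
  shows "cont_approx f"
  using assms
proof (induction rule: integrable_induct)
  case (base A c)
  have cl: "cont_approx (\<lambda>x. indicator T x *\<^sub>R c)" if T: "closed T" "T \<subseteq> A" for T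
  proof (rule cont_approx_lim[where s="\<lambda>n x. indicator (T \<inter> cball 0 (real n)) x *\<^sub>R c" and w="\<lambda>x. indicator A x * norm c"])
    show "cont_approx (\<lambda>x. indicator (T \<inter> cball 0 (real n)) x *\<^sub>R c)" for n
      using T by (intro cont_approx_compact) auto
    show "integrable lborel (\<lambda>x. indicator A x * norm c)" using base by auto
    show "norm (indicator (T \<inter> cball 0 (real n)) x *\<^sub>R c) \<le> indicator A x * norm c" for n x
      using T by (auto simp: indicator_def)
    show "(\<lambda>n. indicator (T \<inter> cball 0 (real n)) x *\<^sub>R c) \<longlonglongrightarrow> indicator T x *\<^sub>R c" for x
    proof -
      obtain m where "norm x \<le> real m" using real_arch_simple by blast
      then have "\<And>n. n \<ge> m \<Longrightarrow> indicator (T \<inter> cball 0 (real n)) x *\<^sub>R c = indicator T x *\<^sub>R c"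
        by (auto simp: indicator_def)
      then show ?thesis by (intro tendsto_eventually eventually_sequentiallyI)
    qed
    show "(\<lambda>x. indicator (T \<inter> cball 0 (real n)) x *\<^sub>R c) \<in> borel_measurable borel" for n
      using T by (intro borel_measurable_scaleR borel_measurable_indicator) auto
  qed (use T in auto)
  have fin: "emeasure lborel T < \<infinity>" if "T \<subseteq> A" "T \<in> sets borel" for T
    using emeasure_mono[OF that(1), of lborel] base by (simp add: order_le_less_trans)
  show ?case
  proof (rule cont_approx_L1_closed)
    show "integrable lborel (\<lambda>x. indicator A x *\<^sub>R c)" using base by auto
    fix e :: real assume e: "e > 0"
    \<comment> \<open>The summand 1 keeps the denominator positive when c is 0.\<close>
    define d where "d = e / (norm c + 1)"
    have d: "d > 0" "d * norm c < e"
      using e by (simp_all add: d_def field_simps add_pos_nonneg)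
    have "A \<in> sets lebesgue" using base by simp
    then obtain T where T: "closed T" "T \<subseteq> A" "A - T \<in> lmeasurable" "emeasure lebesgue (A - T) < ennreal d"
      using sets_lebesgue_inner_closed[of A d] d by blast
    have T': "T \<in> sets borel" using T by auto
    have "emeasure lborel (A - T) < ennreal d" using T base T' by simp
    then have m: "measure lborel (A - T) < d"
      using d by (metis emeasure_eq_ennreal_measure ennreal_less_iff measure_nonneg top.not_eq_extremum order_less_trans ennreal_less_top)
    have "(LINT x|lborel. norm (indicator A x *\<^sub>R c - indicator T x *\<^sub>R c)) = (LINT x|lborel. indicator (A - T) x * norm c)"
      using T by (intro Bochner_Integration.integral_cong) (auto simp: indicator_def)
    also have "\<dots> = measure lborel (A - T) * norm c" by simp
    also have "\<dots> \<le> d * norm c" using m by (intro mult_right_mono) auto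
    finally have "(LINT x|lborel. norm (indicator A x *\<^sub>R c - indicator T x *\<^sub>R c)) < e" using d by simp
    moreover have "integrable lborel (\<lambda>x. indicator T x *\<^sub>R c)" using fin[OF T(2) T'] T' by auto
    ultimately show "\<exists>h. integrable lborel h \<and> cont_approx h \<and> (LINT x|lborel. norm (indicator A x *\<^sub>R c - h x)) < e"
      using cl[OF T(1,2)] by blast
  qed
next
  case (add f g)
  show ?case unfolding cont_approx_def
  proof (intro allI impI)
    fix e :: real assume "e > 0"
    then obtain f' g' where f': "continuous_on UNIV f'" "cpt_supp f'" "(LINT x|lborel. norm (f x - f' x)) < e / 2"
      and g': "continuous_on UNIV g'" "cpt_supp g'" "(LINT x|lborel. norm (g x - g' x)) < e / 2"
      using add unfolding cont_approx_def by (meson half_gt_zero)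
    have "cpt_supp (\<lambda>x. f' x + g' x)"
    proof -
      obtain R S where "\<And>x. norm x > R \<Longrightarrow> f' x = 0" "\<And>x. norm x > S \<Longrightarrow> g' x = 0"
        using f' g' by (auto simp: cpt_supp_def)
      then show ?thesis unfolding cpt_supp_def by (intro exI[of _ "max R S"]) auto
    qed
    moreover have "continuous_on UNIV (\<lambda>x. f' x + g' x)" using f' g' by (intro continuous_intros)
    moreover have "(LINT x|lborel. norm (f x + g x - (f' x + g' x))) < e"
    proof -
      note i = integrable_cpt_supp[OF f'(1,2)] integrable_cpt_supp[OF g'(1,2)]
      have "(LINT x|lborel. norm (f x + g x - (f' x + g' x))) \<le> (LINT x|lborel. norm (f x - f' x) + norm (g x - g' x))"
        using add i by (intro integral_mono) (auto intro: norm_diff_triangle_ineq)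
      also have "\<dots> = (LINT x|lborel. norm (f x - f' x)) + (LINT x|lborel. norm (g x - g' x))"
        using add i by (intro Bochner_Integration.integral_add) auto
      finally show ?thesis using f' g' by simp
    qed
    ultimately show "\<exists>h. continuous_on UNIV h \<and> cpt_supp h \<and> (LINT x|lborel. norm (f x + g x - h x)) < e"
      by blast
  qed
next
  case (lim f s)
  show ?case
    by (rule cont_approx_lim[where s=s and w="\<lambda>x. 2 * norm (f x)"]) (use lim in auto)
qed

section \<open>Convolution with compactly supported kernels\<close>

definition loc_int :: "('a::euclidean_space \<Rightarrow> 'b::euclidean_space) \<Rightarrow> bool" where
  "loc_int f \<longleftrightarrow> f \<in> borel_measurable borel \<and> (\<forall>R. integrable lborel (\<lambda>x. indicator (cball 0 R) x *\<^sub>R f x))"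

text \<open>The point x enters through the kernel only, so continuity and derivatives of the kernel
  pass to the convolution. Integration is over \<open>lborel\<close>, where joint measurability is
  at hand; this is why \<open>loc_int\<close> asks for Borel measurability.\<close>

definition conv :: "('a::euclidean_space \<Rightarrow> real) \<Rightarrow> ('a \<Rightarrow> 'b::euclidean_space) \<Rightarrow> 'a \<Rightarrow> 'b" where
  "conv k f x = (LINT y|lborel. k (x - y) *\<^sub>R f y)"

lemma cpt_supp_bounded:
  fixes f :: "'a::euclidean_space \<Rightarrow> 'b::euclidean_space"
  assumes "continuous_on UNIV f" "cpt_supp f"
  obtains C S where "C > 0" "S \<ge> 0" "\<And>x. norm (f x) \<le> C" "\<And>x. norm x > S \<Longrightarrow> f x = 0"
proof -
  obtain R where R: "\<And>x. norm x > R \<Longrightarrow> f x = 0" using assms by (auto simp: cpt_supp_def)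
  have "compact (f ` cball 0 (max R 0))"
    by (intro compact_continuous_image continuous_on_subset[OF assms(1)]) auto
  then obtain C where C: "C > 0" "\<And>y. y \<in> f ` cball 0 (max R 0) \<Longrightarrow> norm y \<le> C"
    using compact_imp_bounded bounded_pos by metis
  show thesis
  proof (rule that[of C "max R 0"])
    show "norm (f x) \<le> C" for x
    proof (cases "norm x > R")
      case True then show ?thesis using R C by simp
    next
      case False then show ?thesis using C(2)[of "f x"] by auto
    qed
  qed (use C R in auto)
qed

lemma conv_dominated:
  fixes f :: "'a::euclidean_space \<Rightarrow> 'b::euclidean_space"
  assumes f: "loc_int f" and k: "k \<in> borel_measurable borel" "\<And>x. \<bar>k x\<bar> \<le> C" "\<And>y. norm y > R \<Longrightarrow> k y = 0"
  shows "integrable lborel (\<lambda>y. k y *\<^sub>R f y)"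
    and "norm (k y *\<^sub>R f y) \<le> C * norm (indicator (cball 0 R) y *\<^sub>R f y)"
proof -
  show b: "norm (k y *\<^sub>R f y) \<le> C * norm (indicator (cball 0 R) y *\<^sub>R f y)" for y
    using k(2)[of y] k(3)[of y] by (auto simp: indicator_def intro: mult_right_mono)
  have "integrable lborel (\<lambda>y. C * norm (indicator (cball 0 R) y *\<^sub>R f y))"
    using f unfolding loc_int_def by (intro integrable_mult_right integrable_norm) blast
  then show "integrable lborel (\<lambda>y. k y *\<^sub>R f y)"
    by (rule Bochner_Integration.integrable_bound)
       (use k(1) f in \<open>auto simp: loc_int_def simp del: norm_scaleR intro!: AE_I2 order_trans[OF b[unfolded real_norm_def] abs_ge_self]\<close>)
qed

text \<open>The common dominating function is the kernel bound times the restriction of f to a ball.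
  It serves both the continuity of convolutions and their difference quotients.\<close>

lemma conv_tendsto:
  fixes f :: "'a::euclidean_space \<Rightarrow> 'b::euclidean_space"
  assumes f: "loc_int f" and k: "\<And>n::nat. k n \<in> borel_measurable borel" "k' \<in> borel_measurable borel" 
    "\<And>n y. \<bar>k n y\<bar> \<le> C" "\<And>n y. norm y > R \<Longrightarrow> k n y = 0" "\<And>y. (\<lambda>n. k n y) \<longlonglongrightarrow> k' y"
  shows "(\<lambda>n. LINT y|lborel. k n y *\<^sub>R f y) \<longlonglongrightarrow> (LINT y|lborel. k' y *\<^sub>R f y)"
proof (rule integral_dominated_convergence[where w="\<lambda>y. C * norm (indicator (cball 0 R) y *\<^sub>R f y)"])
  show "integrable lborel (\<lambda>y. C * norm (indicator (cball 0 R) y *\<^sub>R f y))"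
    using f unfolding loc_int_def by (intro integrable_mult_right integrable_norm) blast
  show "AE y in lborel. norm (k n y *\<^sub>R f y) \<le> C * norm (indicator (cball 0 R) y *\<^sub>R f y)" for n
    using conv_dominated(2)[OF f k(1) k(3) k(4)] by (intro AE_I2)
  show "AE y in lborel. (\<lambda>n. k n y *\<^sub>R f y) \<longlonglongrightarrow> k' y *\<^sub>R f y"
    by (intro AE_I2 tendsto_intros k)
qed (use f k in \<open>auto simp: loc_int_def\<close>)

lemma integrable_conv:
  fixes f :: "'a::euclidean_space \<Rightarrow> 'b::euclidean_space"
  assumes f: "loc_int f" and k: "continuous_on UNIV k" "cpt_supp k"
  shows "integrable lborel (\<lambda>y. k (x - y) *\<^sub>R f y)"
proof -
  obtain C S where C: "C > 0" "S \<ge> 0" "\<And>x. norm (k x) \<le> C" "\<And>x. norm x > S \<Longrightarrow> k x = 0"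
    using cpt_supp_bounded[OF k] by metis
  have z: "k (x - y) = 0" if "norm y > norm x + S" for y
    by (rule C(4)) (use that norm_triangle_ineq3[of x y] in auto)
  have "continuous_on UNIV (\<lambda>y. k (x - y))"
    by (intro continuous_on_compose2[OF k(1)] continuous_intros) auto
  then show ?thesis using C z borel_measurable_continuous_onI
    by (intro conv_dominated(1)[OF f, where C=C and R="norm x + S"]) auto
qed

lemma continuous_conv:
  fixes f :: "'a::euclidean_space \<Rightarrow> 'b::euclidean_space"
  assumes f: "loc_int f" and k: "continuous_on UNIV k" "cpt_supp k"
  shows "continuous_on UNIV (conv k f)"
proof (rule continuous_on_sequentiallyI)
  fix u :: "nat \<Rightarrow> 'a" and a assume u: "u \<longlonglongrightarrow> a"
  obtain C S where C: "C > 0" "S \<ge> 0" "\<And>x. norm (k x) \<le> C" "\<And>x. norm x > S \<Longrightarrow> k x = 0"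
    using cpt_supp_bounded[OF k] by metis
  obtain B where B: "\<And>n. norm (u n) \<le> B" using convergent_imp_Bseq[OF convergentI[OF u]] by (auto simp: Bseq_def)
  have ck: "continuous_on UNIV (\<lambda>y. k (x - y))" for x
    by (intro continuous_on_compose2[OF k(1)] continuous_intros) auto
  have z: "k (u n - y) = 0" if "norm y > B + S" for y n
    by (rule C(4)) (use that B[of n] norm_triangle_ineq3[of "u n" y] in auto)
  show "(\<lambda>n. conv k f (u n)) \<longlonglongrightarrow> conv k f a"
    unfolding conv_def
  proof (rule conv_tendsto[OF f, where C=C and R="B+S"])
    show "(\<lambda>n. k (u n - y)) \<longlonglongrightarrow> k (a - y)" for y
      by (rule continuous_on_tendsto_compose[OF k(1)]) (auto intro!: tendsto_intros u)
  qed (use C z borel_measurable_continuous_onI[OF ck] in auto)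
qed

section \<open>Differentiation of convolutions\<close>

lemma has_vector_derivative_0I:
  assumes "((\<lambda>h. (f h - f 0) /\<^sub>R h) \<longlongrightarrow> D) (at (0::real))"
  shows "(f has_vector_derivative D) (at 0)"
proof -
  have "((\<lambda>h. norm ((f h - f 0) /\<^sub>R h - D)) \<longlongrightarrow> 0) (at 0)"
    by (rule tendsto_norm_zero[OF LIM_zero[OF assms]])
  moreover have "\<forall>\<^sub>F h in at 0. norm ((f h - f 0) /\<^sub>R h - D) = norm (f (0 + h) - f 0 - h *\<^sub>R D) / norm h"
  proof -
    have "norm ((f h - f 0) /\<^sub>R h - D) = norm (f (0 + h) - f 0 - h *\<^sub>R D) / norm h" if "h \<noteq> 0" for h
    proof -
      have "(f h - f 0) /\<^sub>R h - D = (f (0 + h) - f 0 - h *\<^sub>R D) /\<^sub>R h" using that by (simp add: algebra_simps)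
      then show ?thesis by (simp add: divide_inverse mult.commute)
    qed
    then show ?thesis by (auto simp: eventually_at_filter)
  qed
  ultimately have "((\<lambda>h. norm (f (0 + h) - f 0 - h *\<^sub>R D) / norm h) \<longlongrightarrow> 0) (at 0)"
    by (rule Lim_transform_eventually)
  then show ?thesis
    unfolding has_vector_derivative_def has_derivative_at by (auto intro: bounded_linear_scaleR_left)
qed

lemma has_vector_derivative_0D:
  assumes "(f has_vector_derivative D) (at (0::real))"
  shows "((\<lambda>h. (f h - f 0) /\<^sub>R h) \<longlongrightarrow> D) (at 0)"
proof -
  have "((\<lambda>h. norm (f (0 + h) - f 0 - h *\<^sub>R D) / norm h) \<longlongrightarrow> 0) (at 0)"
    using assms unfolding has_vector_derivative_def has_derivative_at by blast
  moreover have "\<forall>\<^sub>F h in at 0. norm (f (0 + h) - f 0 - h *\<^sub>R D) / norm h = norm ((f h - f 0) /\<^sub>R h - D)"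
  proof -
    have "norm ((f h - f 0) /\<^sub>R h - D) = norm (f (0 + h) - f 0 - h *\<^sub>R D) / norm h" if "h \<noteq> 0" for h
    proof -
      have "(f h - f 0) /\<^sub>R h - D = (f (0 + h) - f 0 - h *\<^sub>R D) /\<^sub>R h" using that by (simp add: algebra_simps)
      then show ?thesis by (simp add: divide_inverse mult.commute)
    qed
    then show ?thesis by (auto simp: eventually_at_filter)
  qed
  ultimately have "((\<lambda>h. norm ((f h - f 0) /\<^sub>R h - D)) \<longlongrightarrow> 0) (at 0)"
    by (rule Lim_transform_eventually)
  then show ?thesis by (rule LIM_zero_cancel[OF tendsto_norm_zero_cancel])
qed

text \<open>The difference quotients of the kernel are bounded by the supremum of \<open>k'\<close>.
  For a bounded sequence of increments they live in one common ball, so dominated convergence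
  applies even though f is only locally integrable.\<close>

lemma has_pd_conv:
  fixes f :: "real^'n::finite \<Rightarrow> 'b::euclidean_space"
  assumes f: "loc_int f" and k: "continuous_on UNIV k" "cpt_supp k"
    and d: "has_pd j k k'" and k': "continuous_on UNIV k'"
  shows "has_pd j (conv k f) (conv k' f)"
  unfolding has_pd_def
proof
  fix x
  let ?e = "axis j (1::real) :: real^'n"
  have s': "cpt_supp k'" using cpt_supp_has_pd[OF d k(2)] .
  obtain C S where C: "C > 0" "S \<ge> 0" "\<And>x. norm (k x) \<le> C" "\<And>x. norm x > S \<Longrightarrow> k x = 0"
    using cpt_supp_bounded[OF k] by metis
  obtain C' where C': "\<And>x. norm (k' x) \<le> C'"
    using cpt_supp_bounded[OF k' s'] by metis
  have lip: "\<bar>k (z + t *\<^sub>R ?e) - k z\<bar> \<le> C' * \<bar>t\<bar>" for z t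
  proof -
    have "norm (k (z + t *\<^sub>R ?e) - k (z + 0 *\<^sub>R ?e)) \<le> C' * norm (t - 0)"
    proof (rule field_differentiable_bound[where S=UNIV and f'="\<lambda>t. k' (z + t *\<^sub>R ?e)"])
      fix t show "((\<lambda>t. k (z + t *\<^sub>R ?e)) has_real_derivative k' (z + t *\<^sub>R ?e)) (at t within UNIV)"
        using has_pd_at[OF d] by (simp add: has_real_derivative_iff_has_vector_derivative)
      show "norm (k' (z + t *\<^sub>R ?e)) \<le> C'" using C' .
    qed auto
    then show ?thesis by simp
  qed
  have ck: "continuous_on UNIV (\<lambda>y. k (x - y))" "continuous_on UNIV (\<lambda>y. k' (x - y))" for x
    by (intro continuous_on_compose2[OF k(1)] continuous_on_compose2[OF k'] continuous_intros; simp)+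
  note mk = borel_measurable_continuous_onI[OF ck(1)] borel_measurable_continuous_onI[OF ck(2)]
  have "((\<lambda>h. (conv k f (x + h *\<^sub>R ?e) - conv k f (x + 0 *\<^sub>R ?e)) /\<^sub>R h) \<longlongrightarrow> conv k' f x) (at 0)"
    unfolding tendsto_at_iff_sequentially
  proof (intro allI impI)
    fix t :: "nat \<Rightarrow> real" assume t: "\<forall>i. t i \<in> UNIV - {0}" "t \<longlonglongrightarrow> 0"
    obtain B where B: "\<And>n. norm (t n) \<le> B" using convergent_imp_Bseq[OF convergentI[OF t(2)]] by (auto simp: Bseq_def)
    define K where "K n y = (k (x + t n *\<^sub>R ?e - y) - k (x - y)) / t n" for n y
    have eq: "(conv k f (x + t n *\<^sub>R ?e) - conv k f (x + 0 *\<^sub>R ?e)) /\<^sub>R t n = (LINT y|lborel. K n y *\<^sub>R f y)" for n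
    proof -
      have "(LINT y|lborel. K n y *\<^sub>R f y) = (LINT y|lborel. (k (x + t n *\<^sub>R ?e - y) *\<^sub>R f y - k (x - y) *\<^sub>R f y) /\<^sub>R t n)"
        by (intro Bochner_Integration.integral_cong) (auto simp: K_def divide_inverse algebra_simps)
      also have "\<dots> = ((LINT y|lborel. k (x + t n *\<^sub>R ?e - y) *\<^sub>R f y) - (LINT y|lborel. k (x - y) *\<^sub>R f y)) /\<^sub>R t n"
        using integrable_conv[OF f k]
        by (simp only: integral_scaleR_right, subst Bochner_Integration.integral_diff) auto
      finally show ?thesis by (simp add: conv_def)
    qed
    have "(\<lambda>n. LINT y|lborel. K n y *\<^sub>R f y) \<longlonglongrightarrow> (LINT y|lborel. k' (x - y) *\<^sub>R f y)"
    proof (rule conv_tendsto[OF f, where C=C' and R="norm x + B + S"])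
      show "K n \<in> borel_measurable borel" for n unfolding K_def using mk by measurable
      show "(\<lambda>y. k' (x - y)) \<in> borel_measurable borel" by (rule mk)
      show "\<bar>K n y\<bar> \<le> C'" for n y
        using lip[of "x - y" "t n"] t(1) by (simp add: K_def divide_le_eq algebra_simps)
      show "K n y = 0" if "norm y > norm x + B + S" for n y
      proof -
        have "norm (t n *\<^sub>R ?e) \<le> B" using B[of n] by simp
        moreover have "norm y \<le> norm (x + t n *\<^sub>R ?e - y) + norm x + norm (t n *\<^sub>R ?e)"
          using norm_triangle_ineq[of "x + t n *\<^sub>R ?e - y" "y"] norm_triangle_ineq4[of "x + t n *\<^sub>R ?e" "x + t n *\<^sub>R ?e - y"]
            norm_triangle_ineq[of x "t n *\<^sub>R ?e"] by simp
        ultimately have "norm (x + t n *\<^sub>R ?e - y) > S" using that by linarith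
        moreover have "norm (x - y) > S" using that B[of n] norm_triangle_ineq3[of x y] norm_ge_zero[of "t n"] by linarith
        ultimately show ?thesis using C(4) by (simp add: K_def)
      qed
      show "(\<lambda>n. K n y) \<longlonglongrightarrow> k' (x - y)" for y
      proof -
        have "((\<lambda>h. (k (x - y + h *\<^sub>R ?e) - k (x - y + 0 *\<^sub>R ?e)) /\<^sub>R h) \<longlongrightarrow> k' (x - y)) (at 0)"
          using d by (intro has_vector_derivative_0D) (auto simp: has_pd_def)
        then have "((\<lambda>h. (k (x - y + h *\<^sub>R ?e) - k (x - y + 0 *\<^sub>R ?e)) /\<^sub>R h) \<circ> t) \<longlonglongrightarrow> k' (x - y)"
          using t unfolding tendsto_at_iff_sequentially by blast
        then show ?thesis by (simp add: o_def K_def divide_inverse algebra_simps)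
      qed
    qed
    then show "((\<lambda>h. (conv k f (x + h *\<^sub>R ?e) - conv k f (x + 0 *\<^sub>R ?e)) /\<^sub>R h) \<circ> t) \<longlonglongrightarrow> conv k' f x"
      unfolding o_def eq by (simp add: conv_def)
  qed
  then show "((\<lambda>t. conv k f (x + t *\<^sub>R ?e)) has_vector_derivative conv k' f x) (at 0)"
    by (rule has_vector_derivative_0I)
qed

section \<open>Mollification\<close>

lemma loc_int_integrable:
  fixes f :: "'a::euclidean_space \<Rightarrow> 'b::euclidean_space"
  assumes "integrable lborel f" shows "loc_int f"
  unfolding loc_int_def
  using assms integrable_mult_indicator[of "cball 0 _" lborel f] by auto

lemma loc_int_square:
  fixes f :: "'a::euclidean_space \<Rightarrow> 'b::euclidean_space"
  assumes m: "f \<in> borel_measurable borel" and i: "integrable lborel (\<lambda>x. (norm (f x))\<^sup>2)"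
  shows "loc_int f"
  unfolding loc_int_def
proof (intro conjI allI m)
  fix R
  have 1: "integrable lborel (\<lambda>x. indicator (cball 0 R) x + (norm (f x))\<^sup>2)"
    using emeasure_lborel_cball_finite[of "0::'a" R] i
    by (auto intro!: integrable_real_indicator)
  have 2: "norm (indicator (cball 0 R) x *\<^sub>R f x) \<le> norm (indicator (cball 0 R) x + (norm (f x))\<^sup>2)" for x
  proof -
    have "norm (f x) \<le> 1 + (norm (f x))\<^sup>2"
      using zero_le_power2[of "norm (f x) - 1"] zero_le_power2[of "norm (f x)"] unfolding power2_diff
      by (simp; linarith)
    then show ?thesis by (auto simp: indicator_def)
  qed
  show "integrable lborel (\<lambda>x. indicator (cball 0 R) x *\<^sub>R f x)"
    by (rule Bochner_Integration.integrable_bound[OF 1]) (use m 2 in \<open>auto intro!: borel_measurable_scaleR borel_measurable_indicator simp del: norm_scaleR\<close>)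
qed

section \<open>Norm bounds for convolution with a probability density\<close>

definition kernel :: "('a::euclidean_space \<Rightarrow> real) \<Rightarrow> bool" where
  "kernel k \<longleftrightarrow> continuous_on UNIV k \<and> cpt_supp k \<and> (\<forall>x. k x \<ge> 0) \<and> (LINT x|lborel. k x) = 1"

lemma kernel_mollifier: "r > 0 \<Longrightarrow> kernel (mollifier r :: real^'n::finite \<Rightarrow> real)"
  by (simp add: kernel_def mollifier_props)

lemma integrable_norm_conv:
  fixes f :: "'a::euclidean_space \<Rightarrow> 'b::euclidean_space"
  assumes "kernel k" "loc_int f"
  shows "integrable lborel (\<lambda>y. k (x - y) * norm (f y))"
  using integrable_norm[OF integrable_conv[OF assms(2), of k x]] assms(1)
  by (simp add: kernel_def)

lemma norm_conv_le:
  fixes f :: "'a::euclidean_space \<Rightarrow> 'b::euclidean_space"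
  assumes "kernel k" "loc_int f"
  shows "norm (conv k f x) \<le> conv k (\<lambda>y. norm (f y)) x"
  unfolding conv_def
  using integral_norm_bound[of lborel "\<lambda>y. k (x - y) *\<^sub>R f y"] assms(1)
  by (simp add: kernel_def)

lemma kernel_integral:
  fixes k :: "'a::euclidean_space \<Rightarrow> real"
  assumes k: "kernel k"
  shows "integrable lborel (\<lambda>y. k (x - y))" "(LINT y|lborel. k (x - y)) = 1"
proof -
  have c: "k \<in> borel_measurable borel" using k by (auto simp: kernel_def intro: borel_measurable_continuous_onI)
  have i: "integrable lborel k" using k by (auto simp: kernel_def intro: integrable_cpt_supp)
  show "integrable lborel (\<lambda>y. k (x - y))" "(LINT y|lborel. k (x - y)) = 1"
    using lborel_affine_integral[OF c, of "-1" x] i k by (simp_all add: kernel_def)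
qed

text \<open>Tonelli: integrated in x first, the kernel contributes the factor 1. Computing in
  \<open>ennreal\<close> yields integrability together with the value.\<close>

lemma integral_conv:
  fixes F :: "'a::euclidean_space \<Rightarrow> real"
  assumes k: "kernel k" and F: "integrable lborel F" "\<And>x. F x \<ge> 0"
  shows "integrable lborel (conv k F)" "(LINT x|lborel. conv k F x) = (LINT x|lborel. F x)"
proof -
  have l: "loc_int F" using loc_int_integrable[OF F(1)] .
  have kc: "continuous_on UNIV k" "cpt_supp k" "k \<in> borel_measurable borel" "\<And>x. k x \<ge> 0"
    using k by (auto simp: kernel_def intro: borel_measurable_continuous_onI)
  have nn: "conv k F x \<ge> 0" for x unfolding conv_def using F kc by (intro Bochner_Integration.integral_nonneg) auto
  have m: "(\<lambda>(x, y). ennreal (k (x - y) * F y)) \<in> borel_measurable (lborel \<Otimes>\<^sub>M lborel)"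
  proof -
    have "continuous_on UNIV (\<lambda>p::'a\<times>'a. k (fst p - snd p))"
      by (intro continuous_on_compose2[OF kc(1)] continuous_intros) auto
    then have "(\<lambda>p::'a\<times>'a. k (fst p - snd p)) \<in> borel_measurable (lborel \<Otimes>\<^sub>M lborel)"
      using borel_measurable_continuous_onI by (simp add: lborel_prod)
    moreover have "(\<lambda>p::'a\<times>'a. F (snd p)) \<in> borel_measurable (lborel \<Otimes>\<^sub>M lborel)"
      using F(1) by measurable
    ultimately show ?thesis unfolding case_prod_beta by measurable
  qed
  have "(\<integral>\<^sup>+ x. ennreal (conv k F x) \<partial>lborel) = (\<integral>\<^sup>+ x. \<integral>\<^sup>+ y. ennreal (k (x - y) * F y) \<partial>lborel \<partial>lborel)"
  proof (intro nn_integral_cong)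
    fix x
    show "ennreal (conv k F x) = (\<integral>\<^sup>+ y. ennreal (k (x - y) * F y) \<partial>lborel)"
      using integrable_conv[OF l kc(1,2), of x] F kc unfolding conv_def
      by (subst nn_integral_eq_integral) auto
  qed
  also have "\<dots> = (\<integral>\<^sup>+ y. \<integral>\<^sup>+ x. ennreal (k (x - y) * F y) \<partial>lborel \<partial>lborel)"
    using lborel_pair.Fubini'[OF m] by simp
  also have "\<dots> = (\<integral>\<^sup>+ y. ennreal (F y) \<partial>lborel)"
  proof (intro nn_integral_cong)
    fix y
    have i: "integrable lborel (\<lambda>x. k (x - y))" "(LINT x|lborel. k (x - y)) = 1"
      using lborel_translate_integral[OF kc(3), of "- y"] k integrable_cpt_supp[OF kc(1,2)] by (auto simp: kernel_def)
    have "(\<integral>\<^sup>+ x. ennreal (k (x - y) * F y) \<partial>lborel) = ennreal (LINT x|lborel. k (x - y) * F y)"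
      using i F kc by (intro nn_integral_eq_integral) auto
    then show "(\<integral>\<^sup>+ x. ennreal (k (x - y) * F y) \<partial>lborel) = ennreal (F y)" using i by simp
  qed
  also have "\<dots> = ennreal (LINT x|lborel. F x)" using F by (intro nn_integral_eq_integral) auto
  finally have *: "(\<integral>\<^sup>+ x. ennreal (conv k F x) \<partial>lborel) = ennreal (LINT x|lborel. F x)" .
  have bm: "conv k F \<in> borel_measurable borel"
    by (rule borel_measurable_continuous_onI[OF continuous_conv[OF l kc(1,2)]])
  show "integrable lborel (conv k F)"
    using * nn bm by (intro integrableI_nonneg) auto
  then show "(LINT x|lborel. conv k F x) = (LINT x|lborel. F x)"
    using * nn by (subst (asm) nn_integral_eq_integral) (auto simp: integral_nonneg_AE F)
qed

lemma conv_L1_bound: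
  fixes f :: "'a::euclidean_space \<Rightarrow> 'b::euclidean_space"
  assumes k: "kernel k" and f: "integrable lborel f"
  shows "integrable lborel (conv k f)" "(LINT x|lborel. norm (conv k f x)) \<le> (LINT x|lborel. norm (f x))"
proof -
  have l: "loc_int f" using loc_int_integrable[OF f] .
  note n = integral_conv[OF k integrable_norm[OF f]]
  have kc: "continuous_on UNIV k" "cpt_supp k" using k by (auto simp: kernel_def)
  have bm: "conv k f \<in> borel_measurable borel"
    by (rule borel_measurable_continuous_onI[OF continuous_conv[OF l kc(1,2)]])
  show i: "integrable lborel (conv k f)"
    by (rule Bochner_Integration.integrable_bound[OF n(1)])
       (use bm norm_conv_le[OF k l] in \<open>auto intro!: AE_I2 order_trans[OF _ abs_ge_self]\<close>)
  show "(LINT x|lborel. norm (conv k f x)) \<le> (LINT x|lborel. norm (f x))"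
    unfolding n(2)[simplified, symmetric] by (intro integral_mono integrable_norm i n(1)) (use norm_conv_le[OF k l] in auto)
qed

text \<open>Jensen's inequality for the probability density \<open>k (x - y)\<close> in y, obtained
  from the nonnegativity of the variance.\<close>

lemma conv_square_le:
  fixes F :: "'a::euclidean_space \<Rightarrow> real"
  assumes k: "kernel k" and F: "F \<in> borel_measurable borel" "integrable lborel (\<lambda>x. (F x)\<^sup>2)"
  shows "(conv k F x)\<^sup>2 \<le> conv k (\<lambda>y. (F y)\<^sup>2) x"
proof -
  have l: "loc_int F" using loc_int_square[OF F(1)] F(2) by simp
  have kc: "continuous_on UNIV k" "cpt_supp k" "\<And>x. k x \<ge> 0" using k by (auto simp: kernel_def)
  define m where "m = conv k F x"
  have i1: "integrable lborel (\<lambda>y. k (x - y) * F y)" using integrable_conv[OF l kc(1,2)] by simp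
  have i2: "integrable lborel (\<lambda>y. k (x - y) * (F y)\<^sup>2)"
    using integrable_conv[OF loc_int_integrable[OF F(2)] kc(1,2)] by simp
  note i3 = kernel_integral[OF k, of x]
  have eq: "k (x - y) * (F y - m)\<^sup>2 = k (x - y) * (F y)\<^sup>2 - 2 * m * (k (x - y) * F y) + m\<^sup>2 * k (x - y)" for y
    by (simp add: power2_eq_square algebra_simps)
  have "0 \<le> (LINT y|lborel. k (x - y) * (F y - m)\<^sup>2)"
    using kc by (intro Bochner_Integration.integral_nonneg) auto
  also have "\<dots> = (LINT y|lborel. k (x - y) * (F y)\<^sup>2) - 2 * m * (LINT y|lborel. k (x - y) * F y) + m\<^sup>2 * (LINT y|lborel. k (x - y))"
    unfolding eq using i1 i2 i3(1) by simp
  also have "\<dots> = conv k (\<lambda>y. (F y)\<^sup>2) x - m\<^sup>2"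
    using i3(2) by (simp add: conv_def m_def power2_eq_square)
  finally show ?thesis by (simp add: m_def)
qed

lemma conv_L2_bound:
  fixes F :: "'a::euclidean_space \<Rightarrow> real"
  assumes k: "kernel k" and F: "F \<in> borel_measurable borel" "integrable lborel (\<lambda>x. (F x)\<^sup>2)"
  shows "integrable lborel (\<lambda>x. (conv k F x)\<^sup>2)"
    "(LINT x|lborel. (conv k F x)\<^sup>2) \<le> (LINT x|lborel. (F x)\<^sup>2)"
proof -
  have l: "loc_int F" using loc_int_square[OF F(1)] F(2) by simp
  have kc: "continuous_on UNIV k" "cpt_supp k" using k by (auto simp: kernel_def)
  note n = integral_conv[OF k F(2) zero_le_power2]
  have bm: "conv k F \<in> borel_measurable borel"
    by (rule borel_measurable_continuous_onI[OF continuous_conv[OF l kc(1,2)]])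
  show i: "integrable lborel (\<lambda>x. (conv k F x)\<^sup>2)"
    by (rule Bochner_Integration.integrable_bound[OF n(1)])
       (use bm in \<open>auto intro!: AE_I2 order_trans[OF conv_square_le[OF k F] abs_ge_self]\<close>)
  show "(LINT x|lborel. (conv k F x)\<^sup>2) \<le> (LINT x|lborel. (F x)\<^sup>2)"
    unfolding n(2)[symmetric] by (intro integral_mono i n(1) conv_square_le[OF k F])
qed

lemma conv_minus_const:
  fixes f :: "'a::euclidean_space \<Rightarrow> 'b::euclidean_space"
  assumes k: "kernel k" and f: "loc_int f"
  shows "conv k f x - c = (LINT y|lborel. k (x - y) *\<^sub>R (f y - c))"
proof -
  have kc: "continuous_on UNIV k" "cpt_supp k" using k by (auto simp: kernel_def)
  show ?thesis
    using integrable_conv[OF f kc, of x] kernel_integral[OF k, of x]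
    by (simp add: conv_def scaleR_diff_right)
qed

section \<open>Convergence of mollifications\<close>

lemma mollify_uniform:
  fixes g :: "real^'n::finite \<Rightarrow> 'b::euclidean_space"
  assumes g: "continuous_on UNIV g" "cpt_supp g" and e: "e > 0"
  obtains d where "d > 0" "\<And>r x. 0 < r \<Longrightarrow> r < d \<Longrightarrow> norm (conv (mollifier r) g x - g x) \<le> e"
proof -
  obtain C S where S: "S \<ge> 0" "\<And>x. norm x > S \<Longrightarrow> g x = 0"
    using cpt_supp_bounded[OF g] by metis
  have "uniformly_continuous_on (cball 0 (S + 1)) g"
    by (intro compact_uniformly_continuous continuous_on_subset[OF g(1)]) auto
  then obtain d where d: "d > 0" "\<And>x y. x \<in> cball 0 (S+1) \<Longrightarrow> y \<in> cball 0 (S+1) \<Longrightarrow> dist y x < d \<Longrightarrow> dist (g y) (g x) < e"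
    unfolding uniformly_continuous_on_def using e by metis
  \<comment> \<open>Of two points closer than 1, if one lies outside the ball of radius
    \<open>S + 1\<close>, then both lie outside the ball of radius S, where g vanishes. Hence
    uniform continuity on a compact ball suffices.\<close>
  have close: "norm (g y - g x) \<le> e" if "dist y x < min d 1" for x y
  proof (cases "norm x \<le> S + 1 \<and> norm y \<le> S + 1")
    case True then show ?thesis using d(2)[of x y] that by (simp add: dist_norm)
  next
    case False
    have "norm x > S" "norm y > S"
      using False that norm_triangle_ineq2[of x y] norm_triangle_ineq2[of y x]
      by (auto simp: dist_norm norm_minus_commute)
    then show ?thesis using S e by simp
  qed
  show thesis
  proof (rule that[of "min d 1"])
    show "min d 1 > 0" using d by simp
    fix r :: real and x :: "real^'n" assume r: "0 < r" "r < min d 1"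
    note k = kernel_mollifier[OF r(1), where 'n='n]
    have kc: "continuous_on UNIV (mollifier r :: real^'n \<Rightarrow> real)" "cpt_supp (mollifier r :: real^'n \<Rightarrow> real)"
      using k by (auto simp: kernel_def)
    have l: "loc_int g" by (rule loc_int_integrable[OF integrable_cpt_supp[OF g]])
    have i1: "integrable lborel (\<lambda>y. mollifier r (x - y) *\<^sub>R (g y - g x))"
      using integrable_conv[OF l kc, of x] kernel_integral[OF k, of x] by (simp add: scaleR_diff_right)
    have "norm (conv (mollifier r) g x - g x) = norm (LINT y|lborel. mollifier r (x - y) *\<^sub>R (g y - g x))"
      using conv_minus_const[OF k l] by simp
    also have "\<dots> \<le> (LINT y|lborel. norm (mollifier r (x - y) *\<^sub>R (g y - g x)))" by (rule integral_norm_bound)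
    also have "\<dots> \<le> (LINT y|lborel. mollifier r (x - y) * e)"
    proof (rule integral_mono)
      show "integrable lborel (\<lambda>y. norm (mollifier r (x - y) *\<^sub>R (g y - g x)))" using i1 by (rule integrable_norm)
      show "integrable lborel (\<lambda>y. mollifier r (x - y) * e)" using kernel_integral[OF k, of x] by simp
      fix y
      show "norm (mollifier r (x - y) *\<^sub>R (g y - g x)) \<le> mollifier r (x - y) * e"
      proof (cases "norm (x - y) \<ge> r")
        case True then show ?thesis using mollifier_props(2)[OF r(1) True] by simp
      next
        case False
        then have "norm (g y - g x) \<le> e" using r by (intro close) (simp add: dist_norm norm_minus_commute)
        then show ?thesis using mollifier_props(1)[OF r(1), of "x - y"] by (simp add: mult_left_mono)
      qed
    qed
    also have "\<dots> = e" using kernel_integral[OF k, of x] by simp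
    finally show "norm (conv (mollifier r) g x - g x) \<le> e" .
  qed
qed

text \<open>An e/3 argument: f is replaced by a compactly supported continuous g, mollification does
  not increase the L^1 norm of the difference, and for g the convergence is uniform. The restriction
  to a ball turns this uniform bound into an integral bound.\<close>

lemma mollify_L1:
  fixes f :: "real^'n::finite \<Rightarrow> 'b::euclidean_space"
  assumes f: "integrable lborel f" and e: "e > 0"
  obtains d where "d > 0" "\<And>r. 0 < r \<Longrightarrow> r < d \<Longrightarrow>
     (LINT x|lborel. norm (indicator (cball 0 R) x *\<^sub>R (conv (mollifier r) f x - f x))) \<le> e"
proof -
  obtain g where g: "continuous_on UNIV g" "cpt_supp g" "(LINT x|lborel. norm (f x - g x)) < e / 3"
    using cont_approx_integrable[OF f, unfolded cont_approx_def, rule_format, of "e/3"] e by auto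
  define B where "B = cball (0::real^'n) R"
  define v where "v = measure lborel B"
  have v: "v \<ge> 0" by (simp add: v_def)
  have Bf: "integrable lborel (indicator B :: _ \<Rightarrow> real)"
    using emeasure_lborel_cball_finite[of "0::real^'n" R] by (auto simp: B_def intro!: integrable_real_indicator)
  \<comment> \<open>The uniform error times the volume v is then at most \<open>e / 3\<close>; the
    summand 1 covers \<open>v = 0\<close>.\<close>
  have "e / (3 * (v + 1)) > 0" using e v by simp
  from mollify_uniform[OF g(1,2) this] obtain d where d: "d > 0"
    "\<And>r x. 0 < r \<Longrightarrow> r < d \<Longrightarrow> norm (conv (mollifier r) g x - g x) \<le> e / (3 * (v + 1))" by metis
  have ig: "integrable lborel g" using integrable_cpt_supp[OF g(1,2)] .
  have ifg: "integrable lborel (\<lambda>x. f x - g x)" using f ig by auto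
  show thesis
  proof (rule that[OF d(1)])
    fix r assume r: "0 < r" "r < d"
    note k = kernel_mollifier[OF r(1), where 'n='n]
    have kc: "continuous_on UNIV (mollifier r :: real^'n \<Rightarrow> real)" "cpt_supp (mollifier r :: real^'n \<Rightarrow> real)"
      using k by (auto simp: kernel_def)
    have diff: "conv (mollifier r) (\<lambda>x. f x - g x) x = conv (mollifier r) f x - conv (mollifier r) g x" for x
      using integrable_conv[OF loc_int_integrable[OF f] kc, of x] integrable_conv[OF loc_int_integrable[OF ig] kc, of x]
      by (simp add: conv_def scaleR_diff_right)
    note c1 = conv_L1_bound[OF k ifg]
    have if': "integrable lborel (conv (mollifier r) f)" using conv_L1_bound(1)[OF k f] .
    have bd: "norm (indicator B x *\<^sub>R (conv (mollifier r) f x - f x))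
       \<le> norm (conv (mollifier r) (\<lambda>x. f x - g x) x) + e / (3 * (v + 1)) * indicator B x + norm (f x - g x)" for x
    proof (cases "x \<in> B")
      case True
      have "conv (mollifier r) f x - f x = conv (mollifier r) (\<lambda>x. f x - g x) x + (conv (mollifier r) g x - g x) + - (f x - g x)"
        by (simp add: diff)
      then have "norm (conv (mollifier r) f x - f x) \<le> norm (conv (mollifier r) (\<lambda>x. f x - g x) x) + norm (conv (mollifier r) g x - g x) + norm (- (f x - g x))"
        by (simp only:) (intro norm_triangle_le add_right_mono norm_triangle_ineq)
      then show ?thesis using True d(2)[OF r, of x] by (simp add: norm_minus_commute)
    qed simp
    have "(LINT x|lborel. norm (indicator B x *\<^sub>R (conv (mollifier r) f x - f x))) \<le>
       (LINT x|lborel. norm (conv (mollifier r) (\<lambda>x. f x - g x) x) + e / (3 * (v + 1)) * indicator B x + norm (f x - g x))"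
    proof (rule integral_mono[OF _ _ bd])
      have "B \<in> sets lborel" by (simp add: B_def)
      then show "integrable lborel (\<lambda>x. norm (indicator B x *\<^sub>R (conv (mollifier r) f x - f x)))"
        using if' f by (intro integrable_norm integrable_mult_indicator) auto
    qed (use c1 Bf ifg in auto)
    also have "\<dots> = (LINT x|lborel. norm (conv (mollifier r) (\<lambda>x. f x - g x) x)) + e / (3 * (v + 1)) * v + (LINT x|lborel. norm (f x - g x))"
      using c1 Bf ifg by (simp add: v_def)
    also have "\<dots> \<le> e / 3 + e / 3 + e / 3"
    proof -
      have "e / (3 * (v + 1)) * v \<le> e / 3" using e v by (simp add: field_simps)
      then show ?thesis using c1(2) g(3) by linarith
    qed
    finally show "(LINT x|lborel. norm (indicator (cball 0 R) x *\<^sub>R (conv (mollifier r) f x - f x))) \<le> e"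
      by (simp add: B_def)
  qed
qed

text \<open>For radii below 1 the mollification on the ball of radius R only sees f on the ball of
  radius \<open>R + 1\<close>, so f may be truncated there to an integrable function.\<close>

lemma mollify_L1_loc:
  fixes f :: "real^'n::finite \<Rightarrow> 'b::euclidean_space"
  assumes f: "loc_int f" and e: "e > 0"
  obtains r where "0 < r" "r < e"
     "(LINT x|lborel. norm (indicator (cball 0 R) x *\<^sub>R (conv (mollifier r) f x - f x))) \<le> e"
proof -
  define h where "h x = indicator (cball 0 (R + 1)) x *\<^sub>R f x" for x
  have h: "integrable lborel h" using f unfolding h_def[abs_def] loc_int_def by blast
  obtain d where d: "d > 0" "\<And>r. 0 < r \<Longrightarrow> r < d \<Longrightarrow>
     (LINT x|lborel. norm (indicator (cball 0 R) x *\<^sub>R (conv (mollifier r) h x - h x))) \<le> e"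
    using mollify_L1[OF h e] by metis
  define r where "r = min d (min e 1) / 2"
  have r: "0 < r" "r < d" "r < e" "r < 1" using d e by (auto simp: r_def min_def)
  have eq: "indicator (cball 0 R) x *\<^sub>R (conv (mollifier r) h x - h x) = indicator (cball 0 R) x *\<^sub>R (conv (mollifier r) f x - f x)" for x
  proof (cases "norm x \<le> R")
    case True
    have "mollifier r (x - y) *\<^sub>R h y = mollifier r (x - y) *\<^sub>R f y" for y
    proof (cases "norm (x - y) \<ge> r")
      case True then show ?thesis using mollifier_props(2)[OF r(1) True] by simp
    next
      case False
      then have "norm y \<le> R + 1" using True r norm_triangle_ineq2[of y x] by (simp add: norm_minus_commute)
      then show ?thesis by (simp add: h_def)
    qed
    then have "conv (mollifier r) h x = conv (mollifier r) f x" unfolding conv_def by (simp only:)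
    then show ?thesis using True by (simp add: h_def)
  qed simp
  show thesis using that[OF r(1) r(3)] d(2)[OF r(1,2)] unfolding eq .
qed

text \<open>The n-th radius makes the L^1 error on the ball of radius n at most
  \<open>1 / (n + 1)\<close>. The truncated errors form one sequence tending to 0 in L^1, and a
  subsequence converges almost everywhere; on any fixed point the truncation is eventually
  inactive.\<close>

lemma mollify_AE:
  fixes f :: "real^'n::finite \<Rightarrow> 'b::euclidean_space"
  assumes f: "loc_int f"
  obtains r :: "nat \<Rightarrow> real" where "\<And>n. 0 < r n" "r \<longlonglongrightarrow> 0"
    "AE x in lborel. (\<lambda>n. conv (mollifier (r n)) f x) \<longlonglongrightarrow> f x"
proof -
  define P where "P n r \<longleftrightarrow> 0 < r \<and> r < 1 / real (Suc n) \<and>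
     (LINT x|lborel. norm (indicator (cball 0 (real n)) x *\<^sub>R (conv (mollifier r) f x - f x))) \<le> 1 / real (Suc n)" for n r
  have "\<exists>r. P n r" for n
    unfolding P_def by (rule mollify_L1_loc[OF f, of "1 / real (Suc n)" "real n"]) auto
  then obtain r where "\<And>n. P n (r n)" by metis
  then have r: "\<And>n. 0 < r n" "\<And>n. r n < 1 / real (Suc n)"
    "\<And>n. (LINT x|lborel. norm (indicator (cball 0 (real n)) x *\<^sub>R (conv (mollifier (r n)) f x - f x))) \<le> 1 / real (Suc n)"
    unfolding P_def by simp_all
  define u where "u n x = indicator (cball 0 (real n)) x *\<^sub>R (conv (mollifier (r n)) f x - f x)" for n x
  have ui: "integrable lborel (u n)" for n
  proof -
    have "continuous_on UNIV (conv (mollifier (r n)) f)"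
      using kernel_mollifier[OF r(1), where 'n='n] by (intro continuous_conv[OF f]) (auto simp: kernel_def)
    then have "integrable lborel (\<lambda>x. indicator (cball 0 (real n)) x *\<^sub>R conv (mollifier (r n)) f x)"
      by (intro borel_integrable_compact) (auto intro: continuous_on_subset)
    moreover have "integrable lborel (\<lambda>x. indicator (cball 0 (real n)) x *\<^sub>R f x)" using f by (auto simp: loc_int_def)
    ultimately show ?thesis unfolding u_def scaleR_diff_right by (rule Bochner_Integration.integrable_diff)
  qed
  have lim0: "(\<lambda>n. 1 / real (Suc n)) \<longlonglongrightarrow> 0" using LIMSEQ_inverse_real_of_nat by (simp add: divide_inverse)
  have "(\<lambda>n. LINT x|lborel. norm (u n x)) \<longlonglongrightarrow> 0"
    by (rule tendsto_sandwich[OF _ _ tendsto_const lim0]) (use r(3) in \<open>auto simp: u_def intro!: always_eventually\<close>)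
  from tendsto_L1_AE_subseq[OF ui this] obtain s where s: "strict_mono s" "AE x in lborel. (\<lambda>n. u (s n) x) \<longlonglongrightarrow> 0" by blast
  show thesis
  proof (rule that[of "\<lambda>n. r (s n)"])
    have "r \<longlonglongrightarrow> 0" by (rule tendsto_sandwich[OF _ _ tendsto_const lim0]) (use r(1,2) in \<open>auto intro!: always_eventually less_imp_le simp del: of_nat_Suc\<close>)
    from LIMSEQ_subseq_LIMSEQ[OF this s(1)] show "(\<lambda>n. r (s n)) \<longlonglongrightarrow> 0" by (simp add: o_def)
    show "AE x in lborel. (\<lambda>n. conv (mollifier (r (s n))) f x) \<longlonglongrightarrow> f x"
      using s(2)
    proof eventually_elim
      case (elim x)
      obtain m where m: "norm x \<le> real m" using real_arch_simple by blast
      have "u (s n) x = conv (mollifier (r (s n))) f x - f x" if "n \<ge> m" for n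
      proof -
        have "n \<le> s n" using s(1) by (rule strict_mono_imp_increasing)
        then have "m \<le> s n" using that by linarith
        then have "real m \<le> real (s n)" by simp
        then show ?thesis using m by (simp add: u_def)
      qed
      then have "\<forall>\<^sub>F n in sequentially. u (s n) x = conv (mollifier (r (s n))) f x - f x"
        by (intro eventually_sequentiallyI)
      then have "(\<lambda>n. conv (mollifier (r (s n))) f x - f x) \<longlonglongrightarrow> 0"
        by (rule Lim_transform_eventually[OF elim])
      then show ?case by (rule LIM_zero_cancel)
    qed
  qed (use r in auto)
qed

text \<open>The fundamental lemma of the calculus of variations: the value of a mollification at x
  is the pairing with a shifted bump, hence 0, and mollifications converge to f almost everywhere
  along a sequence of radii.\<close>

lemma test_functions_separate:
  fixes f :: "real^'n::finite \<Rightarrow> complex"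
  assumes f: "loc_int f" and z: "\<And>\<phi>. test_function \<phi> \<Longrightarrow> (LINT x|lborel. f x * \<phi> x) = 0"
  shows "AE x in lborel. f x = 0"
proof (rule mollify_AE[OF f])
  fix r :: "nat \<Rightarrow> real"
  assume r: "\<And>n. 0 < r n" "r \<longlonglongrightarrow> 0" "AE x in lborel. (\<lambda>n. conv (mollifier (r n)) f x) \<longlonglongrightarrow> f x"
  have "conv (mollifier (r n)) f x = 0" for n x
    using z[OF shifted_bump(1)[OF r(1), of "inverse (LINT y|lborel. bump (r n) (y :: real^'n))" n x]]
    by (simp add: conv_def mollifier_def scaleR_conv_of_real mult.commute)
  then have "AE x in lborel. (\<lambda>n. 0) \<longlonglongrightarrow> f x" using r(3) by simp
  then show ?thesis by eventually_elim (simp add: LIMSEQ_const_iff)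
qed

section \<open>The energy of regular real functions\<close>

lemma borel_representative:
  fixes f :: "'a::euclidean_space \<Rightarrow> 'b::euclidean_space"
  assumes "f \<in> borel_measurable lebesgue"
  obtains f' where "f' \<in> borel_measurable borel" "AE x in lborel. f x = f' x"
proof -
  have "\<exists>h. h \<in> borel_measurable borel \<and> (AE x in lborel. f x \<bullet> i = h x)" for i
    using completion_ex_borel_measurable_real[of "\<lambda>x. f x \<bullet> i" lborel] assms by auto
  then obtain h where h: "\<And>i. h i \<in> borel_measurable borel" "\<And>i. AE x in lborel. f x \<bullet> i = h i x" by metis
  show thesis
  proof (rule that)
    show "(\<lambda>x. \<Sum>i\<in>Basis. h i x *\<^sub>R i) \<in> borel_measurable borel" using h(1) by measurable
    have "AE x in lborel. \<forall>i\<in>Basis. f x \<bullet> i = h i x"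
      using h(2) by (intro AE_finite_allI) auto
    then show "AE x in lborel. f x = (\<Sum>i\<in>Basis. h i x *\<^sub>R i)"
    proof eventually_elim
      case (elim x)
      then have "(\<Sum>i\<in>Basis. h i x *\<^sub>R i) = (\<Sum>i\<in>Basis. (f x \<bullet> i) *\<^sub>R i)" by (intro sum.cong) auto
      then show ?case by (simp add: euclidean_representation)
    qed
  qed
qed

lemma lebesgue_borel_rep:
  fixes f f' :: "'a::euclidean_space \<Rightarrow> 'b::euclidean_space"
  assumes f: "f \<in> borel_measurable lebesgue" and f': "f' \<in> borel_measurable borel" and ae: "AE x in lborel. f x = f' x"
  shows "integrable lebesgue f \<longleftrightarrow> integrable lborel f'" "(LINT x|lebesgue. f x) = (LINT x|lborel. f' x)"
proof -
  have m: "f' \<in> borel_measurable lebesgue" using f' by (intro measurable_completion) simp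
  have ae': "AE x in lebesgue. f x = f' x" using ae by (rule AE_completion)
  show "integrable lebesgue f \<longleftrightarrow> integrable lborel f'"
    using integrable_cong_AE[OF f m ae'] integrable_completion[of f' lborel] f' by simp
  show "(LINT x|lebesgue. f x) = (LINT x|lborel. f' x)"
    using integral_cong_AE[OF f m ae'] integral_completion[of f' lborel] f' by simp
qed

lemma lebesgue_AE_eq_borel:
  fixes f f' :: "'a::euclidean_space \<Rightarrow> 'b::euclidean_space"
  assumes f': "f' \<in> borel_measurable borel" and ae: "AE x in lborel. f x = f' x"
  shows "f \<in> borel_measurable lebesgue"
proof -
  have m: "f' \<in> borel_measurable lebesgue" using f' by (intro measurable_completion) simp
  have "AE x in lebesgue. f' x = f x" using AE_completion[OF ae] by eventually_elim simp
  then show ?thesis using m by (rule borel_measurable_AE[rotated])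
qed

lemma locally_integrable_measurable:
  fixes f :: "real^'n::finite \<Rightarrow> complex"
  assumes "locally_integrable f"
  shows "f \<in> borel_measurable lebesgue"
proof (rule borel_measurable_LIMSEQ_metric)
  show "(\<lambda>x. indicator (cball 0 (real n)) x *\<^sub>R f x) \<in> borel_measurable lebesgue" for n :: nat
    using assms by (intro borel_measurable_integrable) (auto simp: locally_integrable_def set_integrable_def)
  show "(\<lambda>n. indicator (cball 0 (real n)) x *\<^sub>R f x) \<longlonglongrightarrow> f x" for x
  proof -
    obtain m where "norm x \<le> real m" using real_arch_simple by blast
    then have "\<And>n. n \<ge> m \<Longrightarrow> indicator (cball 0 (real n)) x *\<^sub>R f x = f x" by (auto simp: indicator_def)
    then show ?thesis by (intro tendsto_eventually eventually_sequentiallyI)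
  qed
qed

lemma locally_integrable_rep:
  fixes f :: "real^'n::finite \<Rightarrow> complex"
  assumes l: "locally_integrable f" and f': "f' \<in> borel_measurable borel" "AE x in lborel. f x = f' x"
  shows "loc_int f'"
  unfolding loc_int_def
proof (intro conjI allI f'(1))
  fix R
  have "integrable lebesgue (\<lambda>x. indicator (cball 0 R) x *\<^sub>R f x)"
    using l by (auto simp: locally_integrable_def set_integrable_def)
  moreover have "(\<lambda>x. indicator (cball 0 R) x *\<^sub>R f' x) \<in> borel_measurable borel"
    using f'(1) by (intro borel_measurable_scaleR borel_measurable_indicator) auto
  moreover have "AE x in lborel. indicator (cball 0 R) x *\<^sub>R f x = indicator (cball 0 R) x *\<^sub>R f' x"
    using f'(2) by eventually_elim simp
  ultimately show "integrable lborel (\<lambda>x. indicator (cball 0 R) x *\<^sub>R f' x)"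
    using lebesgue_borel_rep(1) borel_measurable_integrable by blast
qed

lemma weak_pderiv_borel:
  fixes f g :: "real^'n::finite \<Rightarrow> complex"
  assumes w: "has_weak_pderiv j f g"
    and f': "f' \<in> borel_measurable borel" "AE x in lborel. f x = f' x"
    and g': "g' \<in> borel_measurable borel" "AE x in lborel. g x = g' x"
    and t: "test_function \<phi>"
  shows "(LINT x|lborel. f' x * partial_deriv j \<phi> x) = - (LINT x|lborel. g' x * \<phi> x)"
proof -
  have m: "f \<in> borel_measurable lebesgue" "g \<in> borel_measurable lebesgue"
    using w locally_integrable_measurable by (auto simp: has_weak_pderiv_def)
  note T = test_functionD[OF t]
  have c: "\<phi> \<in> borel_measurable borel" "partial_deriv j \<phi> \<in> borel_measurable borel"
    using T borel_measurable_continuous_onI by auto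
  have c': "\<phi> \<in> borel_measurable lebesgue" "partial_deriv j \<phi> \<in> borel_measurable lebesgue"
    using c by (auto intro: measurable_completion)
  have "(LINT x|lebesgue. f x * partial_deriv j \<phi> x) = (LINT x|lborel. f' x * partial_deriv j \<phi> x)"
    by (rule lebesgue_borel_rep) (use m c c' f' in \<open>auto elim: eventually_mono\<close>)
  moreover have "(LINT x|lebesgue. g x * \<phi> x) = (LINT x|lborel. g' x * \<phi> x)"
    by (rule lebesgue_borel_rep) (use m c c' g' in \<open>auto elim: eventually_mono\<close>)
  ultimately show ?thesis using w t by (auto simp: has_weak_pderiv_def)
qed

lemma integrable_loc_int_test:
  fixes h :: "real^'n::finite \<Rightarrow> complex"
  assumes h: "loc_int h" and t: "continuous_on UNIV (\<phi> :: real^'n \<Rightarrow> complex)" "cpt_supp \<phi>"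
  shows "integrable lborel (\<lambda>x. h x * \<phi> x)"
proof -
  obtain C S where C: "\<And>x. norm (\<phi> x) \<le> C" "\<And>x. norm x > S \<Longrightarrow> \<phi> x = 0"
    using cpt_supp_bounded[OF t] by metis
  have 1: "integrable lborel (\<lambda>x. C * norm (indicator (cball 0 S) x *\<^sub>R h x))"
    using h unfolding loc_int_def by (intro integrable_mult_right integrable_norm) blast
  have 2: "norm (h x * \<phi> x) \<le> norm (C * norm (indicator (cball 0 S) x *\<^sub>R h x))" for x
  proof (cases "norm x > S")
    case False
    have "C \<ge> 0" using C(1)[of 0] norm_ge_zero order_trans by blast
    then show ?thesis using False C(1)[of x] by (simp add: norm_mult mult.commute mult_right_mono)
  qed (simp add: C)
  show ?thesis
    by (rule Bochner_Integration.integrable_bound[OF 1])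
       (use 2 h borel_measurable_continuous_onI[OF t(1)] in \<open>auto simp: loc_int_def\<close>)
qed

text \<open>\<open>weak_pderiv\<close> is an arbitrary choice among weak derivatives. Two of them
  have the same pairing with every test function, so the chosen one agrees with the classical
  derivative almost everywhere.\<close>

lemma weak_pderiv_classical:
  fixes f :: "real^'n::finite \<Rightarrow> complex"
  assumes d: "has_pd j f f'" and cf: "continuous_on UNIV f" and cf': "continuous_on UNIV f'"
  shows "AE x in lborel. weak_pderiv j f x = f' x"
proof -
  have w0: "has_weak_pderiv j f f'" by (rule has_weak_pderiv_classical[OF assms])
  then have w: "has_weak_pderiv j f (weak_pderiv j f)" unfolding weak_pderiv_def by (rule someI[of "has_weak_pderiv j f"])
  then have lg: "locally_integrable (weak_pderiv j f)" by (simp add: has_weak_pderiv_def)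
  obtain g where g: "g \<in> borel_measurable borel" "AE x in lborel. weak_pderiv j f x = g x"
    by (rule borel_representative[OF locally_integrable_measurable[OF lg]])
  have bf: "f \<in> borel_measurable borel" "f' \<in> borel_measurable borel"
    using cf cf' borel_measurable_continuous_onI by auto
  have l: "loc_int g" "loc_int f'"
    using locally_integrable_rep[OF lg g] locally_integrable_rep[OF locally_integrable_continuous[OF cf'] bf(2)] by auto
  have ld: "loc_int (\<lambda>x. g x - f' x)"
    using l unfolding loc_int_def by (auto simp: scaleR_diff_right)
  have "AE x in lborel. g x - f' x = 0"
  proof (rule test_functions_separate[OF ld])
    fix \<phi> :: "real^'n \<Rightarrow> complex" assume t: "test_function \<phi>"
    note T = test_functionD[OF t]
    have "(LINT x|lborel. g x * \<phi> x) = (LINT x|lborel. f' x * \<phi> x)"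
      using weak_pderiv_borel[OF w bf(1) _ g t] weak_pderiv_borel[OF w0 bf(1) _ bf(2) _ t] by simp
    then show "(LINT x|lborel. (g x - f' x) * \<phi> x) = 0"
      using integrable_loc_int_test[OF l(1) T(2,4)] integrable_loc_int_test[OF l(2) T(2,4)]
      by (simp add: left_diff_distrib)
  qed
  then show ?thesis using g(2) by eventually_elim simp
qed

section \<open>Energy and scaling of real trial functions\<close>

lemma norm_vec_square: "(norm (x :: 'b::real_normed_vector^'n::finite))\<^sup>2 = (\<Sum>j\<in>UNIV. (norm (x $ j))\<^sup>2)"
  by (simp add: norm_vec_def L2_set_def sum_nonneg)

text \<open>For real \<open>v\<close> the cross term of \<open>|(\<nabla> - iA)v|\<^sup>2\<close> vanishes, so \<open>A\<close> only contributes \<open>|A|\<^sup>2 v\<^sup>2 / 2\<close> to the energy.\<close>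

definition confinement :: "real \<Rightarrow> ('n::finite \<Rightarrow> real) \<Rightarrow> 'n \<Rightarrow> 'n \<Rightarrow> real^'n \<Rightarrow> real" where
  "confinement \<gamma> g a b x = 1/2 * (\<Sum>j\<in>UNIV. (mag_potential \<gamma> a b x $ j)\<^sup>2) + V_trap g a b x"

lemma confinement_scale: "confinement \<gamma> g a b (r *\<^sub>R x) = r\<^sup>2 * confinement \<gamma> g a b x"
proof -
  have "(mag_potential \<gamma> a b (r *\<^sub>R x) $ j)\<^sup>2 = r\<^sup>2 * (mag_potential \<gamma> a b x $ j)\<^sup>2" for j
    by (simp add: mag_potential_def power_mult_distrib algebra_simps)
  then show ?thesis
    by (simp add: confinement_def V_trap_def sum_distrib_left power_mult_distrib algebra_simps)
qed

lemma mag_potential_nth: "mag_potential \<gamma> a b x $ j = \<gamma> * (if j = a then - (x $ b) else if j = b then x $ a else 0)"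
  by (simp add: mag_potential_def)

lemma continuous_confinement: "continuous_on S (mag_potential \<gamma> a b)" "continuous_on S (V_trap g a b)" "continuous_on S (confinement \<gamma> g a b)"
proof -
  have 1: "continuous_on S (\<lambda>x. mag_potential \<gamma> a b x $ j)" for j
    by (cases "j = a"; cases "j = b") (auto simp: mag_potential_nth intro!: continuous_intros)
  then have "continuous_on S (\<lambda>x. \<chi> j. mag_potential \<gamma> a b x $ j)" by (intro continuous_on_vec_lambda)
  then show "continuous_on S (mag_potential \<gamma> a b)" by simp
  show 2: "continuous_on S (V_trap g a b)" unfolding V_trap_def by (intro continuous_intros)
  show "continuous_on S (confinement \<gamma> g a b)" unfolding confinement_def by (intro continuous_intros 1 2)
qed

lemma V_trap_nonneg: "V_trap g a b x \<ge> 0"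
  by (simp add: V_trap_def sum_nonneg)

lemma confinement_nonneg: "confinement \<gamma> g a b x \<ge> 0"
  using V_trap_nonneg[of g a b x] by (simp add: confinement_def sum_nonneg)

text \<open>By homogeneity of degree two, the constant is a bound on the unit sphere.\<close>

lemma confinement_bound: "\<exists>C\<ge>0. \<forall>x. confinement \<gamma> g a b x \<le> C * (norm x)\<^sup>2"
proof -
  have "compact (confinement \<gamma> g a b ` sphere 0 1)"
    by (intro compact_continuous_image continuous_confinement) auto
  then obtain C where C: "C > 0" "\<And>y. y \<in> confinement \<gamma> g a b ` sphere 0 1 \<Longrightarrow> norm y \<le> C"
    using compact_imp_bounded bounded_pos by metis
  have "confinement \<gamma> g a b x \<le> C * (norm x)\<^sup>2" for x
  proof (cases "x = 0")
    case True then show ?thesis using confinement_scale[of \<gamma> g a b 0 0] by simp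
  next
    case False
    have "confinement \<gamma> g a b x = (norm x)\<^sup>2 * confinement \<gamma> g a b (x /\<^sub>R norm x)"
      using confinement_scale[of \<gamma> g a b "norm x" "x /\<^sub>R norm x"] False by simp
    moreover have "confinement \<gamma> g a b (x /\<^sub>R norm x) \<le> C" using C(2)[of "confinement \<gamma> g a b (x /\<^sub>R norm x)"] False by fastforce
    ultimately show ?thesis by (metis mult.commute mult_left_mono zero_le_power2)
  qed
  then show ?thesis using C(1) by (intro exI[of _ C]) auto
qed

text \<open>The gradient is passed along as \<open>v'\<close>. The second moment controls the trap
  and also the term with \<open>|A|^2\<close>, both of which grow quadratically.\<close>

definition admissible :: "real \<Rightarrow> (real^'n::finite \<Rightarrow> real) \<Rightarrow> ('n \<Rightarrow> real^'n \<Rightarrow> real) \<Rightarrow> bool" where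
  "admissible p v v' \<longleftrightarrow> continuous_on UNIV v \<and> (\<forall>j. continuous_on UNIV (v' j) \<and> has_pd j v (v' j) \<and> integrable lborel (\<lambda>x. (v' j x)\<^sup>2))
    \<and> integrable lborel (\<lambda>x. (v x)\<^sup>2) \<and> integrable lborel (\<lambda>x. (norm x)\<^sup>2 * (v x)\<^sup>2)
    \<and> integrable lborel (\<lambda>x. \<bar>v x\<bar> powr (p + 1))"

definition mass :: "(real^'n::finite \<Rightarrow> real) \<Rightarrow> real" where
  "mass v = (LINT x|lborel. (v x)\<^sup>2)"
definition kinetic :: "('n::finite \<Rightarrow> real^'n \<Rightarrow> real) \<Rightarrow> real" where
  "kinetic v' = (LINT x|lborel. (\<Sum>j\<in>UNIV. (v' j x)\<^sup>2))"
definition potential :: "real \<Rightarrow> ('n::finite \<Rightarrow> real) \<Rightarrow> 'n \<Rightarrow> 'n \<Rightarrow> (real^'n \<Rightarrow> real) \<Rightarrow> real" where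
  "potential \<gamma> g a b v = (LINT x|lborel. confinement \<gamma> g a b x * (v x)\<^sup>2)"
definition nonlin :: "real \<Rightarrow> (real^'n::finite \<Rightarrow> real) \<Rightarrow> real" where
  "nonlin p v = (LINT x|lborel. \<bar>v x\<bar> powr (p + 1))"

lemma admissible_cpt_supp:
  assumes p: "p > 0" and c: "continuous_on UNIV v" "\<And>j. continuous_on UNIV (v' j)"
    and d: "\<And>j. has_pd j v (v' j)" and s: "cpt_supp v"
  shows "admissible p v v'"
proof -
  obtain R where R: "\<And>x. norm x > R \<Longrightarrow> v x = 0" using s by (auto simp: cpt_supp_def)
  have s2: "cpt_supp (\<lambda>x. (v x)\<^sup>2)" "cpt_supp (\<lambda>x. \<bar>v x\<bar> powr (p + 1))" "cpt_supp (\<lambda>x. (norm x)\<^sup>2 * (v x)\<^sup>2)"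
    using R p by (auto simp: cpt_supp_def intro!: exI[of _ R])
  have "cpt_supp (\<lambda>x. (v' j x)\<^sup>2)" for j
    using cpt_supp_has_pd[OF d s, of j] by (auto simp: cpt_supp_def)
  then show ?thesis unfolding admissible_def
    by (intro conjI allI c d integrable_cpt_supp s2 continuous_intros continuous_on_powr')
       (use c p in auto)
qed

lemma admissible_confinement_integrable:
  assumes "admissible p v v'"
  shows "integrable lborel (\<lambda>x. confinement \<gamma> g a b x * (v x)\<^sup>2)"
    "integrable lborel (\<lambda>x. V_trap g a b x * (v x)\<^sup>2)"
    "integrable lborel (\<lambda>x. (\<Sum>j\<in>UNIV. (mag_potential \<gamma> a b x $ j)\<^sup>2) * (v x)\<^sup>2)"
proof -
  obtain C where C: "C \<ge> 0" "\<And>x. confinement \<gamma> g a b x \<le> C * (norm x)\<^sup>2" using confinement_bound by blast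
  have c: "continuous_on UNIV v" and i: "integrable lborel (\<lambda>x. C * ((norm x)\<^sup>2 * (v x)\<^sup>2))"
    using assms by (auto simp: admissible_def)
  have m: "v \<in> borel_measurable borel" "confinement \<gamma> g a b \<in> borel_measurable borel" "V_trap g a b \<in> borel_measurable borel"
    using c continuous_confinement borel_measurable_continuous_onI by blast+
  show 1: "integrable lborel (\<lambda>x. confinement \<gamma> g a b x * (v x)\<^sup>2)"
  proof (rule Bochner_Integration.integrable_bound[OF i])
    show "AE x in lborel. norm (confinement \<gamma> g a b x * (v x)\<^sup>2) \<le> norm (C * ((norm x)\<^sup>2 * (v x)\<^sup>2))"
      using mult_right_mono[OF C(2) zero_le_power2] C(1) confinement_nonneg[of \<gamma> g a b]
      by (auto simp: abs_mult mult.assoc)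
  qed (use m in measurable)
  show 2: "integrable lborel (\<lambda>x. V_trap g a b x * (v x)\<^sup>2)"
  proof (rule Bochner_Integration.integrable_bound[OF 1])
    have "V_trap g a b x \<le> confinement \<gamma> g a b x" for x by (simp add: confinement_def sum_nonneg)
    then show "AE x in lborel. norm (V_trap g a b x * (v x)\<^sup>2) \<le> norm (confinement \<gamma> g a b x * (v x)\<^sup>2)"
      using V_trap_nonneg[of g a b] confinement_nonneg[of \<gamma> g a b] by (auto simp: abs_mult intro!: mult_right_mono)
  qed (use m in measurable)
  have "(\<lambda>x. (\<Sum>j\<in>UNIV. (mag_potential \<gamma> a b x $ j)\<^sup>2) * (v x)\<^sup>2) = (\<lambda>x. 2 * (confinement \<gamma> g a b x * (v x)\<^sup>2 - V_trap g a b x * (v x)\<^sup>2))"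
    by (auto simp: confinement_def algebra_simps)
  then show "integrable lborel (\<lambda>x. (\<Sum>j\<in>UNIV. (mag_potential \<gamma> a b x $ j)\<^sup>2) * (v x)\<^sup>2)" using 1 2 by simp
qed

lemma admissible_energy:
  fixes v :: "real^'n::finite \<Rightarrow> real"
  assumes n: "admissible p v v'"
  shows "(\<lambda>x. complex_of_real (v x)) \<in> mass_sphere \<gamma> g a b (mass v)"
    and "energy \<gamma> g a b p (\<lambda>x. complex_of_real (v x)) = 1/2 * kinetic v' + potential \<gamma> g a b v - 2 / (p + 1) * nonlin p v"
proof -
  let ?f = "\<lambda>x. complex_of_real (v x)"
  let ?A = "mag_potential \<gamma> a b"
  \<comment> \<open>The explicit continuous version of the magnetic gradient;
    \<open>mag_grad\<close> agrees with it only almost everywhere, because of the choice in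
    \<open>weak_pderiv\<close>.\<close>
  define D :: "real^'n \<Rightarrow> complex^'n" where "D x = (\<chi> j. of_real (v' j x) - \<i> * of_real (?A x $ j) * of_real (v x))" for x
  have c: "continuous_on UNIV v" "\<And>j. continuous_on UNIV (v' j)" using n by (auto simp: admissible_def)
  have cf: "continuous_on UNIV ?f" "continuous_on UNIV (\<lambda>x. complex_of_real (v' j x))" for j
    using c by (auto intro!: continuous_intros)
  have pd: "has_pd j ?f (\<lambda>x. complex_of_real (v' j x))" for j
    using n by (intro has_pd_bounded_linear[OF bounded_linear_of_real]) (auto simp: admissible_def)
  have cA: "continuous_on UNIV (\<lambda>x. ?A x $ j)" for j
    by (intro continuous_intros continuous_confinement)
  have cD: "continuous_on UNIV D" unfolding D_def
    by (intro continuous_on_vec_lambda continuous_intros cf cA)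
  have AED: "AE x in lborel. mag_grad \<gamma> a b ?f x = D x"
  proof -
    have "AE x in lborel. \<forall>j\<in>UNIV. weak_pderiv j ?f x = of_real (v' j x)"
      by (intro AE_finite_allI weak_pderiv_classical pd cf) auto
    then show ?thesis by eventually_elim (simp add: mag_grad_def D_def)
  qed
  have bD: "D \<in> borel_measurable borel" using cD borel_measurable_continuous_onI by blast
  have nD: "(norm (D x))\<^sup>2 = (\<Sum>j\<in>UNIV. (v' j x)\<^sup>2) + (\<Sum>j\<in>UNIV. (?A x $ j)\<^sup>2) * (v x)\<^sup>2" for x
  proof -
    have "(norm (complex_of_real (v' j x) - \<i> * of_real (?A x $ j) * of_real (v x)))\<^sup>2 = (v' j x)\<^sup>2 + (?A x $ j)\<^sup>2 * (v x)\<^sup>2" for j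
      by (simp add: cmod_power2 power_mult_distrib)
    then show ?thesis unfolding norm_vec_square by (simp add: D_def sum.distrib sum_distrib_right)
  qed
  have iK: "integrable lborel (\<lambda>x. \<Sum>j\<in>UNIV. (v' j x)\<^sup>2)" using n by (auto simp: admissible_def)
  note iP = admissible_confinement_integrable[OF n]
  have iD: "integrable lborel (\<lambda>x. (norm (D x))\<^sup>2)" unfolding nD using iK iP by simp
  have mg: "mag_grad \<gamma> a b ?f \<in> borel_measurable lebesgue" by (rule lebesgue_AE_eq_borel[OF bD AED])
  have ng: "(\<lambda>x. (norm (mag_grad \<gamma> a b ?f x))\<^sup>2) \<in> borel_measurable lebesgue" using mg by measurable
  have ae2: "AE x in lborel. (norm (mag_grad \<gamma> a b ?f x))\<^sup>2 = (norm (D x))\<^sup>2" using AED by eventually_elim simp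
  have bD2: "(\<lambda>x. (norm (D x))\<^sup>2) \<in> borel_measurable borel" using bD by measurable
  note r = lebesgue_borel_rep[OF ng bD2 ae2]
  have bv: "v \<in> borel_measurable borel" "V_trap g a b \<in> borel_measurable borel" using c borel_measurable_continuous_onI continuous_confinement by blast+
  have bv2: "(\<lambda>x. (norm (?f x))\<^sup>2) \<in> borel_measurable lborel" "(\<lambda>x. V_trap g a b x * (norm (?f x))\<^sup>2) \<in> borel_measurable lborel"
    "(\<lambda>x. norm (?f x) powr (p + 1)) \<in> borel_measurable lborel" "?f \<in> borel_measurable lborel"
    using bv by measurable
  have sq: "square_integrable ?f"
    using n bv2 by (auto simp: square_integrable_def admissible_def integrable_completion intro: measurable_completion)
  have L2: "L2_norm_sq ?f = mass v" using bv2(1) by (simp add: L2_norm_sq_def mass_def integral_completion)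
  have "square_integrable (mag_grad \<gamma> a b ?f)"
    using mg r(1) iD by (simp add: square_integrable_def)
  then have "?f \<in> H1_mag \<gamma> a b"
    using sq has_weak_pderiv_classical[OF pd cf] by (auto simp: H1_mag_def)
  moreover have "integrable lebesgue (\<lambda>x. V_trap g a b x * (norm (?f x))\<^sup>2)"
    using bv2(2) iP(2) by (subst integrable_completion) auto
  ultimately show "?f \<in> mass_sphere \<gamma> g a b (mass v)" using L2 by (simp add: mass_sphere_def Sigma_space_def)
  have "L2_norm_sq (mag_grad \<gamma> a b ?f) = kinetic v' + (LINT x|lborel. (\<Sum>j\<in>UNIV. (?A x $ j)\<^sup>2) * (v x)\<^sup>2)"
    unfolding L2_norm_sq_def r(2) nD using iK iP by (simp add: kinetic_def)
  moreover have "potential \<gamma> g a b v = 1/2 * (LINT x|lborel. (\<Sum>j\<in>UNIV. (?A x $ j)\<^sup>2) * (v x)\<^sup>2) + (LINT x|lborel. V_trap g a b x * (v x)\<^sup>2)"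
  proof -
    have "potential \<gamma> g a b v = (LINT x|lborel. 1/2 * ((\<Sum>j\<in>UNIV. (?A x $ j)\<^sup>2) * (v x)\<^sup>2) + V_trap g a b x * (v x)\<^sup>2)"
      unfolding potential_def by (intro Bochner_Integration.integral_cong) (auto simp: confinement_def algebra_simps)
    also have "\<dots> = (LINT x|lborel. 1/2 * ((\<Sum>j\<in>UNIV. (?A x $ j)\<^sup>2) * (v x)\<^sup>2)) + (LINT x|lborel. V_trap g a b x * (v x)\<^sup>2)"
      using iP by (intro Bochner_Integration.integral_add integrable_mult_right)
    finally show ?thesis by simp
  qed
  moreover have "(LINT x|lebesgue. V_trap g a b x * (norm (?f x))\<^sup>2) = (LINT x|lborel. V_trap g a b x * (v x)\<^sup>2)"
    using bv2(2) by (subst integral_completion) auto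
  moreover have "(LINT x|lebesgue. norm (?f x) powr (p + 1)) = nonlin p v"
    using bv2(3) by (subst integral_completion) (auto simp: nonlin_def)
  ultimately show "energy \<gamma> g a b p ?f = 1/2 * kinetic v' + potential \<gamma> g a b v - 2 / (p + 1) * nonlin p v"
    by (simp add: energy_def)
qed

lemma has_pd_scale:
  fixes v :: "real^'n::finite \<Rightarrow> real"
  assumes "has_pd j v v'"
  shows "has_pd j (\<lambda>x. s * v (r *\<^sub>R x)) (\<lambda>x. s * r * v' (r *\<^sub>R x))"
  unfolding has_pd_def
proof
  fix x
  have "((\<lambda>t. r * t) has_vector_derivative r) (at 0)"
    by (auto intro!: derivative_eq_intros)
  moreover have "((\<lambda>t. v (r *\<^sub>R x + t *\<^sub>R axis j 1)) has_vector_derivative v' (r *\<^sub>R x)) (at (r * 0))"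
    using assms by (simp add: has_pd_def)
  ultimately have "((\<lambda>t. v (r *\<^sub>R x + t *\<^sub>R axis j 1)) \<circ> (\<lambda>t. r * t) has_vector_derivative r *\<^sub>R v' (r *\<^sub>R x)) (at 0)"
    by (rule vector_diff_chain_at)
  from has_vector_derivative_mult_right[OF this, of s]
  show "((\<lambda>t. s * v (r *\<^sub>R (x + t *\<^sub>R axis j 1))) has_vector_derivative s * r * v' (r *\<^sub>R x)) (at 0)"
    by (simp add: o_def algebra_simps)
qed

lemma admissible_scale:
  fixes v :: "real^'n::finite \<Rightarrow> real" and s r :: real
  assumes n: "admissible p v v'" and r: "r > 0" and s: "s > 0"
  defines "w \<equiv> \<lambda>x. s * v (r *\<^sub>R x)" and "w' \<equiv> \<lambda>j x. s * r * v' j (r *\<^sub>R x)"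
  shows "admissible p w w'"
    and "mass w = s\<^sup>2 * mass v / r ^ CARD('n)"
    and "kinetic w' = s\<^sup>2 * r\<^sup>2 * kinetic v' / r ^ CARD('n)"
    and "potential \<gamma> g a b w = s\<^sup>2 / r\<^sup>2 * potential \<gamma> g a b v / r ^ CARD('n)"
    and "nonlin p w = s powr (p + 1) * nonlin p v / r ^ CARD('n)"
proof -
  have cv: "continuous_on UNIV v" "\<And>j. continuous_on UNIV (v' j)" using n by (auto simp: admissible_def)
  have aff: "integrable lborel (\<lambda>x. f (r *\<^sub>R x)) \<longleftrightarrow> integrable lborel f"
    "(LINT x|lborel. f (r *\<^sub>R x)) = (LINT x|lborel. f x) / r ^ CARD('n)"
    if "f \<in> borel_measurable borel" for f :: "real^'n \<Rightarrow> real"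
    using lborel_affine_integral[OF that, of r 0] r by (simp_all add: divide_inverse mult.commute)
  have m: "v \<in> borel_measurable borel" "confinement \<gamma> g a b \<in> borel_measurable borel" "v' j \<in> borel_measurable borel" for j
    using cv continuous_confinement borel_measurable_continuous_onI by blast+
  have m1: "(\<lambda>x. (v x)\<^sup>2) \<in> borel_measurable borel" "(\<lambda>x. \<bar>v x\<bar> powr (p+1)) \<in> borel_measurable borel"
    "(\<lambda>x. (norm x)\<^sup>2 * (v x)\<^sup>2) \<in> borel_measurable borel" "(\<lambda>x. confinement \<gamma> g a b x * (v x)\<^sup>2) \<in> borel_measurable borel"
    "\<And>j. (\<lambda>x. (v' j x)\<^sup>2) \<in> borel_measurable borel" "(\<lambda>x. \<Sum>j\<in>UNIV. (v' j x)\<^sup>2) \<in> borel_measurable borel"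
    using m by measurable
  have e: "(w x)\<^sup>2 = s\<^sup>2 * (v (r *\<^sub>R x))\<^sup>2" "(w' j x)\<^sup>2 = s\<^sup>2 * r\<^sup>2 * (v' j (r *\<^sub>R x))\<^sup>2"
    "(norm x)\<^sup>2 * (w x)\<^sup>2 = s\<^sup>2 / r\<^sup>2 * ((norm (r *\<^sub>R x))\<^sup>2 * (v (r *\<^sub>R x))\<^sup>2)"
    "confinement \<gamma> g a b x * (w x)\<^sup>2 = s\<^sup>2 / r\<^sup>2 * (confinement \<gamma> g a b (r *\<^sub>R x) * (v (r *\<^sub>R x))\<^sup>2)"
    "\<bar>w x\<bar> powr (p+1) = s powr (p+1) * \<bar>v (r *\<^sub>R x)\<bar> powr (p+1)" for j x
    using r s by (simp_all add: w_def w'_def power_mult_distrib abs_mult powr_mult confinement_scale)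
  have cw: "continuous_on UNIV w" "continuous_on UNIV (w' j)" for j
    unfolding w_def w'_def by (intro continuous_intros continuous_on_compose2[OF cv(1)] continuous_on_compose2[OF cv(2)]; simp)+
  show "admissible p w w'"
    unfolding admissible_def
  proof (intro conjI allI cw)
    show "has_pd j w (w' j)" for j unfolding w_def w'_def by (rule has_pd_scale) (use n in \<open>auto simp: admissible_def\<close>)
    show "integrable lborel (\<lambda>x. (w' j x)\<^sup>2)" for j
      unfolding e(2) using aff(1)[OF m1(5)] n by (intro integrable_mult_right) (auto simp: admissible_def)
    show "integrable lborel (\<lambda>x. (w x)\<^sup>2)"
      unfolding e(1) using aff(1)[OF m1(1)] n by (intro integrable_mult_right) (auto simp: admissible_def)
    show "integrable lborel (\<lambda>x. (norm x)\<^sup>2 * (w x)\<^sup>2)"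
      unfolding e(3) using aff(1)[OF m1(3)] n by (intro integrable_mult_right) (auto simp: admissible_def simp del: norm_scaleR)
    show "integrable lborel (\<lambda>x. \<bar>w x\<bar> powr (p + 1))"
      unfolding e(5) using aff(1)[OF m1(2)] n by (intro integrable_mult_right) (auto simp: admissible_def)
  qed
  show "mass w = s\<^sup>2 * mass v / r ^ CARD('n)" unfolding mass_def e by (simp add: aff(2)[OF m1(1)])
  show "kinetic w' = s\<^sup>2 * r\<^sup>2 * kinetic v' / r ^ CARD('n)"
    unfolding kinetic_def e sum_distrib_left[symmetric] by (simp add: aff(2)[OF m1(6)])
  show "potential \<gamma> g a b w = s\<^sup>2 / r\<^sup>2 * potential \<gamma> g a b v / r ^ CARD('n)"
    unfolding potential_def e(4) by (simp add: aff(2)[OF m1(4)] del: norm_scaleR) (simp add: confinement_scale)?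
  show "nonlin p w = s powr (p + 1) * nonlin p v / r ^ CARD('n)"
    unfolding nonlin_def e by (simp add: aff(2)[OF m1(2)])
qed

section \<open>Concentration by scaling\<close>

lemma rescaled_energy:
  fixes v :: "real^'n::finite \<Rightarrow> real" and g :: "'n \<Rightarrow> real"
  assumes n: "admissible p v v'" and c: "c > 0" and M: "mass v > 0" and l: "l > 0"
  defines "\<alpha> \<equiv> sqrt (c / mass v)"
  shows "\<exists>f\<in>mass_sphere \<gamma> g a b c. energy \<gamma> g a b p f =
     1/2 * (\<alpha>\<^sup>2 * l\<^sup>2 * kinetic v') + \<alpha>\<^sup>2 / l\<^sup>2 * potential \<gamma> g a b v
       - 2 / (p + 1) * (\<alpha> powr (p + 1) * l powr (real CARD('n) * (p - 1) / 2) * nonlin p v)"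
proof -
  \<comment> \<open>The factor \<open>l powr (N / 2)\<close> preserves the mass under dilation by l,
    and \<alpha> raises it to c. The nonlinear term receives l to the power
    \<open>N (p + 1) / 2 - N\<close>, which is \<open>N (p - 1) / 2\<close>.\<close>
  define s where "s = \<alpha> * l powr (real CARD('n) / 2)"
  have \<alpha>: "\<alpha> > 0" "\<alpha>\<^sup>2 = c / mass v" using c M by (auto simp: \<alpha>_def)
  have s: "s > 0" using \<alpha> l by (simp add: s_def)
  have "(l powr (real CARD('n) / 2))\<^sup>2 = l ^ CARD('n)"
    using l by (simp add: power2_eq_square flip: powr_add powr_realpow)
  then have s2: "s\<^sup>2 = \<alpha>\<^sup>2 * l ^ CARD('n)" by (simp add: s_def power_mult_distrib)
  have "(l powr (real CARD('n) / 2)) powr (p + 1) / l ^ CARD('n) = l powr (real CARD('n) * (p - 1) / 2)"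
    using l by (simp add: powr_powr field_simps flip: powr_diff powr_realpow powr_add)
  then have sp: "s powr (p + 1) / l ^ CARD('n) = \<alpha> powr (p + 1) * l powr (real CARD('n) * (p - 1) / 2)"
    using \<alpha> l by (simp add: s_def powr_mult times_divide_eq_right[symmetric] del: times_divide_eq_right)
  note ns = admissible_scale[OF n l s]
  define w where "w = (\<lambda>x. s * v (l *\<^sub>R x))"
  define w' where "w' = (\<lambda>j x. s * l * v' j (l *\<^sub>R x))"
  have w: "admissible p w w'" using ns(1) by (simp add: w_def w'_def)
  have k1: "mass w = c" using ns(2) s2 \<alpha> l M by (simp add: w_def)
  have k2: "kinetic w' = \<alpha>\<^sup>2 * l\<^sup>2 * kinetic v'" using ns(3) s2 l by (simp add: w'_def)
  have k3: "potential \<gamma> g a b w = \<alpha>\<^sup>2 / l\<^sup>2 * potential \<gamma> g a b v" using ns(4) s2 l by (simp add: w_def)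
  have k4: "nonlin p w = s powr (p + 1) / l ^ CARD('n) * nonlin p v"
    using ns(5) by (simp add: w_def)
  have "energy \<gamma> g a b p (\<lambda>x. complex_of_real (w x)) =
     1/2 * (\<alpha>\<^sup>2 * l\<^sup>2 * kinetic v') + \<alpha>\<^sup>2 / l\<^sup>2 * potential \<gamma> g a b v
       - 2 / (p + 1) * (\<alpha> powr (p + 1) * l powr (real CARD('n) * (p - 1) / 2) * nonlin p v)"
    unfolding admissible_energy(2)[OF w] k2 k3 k4 sp ..
  then show ?thesis using admissible_energy(1)[OF w, of \<gamma> g a b] unfolding k1 by (rule bexI)
qed

lemma nonlin_nonneg: "nonlin p v \<ge> 0"
  by (simp add: nonlin_def)
lemma kinetic_nonneg: "kinetic v \<ge> 0"
  unfolding kinetic_def by (intro Bochner_Integration.integral_nonneg sum_nonneg) auto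
lemma potential_nonneg: "potential \<gamma> g a b v \<ge> 0"
  unfolding potential_def by (intro Bochner_Integration.integral_nonneg mult_nonneg_nonneg confinement_nonneg) auto

text \<open>As \<alpha> and l are at least 1, both exponents \<open>p + 1\<close> and
  \<open>N (p - 1) / 2\<close> may be lowered to 2 in the negative nonlinear term. Then kinetic and
  nonlinear parts carry the common factor \<open>\<alpha>^2 l^2\<close>, and the sign of the
  field-free energy of v decides.\<close>

lemma rescaled_energy_le:
  fixes v :: "real^'n::finite \<Rightarrow> real" and g :: "'n \<Rightarrow> real"
  assumes n: "admissible p v v'" and M: "0 < mass v" "mass v \<le> c" and l: "l \<ge> 1" and p: "p \<ge> 1 + 4 / real CARD('n)"
  shows "\<exists>f\<in>mass_sphere \<gamma> g a b c. energy \<gamma> g a b p f \<le>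
     c / mass v * (l\<^sup>2 * (1/2 * kinetic v' - 2 / (p + 1) * nonlin p v) + potential \<gamma> g a b v / l\<^sup>2)"
proof -
  define \<alpha> where "\<alpha> = sqrt (c / mass v)"
  have \<alpha>: "\<alpha> \<ge> 1" "\<alpha>\<^sup>2 = c / mass v" using M by (auto simp: \<alpha>_def)
  have p1: "p > 1" using p by (rule less_le_trans[rotated]) auto
  have "\<alpha> powr 2 \<le> \<alpha> powr (p + 1)" using \<alpha> p1 by (intro powr_mono) auto
  then have 1: "\<alpha>\<^sup>2 \<le> \<alpha> powr (p + 1)" using \<alpha> by simp
  have "2 \<le> real CARD('n) * (p - 1) / 2" using p by (simp add: field_simps)
  then have "l powr 2 \<le> l powr (real CARD('n) * (p - 1) / 2)" using l by (intro powr_mono) auto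
  then have 2: "l\<^sup>2 \<le> l powr (real CARD('n) * (p - 1) / 2)" using l by simp
  have "\<alpha>\<^sup>2 * l\<^sup>2 * nonlin p v \<le> \<alpha> powr (p + 1) * l powr (real CARD('n) * (p - 1) / 2) * nonlin p v"
    using 1 2 nonlin_nonneg by (intro mult_mono) auto
  then have "2 / (p + 1) * (\<alpha>\<^sup>2 * l\<^sup>2 * nonlin p v) \<le> 2 / (p + 1) * (\<alpha> powr (p + 1) * l powr (real CARD('n) * (p - 1) / 2) * nonlin p v)"
    using p1 by (intro mult_left_mono) auto
  then have 3: "1/2 * (\<alpha>\<^sup>2 * l\<^sup>2 * kinetic v') + \<alpha>\<^sup>2 / l\<^sup>2 * potential \<gamma> g a b v
       - 2 / (p + 1) * (\<alpha> powr (p + 1) * l powr (real CARD('n) * (p - 1) / 2) * nonlin p v)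
     \<le> \<alpha>\<^sup>2 * (l\<^sup>2 * (1/2 * kinetic v' - 2 / (p + 1) * nonlin p v) + potential \<gamma> g a b v / l\<^sup>2)"
    by (simp add: algebra_simps)
  have "l > 0" "c > 0" using l M by auto
  from rescaled_energy[OF n this(2) M(1) this(1), of \<gamma> g a b]
  obtain f where f: "f \<in> mass_sphere \<gamma> g a b c" "energy \<gamma> g a b p f = 1/2 * (\<alpha>\<^sup>2 * l\<^sup>2 * kinetic v') + \<alpha>\<^sup>2 / l\<^sup>2 * potential \<gamma> g a b v
       - 2 / (p + 1) * (\<alpha> powr (p + 1) * l powr (real CARD('n) * (p - 1) / 2) * nonlin p v)"
    unfolding \<alpha>_def[symmetric] by blast
  show ?thesis using f(1) 3[folded f(2)] unfolding \<alpha>(2) by blast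
qed

lemma energy_unbounded_below:
  fixes v :: "real^'n::finite \<Rightarrow> real" and g :: "'n \<Rightarrow> real"
  assumes n: "admissible p v v'" and M: "0 < mass v" "mass v \<le> c" and p: "p \<ge> 1 + 4 / real CARD('n)"
    and neg: "1/2 * kinetic v' < 2 / (p + 1) * nonlin p v"
  shows "\<exists>f\<in>mass_sphere \<gamma> g a b c. energy \<gamma> g a b p f < B"
proof -
  define D where "D = 2 / (p + 1) * nonlin p v - 1/2 * kinetic v'"
  define m where "m = c / mass v"
  define P where "P = potential \<gamma> g a b v"
  have D: "D > 0" "m \<ge> 1" "P \<ge> 0" using neg M potential_nonneg by (auto simp: D_def m_def P_def)
  \<comment> \<open>Chosen so that \<open>l^2 m D\<close> is at least \<open>m P + |B| + 1\<close>,
    using that l is at most its square; the trap contributes at most \<open>m P\<close>.\<close>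
  define l where "l = max 1 ((m * P + \<bar>B\<bar> + 1) / (m * D))"
  have l: "l \<ge> 1" by (simp add: l_def)
  obtain f where f: "f \<in> mass_sphere \<gamma> g a b c" "energy \<gamma> g a b p f \<le> m * (l\<^sup>2 * (- D) + P / l\<^sup>2)"
    using rescaled_energy_le[OF n M l p, of \<gamma> g a b] by (auto simp: D_def m_def P_def)
  have "l * 1 \<le> l * l" using l by (intro mult_left_mono) auto
  then have l2: "l \<le> l\<^sup>2" by (simp add: power2_eq_square)
  have "(m * P + \<bar>B\<bar> + 1) / (m * D) \<le> l\<^sup>2" using l2 by (simp add: l_def)
  then have 1: "m * P + \<bar>B\<bar> + 1 \<le> l\<^sup>2 * (m * D)" using D by (subst (asm) pos_divide_le_eq) auto
  have "P / l\<^sup>2 \<le> P / 1" using l2 l D by (intro divide_left_mono) auto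
  then have "m * (P / l\<^sup>2) \<le> m * P" using D by (intro mult_left_mono) auto
  then have "m * (l\<^sup>2 * (- D) + P / l\<^sup>2) \<le> m * P - l\<^sup>2 * (m * D)" by (simp add: algebra_simps)
  then have "energy \<gamma> g a b p f < B" using f(2) 1 by linarith
  then show ?thesis using f(1) by blast
qed

text \<open>Once the field-free energy is nonpositive, only the trap term, of order
  \<open>l^-2\<close>, can make the energy positive, and concentration sends it to 0.\<close>

lemma energy_inf_le_0:
  fixes v :: "real^'n::finite \<Rightarrow> real" and g :: "'n \<Rightarrow> real"
  assumes n: "admissible p v v'" and M: "0 < mass v" "mass v \<le> c" and p: "p \<ge> 1 + 4 / real CARD('n)"
    and neg: "1/2 * kinetic v' \<le> 2 / (p + 1) * nonlin p v" and e: "e > 0"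
  shows "\<exists>f\<in>mass_sphere \<gamma> g a b c. energy \<gamma> g a b p f < e"
proof -
  define m where "m = c / mass v"
  define P where "P = potential \<gamma> g a b v"
  have D: "m \<ge> 1" "P \<ge> 0" using M potential_nonneg by (auto simp: m_def P_def)
  define l where "l = max 1 ((m * P + 1) / e)"
  have l: "l \<ge> 1" by (simp add: l_def)
  obtain f where f: "f \<in> mass_sphere \<gamma> g a b c"
      "energy \<gamma> g a b p f \<le> m * (l\<^sup>2 * (1/2 * kinetic v' - 2 / (p + 1) * nonlin p v) + P / l\<^sup>2)"
    using rescaled_energy_le[OF n M l p, of \<gamma> g a b] by (auto simp: m_def P_def)
  have "l * 1 \<le> l * l" using l by (intro mult_left_mono) auto
  then have l2: "l \<le> l\<^sup>2" by (simp add: power2_eq_square)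
  have "(m * P + 1) / e \<le> l\<^sup>2" using l2 by (simp add: l_def)
  then have "m * P < e * l\<^sup>2" using e by (simp add: field_simps)
  then have 1: "m * (P / l\<^sup>2) < e" using l by (simp add: divide_less_eq)
  have "m * (l\<^sup>2 * (1/2 * kinetic v' - 2 / (p + 1) * nonlin p v)) \<le> 0"
    using D neg by (intro mult_nonneg_nonpos) (auto intro: mult_nonneg_nonpos)
  then have "energy \<gamma> g a b p f < e" using f(2) 1 by (simp add: distrib_left)
  then show ?thesis using f(1) by blast
qed

lemma energy_unbounded_supercritical:
  fixes \<gamma> :: real and g :: "'n::finite \<Rightarrow> real"
  assumes p: "p > 1 + 4 / real CARD('n)" and c: "c > 0"
  shows "\<exists>f\<in>mass_sphere \<gamma> g a b c. energy \<gamma> g a b p f < B"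
proof -
  let ?v = "bump 1 :: real^'n \<Rightarrow> real"
  let ?v' = "bump_pd 1 :: 'n \<Rightarrow> real^'n \<Rightarrow> real"
  have p1: "p > 1" using p by (rule less_trans[rotated]) auto
  have n: "admissible p ?v ?v'"
    using p1 by (intro admissible_cpt_supp continuous_bump has_pd_bump cpt_supp_bump) auto
  have M: "mass ?v > 0" unfolding mass_def
    using n bump_pos[of 1, where ?'a='n] continuous_bump(1)
    by (intro integral_continuous_pos[where a=0]) (auto simp: admissible_def intro!: continuous_intros)
  have NL: "nonlin p ?v > 0" unfolding nonlin_def
    using n bump_pos[of 1, where ?'a='n] continuous_bump(1) p1
    by (intro integral_continuous_pos[where a=0]) (auto simp: admissible_def intro!: continuous_intros continuous_on_powr')
  define m where "m = c / mass ?v"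
  define q where "q = real CARD('n) * (p - 1) / 2"
  have q: "q > 2" using p by (simp add: q_def field_simps)
  define C where "C = 2 / (p + 1) * (sqrt m powr (p + 1) * nonlin p ?v)"
  have C: "C > 0" using p1 NL c M by (auto simp: C_def m_def intro!: mult_pos_pos divide_pos_pos)
  have m: "m > 0" using c M by (simp add: m_def)
  \<comment> \<open>After a common factor \<open>l^2\<close> is taken out, the nonlinear term keeps
    the positive power \<open>q - 2\<close> of l. The choice of l below makes
    \<open>C * l powr (q - 2)\<close> at least X, which outweighs the kinetic and trap parts and
    leaves a surplus of \<open>|B| + 1\<close>.\<close>
  define X where "X = m * kinetic ?v' / 2 + m * potential \<gamma> g a b ?v + \<bar>B\<bar> + 1"
  define l where "l = max 1 ((X / C) powr (1 / (q - 2)))"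
  have l: "l \<ge> 1" by (simp add: l_def)
  have X: "X > 0" using m kinetic_nonneg[of ?v'] potential_nonneg[of \<gamma> g a b ?v] by (auto simp: X_def intro!: add_nonneg_pos add_nonneg_nonneg)
  obtain f where f: "f \<in> mass_sphere \<gamma> g a b c" "energy \<gamma> g a b p f =
     1/2 * (m * l\<^sup>2 * kinetic ?v') + m / l\<^sup>2 * potential \<gamma> g a b ?v
       - 2 / (p + 1) * (sqrt m powr (p + 1) * l powr q * nonlin p ?v)"
    using rescaled_energy[OF n c M, of l \<gamma> g a b] l m unfolding m_def[symmetric] q_def[symmetric] by auto
  have "X / C = ((X / C) powr (1 / (q - 2))) powr (q - 2)" using q X C by (simp add: powr_powr)
  also have "\<dots> \<le> l powr (q - 2)" using q by (intro powr_mono2) (auto simp: l_def)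
  finally have 1: "X \<le> C * l powr (q - 2)" using C by (simp add: pos_divide_le_eq mult.commute)
  have lq: "l powr q = l\<^sup>2 * l powr (q - 2)"
  proof -
    have "l powr q = l powr (2 + (q - 2))" by simp
    also have "\<dots> = l powr 2 * l powr (q - 2)" by (rule powr_add)
    finally show ?thesis using l by simp
  qed
  have l2: "1 \<le> l\<^sup>2" using l by (rule one_le_power)
  \<comment> \<open>A wasteful bound: it gives the trap term the same factor \<open>l^2\<close> as
    the other terms.\<close>
  have "m / l\<^sup>2 * potential \<gamma> g a b ?v \<le> l\<^sup>2 * (m * potential \<gamma> g a b ?v)"
  proof -
    have "m / l\<^sup>2 \<le> m / 1" using l2 m by (intro divide_left_mono) auto
    also have "\<dots> \<le> l\<^sup>2 * m" using l2 m by simp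
    finally have "m / l\<^sup>2 * potential \<gamma> g a b ?v \<le> l\<^sup>2 * m * potential \<gamma> g a b ?v"
      by (rule mult_right_mono) (rule potential_nonneg)
    then show ?thesis by (simp only: mult.assoc)
  qed
  then have "energy \<gamma> g a b p f \<le> l\<^sup>2 * (m * kinetic ?v' / 2 + m * potential \<gamma> g a b ?v - C * l powr (q - 2))"
    unfolding f(2) lq C_def by (simp add: algebra_simps)
  also have "\<dots> \<le> l\<^sup>2 * (- (\<bar>B\<bar> + 1))" using 1 by (intro mult_left_mono) (auto simp: X_def)
  also have "\<dots> \<le> 1 * (- (\<bar>B\<bar> + 1))" using l2 by (intro mult_right_mono_neg) auto
  also have "\<dots> < B" by simp
  finally show ?thesis using f(1) by blast
qed

section \<open>The strict diamagnetic inequality\<close>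

lemma has_pd_lipschitz:
  fixes f :: "real^'n::finite \<Rightarrow> 'b::real_normed_vector"
  assumes d: "has_pd j f f'" and C: "\<And>x. norm (f' x) \<le> C"
  shows "norm (f (x + t *\<^sub>R axis j 1) - f x) \<le> C * \<bar>t\<bar>"
proof -
  have "norm (f (x + t *\<^sub>R axis j 1) - f (x + 0 *\<^sub>R axis j 1)) \<le> C * norm (t - 0)"
  proof (rule differentiable_bound[where S=UNIV and f="\<lambda>t. f (x + t *\<^sub>R axis j 1)" and f'="\<lambda>t h. h *\<^sub>R f' (x + t *\<^sub>R axis j 1)"])
    show "((\<lambda>t. f (x + t *\<^sub>R axis j 1)) has_derivative (\<lambda>h. h *\<^sub>R f' (x + t *\<^sub>R axis j 1))) (at t within UNIV)" for t
      using has_pd_at[OF d, of x t UNIV] by (simp add: has_vector_derivative_def)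
    show "onorm (\<lambda>h. h *\<^sub>R f' (x + t *\<^sub>R axis j 1)) \<le> C" for t
    proof (rule onorm_le)
      fix s show "norm (s *\<^sub>R f' (x + t *\<^sub>R axis j 1)) \<le> C * norm s"
        using mult_left_mono[OF C, of "\<bar>s\<bar>" "x + t *\<^sub>R axis j 1"] by (simp add: mult.commute)
    qed
  qed auto
  then show ?thesis by simp
qed

text \<open>The quotients are bounded by the suprema of the derivatives, and increments of size at
  most 1 keep the support of the first one in a fixed ball, so dominated convergence applies. The
  sign of the increments is left open because both signs occur later.\<close>

lemma difference_quotient_product:
  fixes f g :: "real^'n::finite \<Rightarrow> complex"
  assumes f: "has_pd j f f'" "continuous_on UNIV f" "continuous_on UNIV f'" "cpt_supp f"
    and g: "has_pd k g g'" "continuous_on UNIV g" "continuous_on UNIV g'" "cpt_supp g"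
    and h: "\<And>n::nat. h n \<noteq> 0" "h \<longlonglongrightarrow> 0" "\<And>n. \<bar>h n\<bar> \<le> 1"
  shows "(\<lambda>n. LINT x|lborel. cnj ((f (x + h n *\<^sub>R axis j 1) - f x) /\<^sub>R h n) * ((g (x + h n *\<^sub>R axis k 1) - g x) /\<^sub>R h n))
     \<longlonglongrightarrow> (LINT x|lborel. cnj (f' x) * g' x)"
proof -
  note sf' = cpt_supp_has_pd[OF f(1,4)] and sg' = cpt_supp_has_pd[OF g(1,4)]
  obtain C S where C: "\<And>x. norm (f' x) \<le> C" "\<And>x. norm x > S \<Longrightarrow> f x = 0" "C > 0" "S \<ge> 0"
  proof -
    obtain C where "C > 0" "\<And>x. norm (f' x) \<le> C" using cpt_supp_bounded[OF f(3) sf'] by metis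
    moreover obtain S where "S \<ge> 0" "\<And>x. norm x > S \<Longrightarrow> f x = 0" using cpt_supp_bounded[OF f(2,4)] by metis
    ultimately show thesis using that by blast
  qed
  obtain E where E: "\<And>x. norm (g' x) \<le> E" "E > 0" using cpt_supp_bounded[OF g(3) sg'] by metis
  define F where "F n x = (f (x + h n *\<^sub>R axis j 1) - f x) /\<^sub>R h n" for n x
  define G where "G n x = (g (x + h n *\<^sub>R axis k 1) - g x) /\<^sub>R h n" for n x
  have bF: "norm (F n x) \<le> C" for n x
  proof -
    have "norm (f (x + h n *\<^sub>R axis j 1) - f x) \<le> C * \<bar>h n\<bar>" by (rule has_pd_lipschitz[OF f(1) C(1)])
    moreover have "norm (F n x) = norm (f (x + h n *\<^sub>R axis j 1) - f x) / \<bar>h n\<bar>"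
      by (simp add: F_def divide_inverse mult.commute)
    ultimately show ?thesis using h(1)[of n] by (simp add: divide_le_eq)
  qed
  have bG: "norm (G n x) \<le> E" for n x
  proof -
    have "norm (g (x + h n *\<^sub>R axis k 1) - g x) \<le> E * \<bar>h n\<bar>" by (rule has_pd_lipschitz[OF g(1) E(1)])
    moreover have "norm (G n x) = norm (g (x + h n *\<^sub>R axis k 1) - g x) / \<bar>h n\<bar>"
      by (simp add: G_def divide_inverse mult.commute)
    ultimately show ?thesis using h(1)[of n] by (simp add: divide_le_eq)
  qed
  have zF: "F n x = 0" if "norm x > S + 1" for n x
  proof -
    have "norm (x + h n *\<^sub>R axis j 1) > S"
      using that h(3)[of n] norm_triangle_ineq4[of "x + h n *\<^sub>R axis j 1" "h n *\<^sub>R axis j 1"] by simp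
    then show ?thesis using C(2) that by (simp add: F_def)
  qed
  have lF: "(\<lambda>n. F n x) \<longlonglongrightarrow> f' x" for x
  proof -
    have "((\<lambda>t. (f (x + t *\<^sub>R axis j 1) - f (x + 0 *\<^sub>R axis j 1)) /\<^sub>R t) \<longlongrightarrow> f' x) (at 0)"
      using f(1) by (intro has_vector_derivative_0D) (auto simp: has_pd_def)
    then have "((\<lambda>t. (f (x + t *\<^sub>R axis j 1) - f (x + 0 *\<^sub>R axis j 1)) /\<^sub>R t) \<circ> h) \<longlonglongrightarrow> f' x"
      using h unfolding tendsto_at_iff_sequentially by blast
    then show ?thesis by (simp add: o_def F_def)
  qed
  have lG: "(\<lambda>n. G n x) \<longlonglongrightarrow> g' x" for x
  proof -
    have "((\<lambda>t. (g (x + t *\<^sub>R axis k 1) - g (x + 0 *\<^sub>R axis k 1)) /\<^sub>R t) \<longlongrightarrow> g' x) (at 0)"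
      using g(1) by (intro has_vector_derivative_0D) (auto simp: has_pd_def)
    then have "((\<lambda>t. (g (x + t *\<^sub>R axis k 1) - g (x + 0 *\<^sub>R axis k 1)) /\<^sub>R t) \<circ> h) \<longlonglongrightarrow> g' x"
      using h unfolding tendsto_at_iff_sequentially by blast
    then show ?thesis by (simp add: o_def G_def)
  qed
  have cFG: "continuous_on UNIV (F n)" "continuous_on UNIV (G n)" for n
    unfolding F_def G_def
    by (intro continuous_intros continuous_on_compose2[OF f(2)] continuous_on_compose2[OF g(2)]; simp)+
  have "(\<lambda>n. LINT x|lborel. cnj (F n x) * G n x) \<longlonglongrightarrow> (LINT x|lborel. cnj (f' x) * g' x)"
  proof (rule integral_dominated_convergence[where w="\<lambda>x. C * E * indicator (cball 0 (S+1)) x"])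
    show "(\<lambda>x. cnj (f' x) * g' x) \<in> borel_measurable lborel"
      by (simp, intro borel_measurable_continuous_onI continuous_intros f(3) g(3))
    show "(\<lambda>x. cnj (F n x) * G n x) \<in> borel_measurable lborel" for n
      by (simp, intro borel_measurable_continuous_onI continuous_intros cFG)
    show "integrable lborel (\<lambda>x::real^'n. C * E * indicator (cball 0 (S+1)) x)"
      using emeasure_lborel_cball_finite[of "0::real^'n" "S+1"]
      by (intro integrable_mult_right integrable_real_indicator) auto
    show "AE x in lborel. (\<lambda>n. cnj (F n x) * G n x) \<longlonglongrightarrow> cnj (f' x) * g' x"
      by (intro AE_I2 tendsto_intros lF lG)
    show "AE x in lborel. norm (cnj (F n x) * G n x) \<le> C * E * indicator (cball 0 (S+1)) x" for n
    proof (rule AE_I2)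
      fix x show "norm (cnj (F n x) * G n x) \<le> C * E * indicator (cball 0 (S+1)) x"
      proof (cases "norm x > S + 1")
        case True then show ?thesis using zF by simp
      next
        case False
        then show ?thesis using mult_mono[OF bF[of n x] bG[of n x]] C(3) by (simp add: norm_mult)
      qed
    qed
  qed
  then show ?thesis by (simp add: F_def G_def)
qed

text \<open>Translating the right-hand integrand by \<open>u + w\<close> exchanges the two shifts
  and reverses their signs.\<close>

lemma lborel_cnj_shift:
  fixes f g :: "real^'n::finite \<Rightarrow> complex"
  assumes "continuous_on UNIV f" "continuous_on UNIV g"
  shows "(LINT x|lborel. cnj (f (x + u)) * g (x + w)) = (LINT x|lborel. cnj (f (x - w)) * g (x - u))"
proof -
  have "continuous_on UNIV (\<lambda>x. cnj (f (x - w)) * g (x - u))"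
    by (intro continuous_intros continuous_on_compose2[OF assms(1)] continuous_on_compose2[OF assms(2)]) auto
  from lborel_translate_integral(2)[OF borel_measurable_continuous_onI[OF this], of "u + w"]
  show ?thesis by (simp add: algebra_simps)
qed

text \<open>With only one derivative available, translation invariance of the integrated difference quotients replaces the symmetry of second derivatives.\<close>

lemma integral_mixed_symmetric:
  fixes f :: "real^'n::finite \<Rightarrow> complex"
  assumes f: "\<And>j. has_pd j f (f' j)" "continuous_on UNIV f" "\<And>j. continuous_on UNIV (f' j)" "cpt_supp f"
  shows "(LINT x|lborel. cnj (f' a x) * f' b x) = (LINT x|lborel. cnj (f' b x) * f' a x)"
proof -
  let ?ea = "axis a (1::real) :: real^'n" and ?eb = "axis b (1::real) :: real^'n"
  define h where "h n = 1 / real (Suc n)" for n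
  have h: "h n \<noteq> 0" "\<bar>h n\<bar> \<le> 1" "- h n \<noteq> 0" "\<bar>- h n\<bar> \<le> 1" for n by (auto simp: h_def)
  have h0: "h \<longlonglongrightarrow> 0" unfolding h_def[abs_def] using LIMSEQ_inverse_real_of_nat by (simp add: divide_inverse)
  have h0': "(\<lambda>n. - h n) \<longlonglongrightarrow> 0" using tendsto_minus[OF h0] by simp
  have int: "integrable lborel (\<lambda>x. cnj (f (x + u)) * f (x + w))" for u w
  proof (rule integrable_cpt_supp)
    show "continuous_on UNIV (\<lambda>x. cnj (f (x + u)) * f (x + w))"
      by (intro continuous_intros continuous_on_compose2[OF f(2)]) auto
    obtain R where R: "\<And>x. norm x > R \<Longrightarrow> f x = 0" using f(4) by (auto simp: cpt_supp_def)
    have "f (x + w) = 0" if "norm x > R + norm w" for x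
      by (rule R) (use that norm_triangle_ineq4[of "x + w" w] in simp)
    then show "cpt_supp (\<lambda>x. cnj (f (x + u)) * f (x + w))" by (auto simp: cpt_supp_def)
  qed
  have expand: "(LINT x|lborel. cnj ((f (x + u) - f x) /\<^sub>R s) * ((f (x + w) - f x) /\<^sub>R s)) =
     ((LINT x|lborel. cnj (f (x + u)) * f (x + w)) - (LINT x|lborel. cnj (f (x + u)) * f x)
      - (LINT x|lborel. cnj (f x) * f (x + w)) + (LINT x|lborel. cnj (f x) * f x)) /\<^sub>R s\<^sup>2" for u w s
  proof -
    have "(LINT x|lborel. cnj ((f (x + u) - f x) /\<^sub>R s) * ((f (x + w) - f x) /\<^sub>R s)) =
      (LINT x|lborel. (cnj (f (x + u)) * f (x + w) - cnj (f (x + u)) * f x - cnj (f x) * f (x + w) + cnj (f x) * f x) /\<^sub>R s\<^sup>2)"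
      by (intro Bochner_Integration.integral_cong) (auto simp: scaleR_conv_of_real power2_eq_square algebra_simps)
    also have "\<dots> = (LINT x|lborel. cnj (f (x + u)) * f (x + w) - cnj (f (x + u)) * f x - cnj (f x) * f (x + w) + cnj (f x) * f x) /\<^sub>R s\<^sup>2"
      by (rule integral_scaleR_right)
    finally show ?thesis
      using int[of u w] int[of u 0] int[of 0 w] int[of 0 0] by (simp del: complex_cnj_mult)
  qed
  \<comment> \<open>Forward quotients in the directions a, b have the same integrated product as
    backward quotients in the directions b, a. The two sides converge to the two integrals of the
    claim.\<close>
  have eq: "(LINT x|lborel. cnj ((f (x + h n *\<^sub>R ?ea) - f x) /\<^sub>R h n) * ((f (x + h n *\<^sub>R ?eb) - f x) /\<^sub>R h n)) =
    (LINT x|lborel. cnj ((f (x + (- h n) *\<^sub>R ?eb) - f x) /\<^sub>R (- h n)) * ((f (x + (- h n) *\<^sub>R ?ea) - f x) /\<^sub>R (- h n)))" for n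
    unfolding expand
    using lborel_cnj_shift[OF f(2) f(2), of "h n *\<^sub>R ?ea" "h n *\<^sub>R ?eb"]
      lborel_cnj_shift[OF f(2) f(2), of "h n *\<^sub>R ?ea" 0] lborel_cnj_shift[OF f(2) f(2), of 0 "h n *\<^sub>R ?eb"]
    by simp
  show ?thesis
    by (rule LIMSEQ_unique[OF difference_quotient_product[OF f(1,2,3,4) f(1,2,3,4) h(1) h0 h(2)]])
       (unfold eq, rule difference_quotient_product[OF f(1,2,3,4) f(1,2,3,4) h(3) h0' h(4)])
qed

lemma has_pd_coordinate: "has_pd a (\<lambda>x :: real^'n::finite. x $ a) (\<lambda>_. 1)"
  unfolding has_pd_def
proof
  fix x :: "real^'n"
  have "((\<lambda>t. x $ a + t) has_vector_derivative 1) (at 0)" by (auto intro!: derivative_eq_intros)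
  then show "((\<lambda>t. (x + t *\<^sub>R axis a 1) $ a) has_vector_derivative 1) (at 0)" by simp
qed

lemma has_pd_norm_square:
  fixes f :: "real^'n::finite \<Rightarrow> complex"
  assumes "has_pd j f f'"
  shows "has_pd j (\<lambda>x. (norm (f x))\<^sup>2) (\<lambda>x. 2 * Re (cnj (f x) * f' x))"
proof -
  have "has_pd j (\<lambda>x. Re (cnj (f x) * f x)) (\<lambda>x. Re (cnj (f' x) * f x + cnj (f x) * f' x))"
    by (intro has_pd_bounded_linear[OF bounded_linear_Re] has_pd_mult has_pd_bounded_linear[OF bounded_linear_cnj] assms)
  moreover have "Re (cnj z * z) = (norm z)\<^sup>2" for z by (simp add: cmod_power2) (simp add: power2_eq_square)
  moreover have "Re (cnj w * z + cnj z * w) = 2 * Re (cnj z * w)" for z w by simp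
  ultimately show ?thesis by simp
qed

text \<open>The derivative of \<open>x_a |f|^2\<close> in direction a integrates to 0.\<close>

lemma integral_coordinate_pd:
  fixes f :: "real^'n::finite \<Rightarrow> complex"
  assumes f: "has_pd a f f'" "continuous_on UNIV f" "continuous_on UNIV f'" "cpt_supp f"
  shows "integrable lborel (\<lambda>x. x $ a * Re (cnj (f x) * f' x))"
    "2 * (LINT x|lborel. x $ a * Re (cnj (f x) * f' x)) = - (LINT x|lborel. (norm (f x))\<^sup>2)"
proof -
  obtain R where R: "\<And>x. norm x > R \<Longrightarrow> f x = 0" using f(4) by (auto simp: cpt_supp_def)
  have i: "integrable lborel (\<lambda>x. x $ a * Re (cnj (f x) * f' x))" "integrable lborel (\<lambda>x. (norm (f x))\<^sup>2)"
    "integrable lborel (\<lambda>x. x $ a * (norm (f x))\<^sup>2)"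
    by (intro integrable_cpt_supp continuous_intros f; use R in \<open>auto simp: cpt_supp_def intro!: exI[of _ R]\<close>)+
  define q where "q x = Re (cnj (f x) * f' x)" for x
  have iq: "integrable lborel (\<lambda>x. x $ a * (2 * q x))"
    using integrable_mult_right[OF i(1), of 2] unfolding q_def by (simp only: mult.left_commute)
  show "integrable lborel (\<lambda>x. x $ a * Re (cnj (f x) * f' x))" by (rule i)
  have pd: "has_pd a (\<lambda>x. x $ a * (norm (f x))\<^sup>2) (\<lambda>x. 1 * (norm (f x))\<^sup>2 + x $ a * (2 * q x))"
    unfolding q_def by (intro has_pd_mult has_pd_coordinate has_pd_norm_square f)
  have "(LINT x|lborel. 1 * (norm (f x))\<^sup>2 + x $ a * (2 * q x)) = 0"
  proof (rule integral_has_pd_eq_0[OF pd])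
    show "integrable lborel (\<lambda>x. 1 * (norm (f x))\<^sup>2 + x $ a * (2 * q x))"
      using i(2) iq by simp
    show "continuous_on UNIV (\<lambda>x. 1 * (norm (f x))\<^sup>2 + x $ a * (2 * q x))"
      unfolding q_def by (intro continuous_intros f)
  qed (intro i continuous_intros f)+
  moreover have "(LINT x|lborel. 1 * (norm (f x))\<^sup>2 + x $ a * (2 * q x)) =
     (LINT x|lborel. (norm (f x))\<^sup>2) + (LINT x|lborel. x $ a * (2 * q x))"
    using i(2) iq by simp
  moreover have "(LINT x|lborel. x $ a * (2 * q x)) = 2 * (LINT x|lborel. x $ a * q x)"
    by (simp only: mult.left_commute[of _ 2] integral_mult_right_zero)
  ultimately show "2 * (LINT x|lborel. x $ a * Re (cnj (f x) * f' x)) = - (LINT x|lborel. (norm (f x))\<^sup>2)"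
    unfolding q_def by linarith
qed

text \<open>A component of the magnetic gradient with the derivatives supplied as \<open>f'\<close>,
  so that it serves classical derivatives as well as Borel versions of weak ones.\<close>

definition cov_deriv :: "real \<Rightarrow> 'n::finite \<Rightarrow> 'n \<Rightarrow> (real^'n \<Rightarrow> complex) \<Rightarrow> ('n \<Rightarrow> real^'n \<Rightarrow> complex) \<Rightarrow> 'n \<Rightarrow> real^'n \<Rightarrow> complex" where
  "cov_deriv \<gamma> a b f f' j x = f' j x - \<i> * complex_of_real (mag_potential \<gamma> a b x $ j) * f x"

text \<open>The commutator of the covariant derivatives in weak form. In the expanded product, the
  term with two derivatives is real after integration by symmetry, the term with two factors of A is
  real pointwise, and each of the two mixed terms contributes half of the right side.\<close>

lemma commutator_identity:
  fixes f :: "real^'n::finite \<Rightarrow> complex"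
  assumes f: "\<And>j. has_pd j f (f' j)" "continuous_on UNIV f" "\<And>j. continuous_on UNIV (f' j)" "cpt_supp f"
    and ab: "a \<noteq> b"
  shows "(LINT x|lborel. Im (cnj (cov_deriv \<gamma> a b f f' a x) * cov_deriv \<gamma> a b f f' b x)) = \<gamma> * (LINT x|lborel. (norm (f x))\<^sup>2)"
proof -
  have s: "cpt_supp (f' j)" for j using cpt_supp_has_pd[OF f(1,4)] .
  have pt: "Im (cnj (cov_deriv \<gamma> a b f f' a x) * cov_deriv \<gamma> a b f f' b x) =
     Im (cnj (f' a x) * f' b x) - \<gamma> * (x $ a * Re (cnj (f x) * f' a x)) - \<gamma> * (x $ b * Re (cnj (f x) * f' b x))" for x
    using ab by (simp add: cov_deriv_def mag_potential_nth algebra_simps)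
  have iab: "integrable lborel (\<lambda>x. cnj (f' a x) * f' b x)"
    by (intro integrable_cpt_supp cpt_supp_mult s continuous_intros f)
  have iI: "integrable lborel (\<lambda>x. Im (cnj (f' a x) * f' b x))" using integrable_Im[OF iab] .
  have "cnj (LINT x|lborel. cnj (f' a x) * f' b x) = (LINT x|lborel. cnj (cnj (f' a x) * f' b x))"
    by (rule Bochner_Integration.integral_cnj[symmetric])
  also have "\<dots> = (LINT x|lborel. cnj (f' b x) * f' a x)"
    by (rule Bochner_Integration.integral_cong) (simp_all add: mult.commute)
  also have "\<dots> = (LINT x|lborel. cnj (f' a x) * f' b x)" by (rule integral_mixed_symmetric[OF f])
  finally have "(LINT x|lborel. cnj (f' a x) * f' b x) \<in> \<real>" by (simp only: Reals_cnj_iff)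
  then have "Im (LINT x|lborel. cnj (f' a x) * f' b x) = 0" by (simp only: complex_is_Real_iff)
  then have I0: "(LINT x|lborel. Im (cnj (f' a x) * f' b x)) = 0" using integral_Im[OF iab] by simp
  note c = integral_coordinate_pd[OF f(1,2,3,4), of a] integral_coordinate_pd[OF f(1,2,3,4), of b]
  have h: "(LINT x|lborel. x $ a * Re (cnj (f x) * f' a x)) = - (LINT x|lborel. (norm (f x))\<^sup>2) / 2"
    "(LINT x|lborel. x $ b * Re (cnj (f x) * f' b x)) = - (LINT x|lborel. (norm (f x))\<^sup>2) / 2"
    using c by linarith+
  have "(LINT x|lborel. Im (cnj (f' a x) * f' b x) - \<gamma> * (x $ a * Re (cnj (f x) * f' a x)) - \<gamma> * (x $ b * Re (cnj (f x) * f' b x)))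
     = 0 - \<gamma> * (LINT x|lborel. x $ a * Re (cnj (f x) * f' a x)) - \<gamma> * (LINT x|lborel. x $ b * Re (cnj (f x) * f' b x))"
    using c(1,3) iI I0 by (simp del: times_complex.sel)
  then show ?thesis unfolding pt h by simp
qed

text \<open>Rotating by the phase of z splits \<open>d j\<close> into a part \<open>R j\<close>
  along z and a part \<open>I j\<close> across it. The derivative of the regularized modulus sees at
  most \<open>R j\<close>, so the squares of the \<open>I j\<close> are bounded by the kinetic loss.
  As \<open>Im (cnj (d a) * d b)\<close> is \<open>R a * I b - I a * R b\<close>, every term
  contains a factor controlled by the loss; Young's inequality with weight t separates it from the
  other.\<close>

lemma strict_diamagnetic_pointwise:
  fixes d :: "'n::finite \<Rightarrow> complex" and z :: complex
  assumes ab: "a \<noteq> b" and t: "t > 0" and \<delta>: "\<delta> > 0"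
  defines "w \<equiv> \<lambda>j. Re (cnj z * d j) / sqrt ((norm z)\<^sup>2 + \<delta>\<^sup>2)"
  shows "\<bar>Im (cnj (d a) * d b)\<bar> \<le> 1/2 * (t * (\<Sum>j\<in>UNIV. (norm (d j))\<^sup>2) + ((\<Sum>j\<in>UNIV. (norm (d j))\<^sup>2) - (\<Sum>j\<in>UNIV. (w j)\<^sup>2)) / t)"
    and "(\<Sum>j\<in>UNIV. (w j)\<^sup>2) \<le> (\<Sum>j\<in>UNIV. (norm (d j))\<^sup>2)"
proof -
  \<comment> \<open>At zeros of z any phase does, as all \<open>w j\<close> are then 0.\<close>
  define \<theta> where "\<theta> = (if z = 0 then 1 else z / of_real (norm z))"
  have th: "norm \<theta> = 1" by (simp add: \<theta>_def norm_divide)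
  have zt: "z = of_real (norm z) * \<theta>" by (simp add: \<theta>_def)
  define R where "R j = Re (cnj \<theta> * d j)" for j
  define I where "I j = Im (cnj \<theta> * d j)" for j
  have nd: "(norm (d j))\<^sup>2 = (R j)\<^sup>2 + (I j)\<^sup>2" for j
  proof -
    have "norm (d j) = norm (cnj \<theta> * d j)" using th by (simp add: norm_mult)
    then show ?thesis unfolding R_def I_def by (simp only: cmod_power2)
  qed
  have im: "Im (cnj (d a) * d b) = R a * I b - I a * R b"
  proof -
    have "cnj \<theta> * \<theta> = 1" using th complex_norm_square[of \<theta>] by (simp add: mult.commute)
    then have "cnj (d a) * d b = (cnj \<theta> * \<theta>) * (cnj (d a) * d b)" by simp
    then have "cnj (d a) * d b = cnj (cnj \<theta> * d a) * (cnj \<theta> * d b)" by (simp add: mult_ac)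
    then have "Im (cnj (d a) * d b) = Im (cnj (cnj \<theta> * d a) * (cnj \<theta> * d b))" by (rule arg_cong)
    moreover have "Im (cnj u * w) = Re u * Im w - Im u * Re w" for u w by simp
    ultimately show ?thesis by (simp only: R_def I_def)
  qed
  have w: "(w j)\<^sup>2 \<le> (R j)\<^sup>2" for j
  proof -
    have "Re (cnj z * d j) = norm z * R j" by (subst zt) (simp add: R_def algebra_simps)
    then have "(w j)\<^sup>2 = (norm z)\<^sup>2 / ((norm z)\<^sup>2 + \<delta>\<^sup>2) * (R j)\<^sup>2"
      by (simp add: w_def power_divide power_mult_distrib)
    also have "\<dots> \<le> 1 * (R j)\<^sup>2"
      using \<delta> by (intro mult_right_mono) (auto simp: divide_le_eq add_nonneg_pos)
    finally show ?thesis by simp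
  qed
  have sub: "f a + f b \<le> (\<Sum>j\<in>UNIV. f j)" if "\<And>j. f j \<ge> (0::real)" for f
    using sum_mono2[of UNIV "{a,b}" f] that ab by simp
  have sI: "(I a)\<^sup>2 + (I b)\<^sup>2 \<le> (\<Sum>j\<in>UNIV. (norm (d j))\<^sup>2) - (\<Sum>j\<in>UNIV. (w j)\<^sup>2)"
  proof -
    have "(I a)\<^sup>2 + (I b)\<^sup>2 \<le> (\<Sum>j\<in>UNIV. (I j)\<^sup>2)" by (rule sub) simp
    also have "\<dots> \<le> (\<Sum>j\<in>UNIV. (norm (d j))\<^sup>2 - (w j)\<^sup>2)" by (rule sum_mono) (use w nd in \<open>simp add: add.commute\<close>)
    finally show ?thesis by (simp add: sum_subtractf)
  qed
  have sR: "(R a)\<^sup>2 + (R b)\<^sup>2 \<le> (\<Sum>j\<in>UNIV. (norm (d j))\<^sup>2)"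
  proof -
    have "(R a)\<^sup>2 + (R b)\<^sup>2 \<le> (\<Sum>j\<in>UNIV. (R j)\<^sup>2)" by (rule sub) simp
    also have "\<dots> \<le> (\<Sum>j\<in>UNIV. (norm (d j))\<^sup>2)" by (rule sum_mono) (use nd in simp)
    finally show ?thesis .
  qed
  have amgm: "\<bar>x * y\<bar> \<le> 1/2 * (t * x\<^sup>2 + y\<^sup>2 / t)" for x y :: real
  proof -
    have "0 \<le> (t * \<bar>x\<bar> - \<bar>y\<bar>)\<^sup>2 / t" using t by simp
    also have "\<dots> = t * x\<^sup>2 + y\<^sup>2 / t - 2 * \<bar>x * y\<bar>" using t by (simp add: power2_eq_square field_simps abs_mult)
    finally show ?thesis by simp
  qed
  have "\<bar>Im (cnj (d a) * d b)\<bar> \<le> \<bar>R a * I b\<bar> + \<bar>R b * I a\<bar>" unfolding im by (simp add: mult.commute)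
  also have "\<dots> \<le> 1/2 * (t * (R a)\<^sup>2 + (I b)\<^sup>2 / t) + 1/2 * (t * (R b)\<^sup>2 + (I a)\<^sup>2 / t)"
    by (intro add_mono amgm)
  also have "\<dots> = 1/2 * (t * ((R a)\<^sup>2 + (R b)\<^sup>2) + ((I a)\<^sup>2 + (I b)\<^sup>2) / t)" using t by (simp add: field_simps)
  also have "\<dots> \<le> 1/2 * (t * (\<Sum>j\<in>UNIV. (norm (d j))\<^sup>2) + ((\<Sum>j\<in>UNIV. (norm (d j))\<^sup>2) - (\<Sum>j\<in>UNIV. (w j)\<^sup>2)) / t)"
    using sI sR t by (intro mult_left_mono add_mono divide_right_mono) auto
  finally show "\<bar>Im (cnj (d a) * d b)\<bar> \<le> 1/2 * (t * (\<Sum>j\<in>UNIV. (norm (d j))\<^sup>2) + ((\<Sum>j\<in>UNIV. (norm (d j))\<^sup>2) - (\<Sum>j\<in>UNIV. (w j)\<^sup>2)) / t)" .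
  show "(\<Sum>j\<in>UNIV. (w j)\<^sup>2) \<le> (\<Sum>j\<in>UNIV. (norm (d j))\<^sup>2)"
    using sI zero_le_power2[of "I a"] zero_le_power2[of "I b"] by linarith
qed

text \<open>The square root with \<delta> makes the modulus differentiable at zeros of f;
  subtracting \<delta> restores compact support and keeps v between 0 and the modulus. The gain
  follows by integrating the pointwise inequality against the commutator identity. It is stated with
  an upper bound L of the kinetic energy so that it is uniform along a sequence of
  approximations.\<close>

lemma strict_diamagnetic:
  fixes f :: "real^'n::finite \<Rightarrow> complex"
  assumes f: "\<And>j. has_pd j f (f' j)" "continuous_on UNIV f" "\<And>j. continuous_on UNIV (f' j)" "cpt_supp f"
    and ab: "a \<noteq> b" and \<gamma>: "\<gamma> > 0" and \<delta>: "\<delta> > 0" and L: "L > 0" and p: "p > 0"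
    and K: "(LINT x|lborel. (\<Sum>j\<in>UNIV. (norm (cov_deriv \<gamma> a b f f' j x))\<^sup>2)) \<le> L"
  defines "v \<equiv> \<lambda>x. sqrt ((norm (f x))\<^sup>2 + \<delta>\<^sup>2) - \<delta>"
    and "v' \<equiv> \<lambda>j x. Re (cnj (f x) * f' j x) / sqrt ((norm (f x))\<^sup>2 + \<delta>\<^sup>2)"
  shows "admissible p v v'" and "mass v \<le> (LINT x|lborel. (norm (f x))\<^sup>2)"
    and "kinetic v' \<le> (LINT x|lborel. (\<Sum>j\<in>UNIV. (norm (cov_deriv \<gamma> a b f f' j x))\<^sup>2)) - (\<gamma> * (LINT x|lborel. (norm (f x))\<^sup>2))\<^sup>2 / L"
proof -
  let ?D = "cov_deriv \<gamma> a b f f'"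
  have pos: "(norm (f x))\<^sup>2 + \<delta>\<^sup>2 > 0" for x using \<delta> by (simp add: add_nonneg_pos)
  have "0 \<le> v x \<and> v x \<le> norm (f x)" for x
  proof -
    have "sqrt (\<delta>\<^sup>2) \<le> sqrt ((norm (f x))\<^sup>2 + \<delta>\<^sup>2)" by (intro real_sqrt_le_mono) auto
    moreover have "sqrt ((norm (f x))\<^sup>2 + \<delta>\<^sup>2) \<le> sqrt ((norm (f x))\<^sup>2) + sqrt (\<delta>\<^sup>2)" by (rule sqrt_add_le_add_sqrt) auto
    ultimately show ?thesis using \<delta> by (simp add: v_def)
  qed
  then have vb: "0 \<le> v x" "v x \<le> norm (f x)" for x by auto
  obtain R where R: "\<And>x. norm x > R \<Longrightarrow> f x = 0" using f(4) by (auto simp: cpt_supp_def)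
  have s': "cpt_supp (f' j)" for j using cpt_supp_has_pd[OF f(1,4)] .
  have sv: "cpt_supp v" using R \<delta> by (auto simp: cpt_supp_def v_def intro!: exI[of _ R])
  have cv: "continuous_on UNIV v" unfolding v_def by (intro continuous_intros f)
  have cv': "continuous_on UNIV (v' j)" for j unfolding v'_def
    using \<delta> pos by (intro continuous_intros f) (simp add: add_nonneg_eq_0_iff)
  have pdv: "has_pd j v (v' j)" for j
    unfolding has_pd_def
  proof
    fix x
    have 1: "((\<lambda>t. (norm (f (x + t *\<^sub>R axis j 1)))\<^sup>2) has_real_derivative 2 * Re (cnj (f x) * f' j x)) (at 0)"
      using has_pd_norm_square[OF f(1)[of j]] by (simp add: has_pd_def has_real_derivative_iff_has_vector_derivative)
    have "((\<lambda>t. sqrt ((norm (f (x + t *\<^sub>R axis j 1)))\<^sup>2 + \<delta>\<^sup>2) - \<delta>) has_real_derivative v' j x) (at 0)"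
    proof -
      have "((\<lambda>t. (norm (f (x + t *\<^sub>R axis j 1)))\<^sup>2 + \<delta>\<^sup>2) has_real_derivative 2 * Re (cnj (f x) * f' j x)) (at 0)"
        using DERIV_add[OF 1 DERIV_const[of "\<delta>\<^sup>2"]] by simp
      moreover have "(sqrt has_real_derivative inverse (sqrt ((norm (f x))\<^sup>2 + \<delta>\<^sup>2)) / 2) (at ((norm (f (x + 0 *\<^sub>R axis j 1)))\<^sup>2 + \<delta>\<^sup>2))"
        using DERIV_real_sqrt[OF pos[of x]] by simp
      ultimately have "((\<lambda>t. sqrt ((norm (f (x + t *\<^sub>R axis j 1)))\<^sup>2 + \<delta>\<^sup>2)) has_real_derivative
          inverse (sqrt ((norm (f x))\<^sup>2 + \<delta>\<^sup>2)) / 2 * (2 * Re (cnj (f x) * f' j x))) (at 0)"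
        by (rule DERIV_chain2[rotated])
      from DERIV_diff[OF this DERIV_const[of \<delta>]]
      have D: "((\<lambda>t. sqrt ((norm (f (x + t *\<^sub>R axis j 1)))\<^sup>2 + \<delta>\<^sup>2) - \<delta>) has_real_derivative
          inverse (sqrt ((norm (f x))\<^sup>2 + \<delta>\<^sup>2)) / 2 * (2 * Re (cnj (f x) * f' j x)) - 0) (at 0)" .
      have e: "inverse s / 2 * (2 * q) - 0 = q / s" for s q :: real
        by (cases "s = 0") (simp_all add: field_simps)
      show ?thesis using D unfolding v'_def e .
    qed
    then show "((\<lambda>t. v (x + t *\<^sub>R axis j 1)) has_vector_derivative v' j x) (at 0)"
      by (simp add: v_def has_real_derivative_iff_has_vector_derivative)
  qed
  show n: "admissible p v v'" by (rule admissible_cpt_supp[OF p cv cv' pdv sv])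
  have iM: "integrable lborel (\<lambda>x. (norm (f x))\<^sup>2)"
    by (intro integrable_cpt_supp continuous_intros f) (use R in \<open>auto simp: cpt_supp_def\<close>)
  show "mass v \<le> (LINT x|lborel. (norm (f x))\<^sup>2)" unfolding mass_def
    using n iM vb by (intro integral_mono) (auto simp: admissible_def intro: power_mono)
  have cA: "continuous_on UNIV (\<lambda>x. mag_potential \<gamma> a b x $ j)" for j
    by (intro continuous_intros continuous_confinement)
  have cD: "continuous_on UNIV (?D j)" for j unfolding cov_deriv_def[abs_def] by (intro continuous_intros f cA)
  have sD: "cpt_supp (?D j)" for j
  proof -
    obtain S where "\<And>x. norm x > S \<Longrightarrow> f' j x = 0" using s'[of j] by (auto simp: cpt_supp_def)
    then show ?thesis using R by (auto simp: cpt_supp_def cov_deriv_def intro!: exI[of _ "max R S"])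
  qed
  have iD: "integrable lborel (\<lambda>x. \<Sum>j\<in>UNIV. (norm (?D j x))\<^sup>2)"
  proof (intro Bochner_Integration.integrable_sum integrable_cpt_supp continuous_intros cD)
    show "cpt_supp (\<lambda>x. (norm (?D j x))\<^sup>2)" for j using sD[of j] by (auto simp: cpt_supp_def)
  qed
  have iI: "integrable lborel (\<lambda>x. Im (cnj (?D a x) * ?D b x))"
    by (intro integrable_Im integrable_cpt_supp continuous_intros cD cpt_supp_mult sD)
  have iv: "integrable lborel (\<lambda>x. \<Sum>j\<in>UNIV. (v' j x)\<^sup>2)" using n by (auto simp: admissible_def)
  \<comment> \<open>The potential is real, so it contributes only an imaginary part to
    \<open>cnj (f x) * ?D j x\<close>; ordinary and covariant derivatives yield the same derivative
    of the modulus.\<close>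
  have ReD: "v' j x = Re (cnj (f x) * ?D j x) / sqrt ((norm (f x))\<^sup>2 + \<delta>\<^sup>2)" for j x
    by (simp add: v'_def cov_deriv_def algebra_simps)
  define KD where "KD = (LINT x|lborel. (\<Sum>j\<in>UNIV. (norm (?D j x))\<^sup>2))"
  define M where "M = (LINT x|lborel. (norm (f x))\<^sup>2)"
  have main: "\<gamma> * M \<le> 1/2 * (t * KD + (KD - kinetic v') / t)" if t: "t > 0" for t
  proof -
    have "\<gamma> * M = (LINT x|lborel. Im (cnj (?D a x) * ?D b x))"
      using commutator_identity[OF f ab] by (simp add: M_def)
    also have "\<dots> \<le> (LINT x|lborel. 1/2 * (t * (\<Sum>j\<in>UNIV. (norm (?D j x))\<^sup>2) + ((\<Sum>j\<in>UNIV. (norm (?D j x))\<^sup>2) - (\<Sum>j\<in>UNIV. (v' j x)\<^sup>2)) / t))"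
    proof (rule integral_mono[OF iI])
      show "integrable lborel (\<lambda>x. 1/2 * (t * (\<Sum>j\<in>UNIV. (norm (?D j x))\<^sup>2) + ((\<Sum>j\<in>UNIV. (norm (?D j x))\<^sup>2) - (\<Sum>j\<in>UNIV. (v' j x)\<^sup>2)) / t))"
        using iD iv by (intro integrable_mult_right Bochner_Integration.integrable_add Bochner_Integration.integrable_diff integrable_divide)
      fix x
      show "Im (cnj (?D a x) * ?D b x) \<le> 1/2 * (t * (\<Sum>j\<in>UNIV. (norm (?D j x))\<^sup>2) + ((\<Sum>j\<in>UNIV. (norm (?D j x))\<^sup>2) - (\<Sum>j\<in>UNIV. (v' j x)\<^sup>2)) / t)"
        using strict_diamagnetic_pointwise(1)[OF ab t \<delta>, where d="\<lambda>j. ?D j x" and z="f x"]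
        unfolding ReD by (rule order_trans[OF abs_ge_self])
    qed
    also have "\<dots> = 1/2 * (t * KD + (KD - kinetic v') / t)"
    proof -
      note i = integrable_mult_right[OF iD, of t] integrable_divide[OF Bochner_Integration.integrable_diff[OF iD iv], of t]
      show ?thesis unfolding KD_def kinetic_def
        by (simp only: integral_mult_right_zero integral_divide_zero Bochner_Integration.integral_add[OF i] Bochner_Integration.integral_diff[OF iD iv])
    qed
    finally show ?thesis .
  qed
  have le: "kinetic v' \<le> KD"
    unfolding KD_def kinetic_def
    using strict_diamagnetic_pointwise(2)[OF ab zero_less_one \<delta>, where d="\<lambda>j. ?D j _" and z="f _"]
    by (intro integral_mono iD iv) (unfold ReD)
  have "kinetic v' \<le> KD - (\<gamma> * M)\<^sup>2 / L"
  proof (cases "M > 0")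
    case False
    have "M \<ge> 0" unfolding M_def by (rule Bochner_Integration.integral_nonneg) simp
    then show ?thesis using False le by simp
  next
    case True
    \<comment> \<open>The weight \<open>t = s / L\<close> makes the first term on the right of
      \<open>main\<close> at most \<open>s / 2\<close>, so half of s is absorbed and the kinetic
      loss must account for the rest. The weight has to be positive, whence the case
      distinction.\<close>
    define s where "s = \<gamma> * M"
    have s: "s > 0" using True \<gamma> by (simp add: s_def)
    have "s / L * KD \<le> s / L * L" using s L K by (intro mult_left_mono) (auto simp: KD_def)
    then have 1: "s / L * KD \<le> s" using L by simp
    have "s \<le> 1/2 * (s / L * KD + (KD - kinetic v') / (s / L))"
      using main[of "s / L"] s L by (simp add: s_def)
    then have "s \<le> (KD - kinetic v') * (L / s)" using 1 by simp
    then have "s * s \<le> (KD - kinetic v') * L" using s by (simp add: field_simps)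
    then show ?thesis using L by (simp add: s_def power2_eq_square field_simps)
  qed
  then show "kinetic v' \<le> (LINT x|lborel. (\<Sum>j\<in>UNIV. (norm (?D j x))\<^sup>2)) - (\<gamma> * (LINT x|lborel. (norm (f x))\<^sup>2))\<^sup>2 / L"
    by (simp add: KD_def M_def)
qed

section \<open>Regularization in the magnetic energy space\<close>

text \<open>The factor \<open>exp 1\<close> normalizes the value at the origin to 1, as
  \<open>bump 1 0\<close> is \<open>exp (- 1)\<close>.\<close>

definition cutoff :: "real^'n::finite \<Rightarrow> real" where
  "cutoff x = exp 1 * bump 1 x"

lemma cutoff_props:
  fixes x :: "real^'n::finite"
  shows "0 \<le> cutoff x" "cutoff x \<le> 1" "continuous_on UNIV (cutoff :: real^'n \<Rightarrow> real)"
    "cpt_supp (cutoff :: real^'n \<Rightarrow> real)" "has_pd j (cutoff :: real^'n \<Rightarrow> real) (\<lambda>x. exp 1 * bump_pd 1 j x)"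
    "(\<lambda>n. cutoff ((1 / real (Suc n)) *\<^sub>R x)) \<longlonglongrightarrow> 1"
proof -
  show "0 \<le> cutoff x" by (simp add: cutoff_def bump_nonneg)
  show "cutoff x \<le> 1"
  proof (cases "norm x < 1")
    case True
    then have t: "0 < 1 - (norm x)\<^sup>2" "1 - (norm x)\<^sup>2 \<le> 1" using power_strict_mono[of "norm x" 1 2] by auto
    then have "1 + - 1 / (1 - (norm x)\<^sup>2) \<le> 0" by (simp add: field_simps)
    then have "exp (1 + - 1 / (1 - (norm x)\<^sup>2)) \<le> exp 0" by (subst exp_le_cancel_iff)
    then show ?thesis using t(1) by (simp only: cutoff_def bump_def flat_def exp_add[symmetric] one_power2 if_True power_0 div_by_1) simp
  next
    case False then show ?thesis using bump_supp(1)[of 1 x] by (simp add: cutoff_def)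
  qed
  show c: "continuous_on UNIV (cutoff :: real^'n \<Rightarrow> real)"
    unfolding cutoff_def[abs_def] by (intro continuous_intros continuous_bump)
  show "cpt_supp (cutoff :: real^'n \<Rightarrow> real)"
    unfolding cutoff_def[abs_def] by (intro cpt_supp_mult cpt_supp_bump) simp
  show "has_pd j (cutoff :: real^'n \<Rightarrow> real) (\<lambda>x. exp 1 * bump_pd 1 j x)"
    unfolding cutoff_def[abs_def] by (rule has_pd_bounded_linear[OF bounded_linear_mult_right has_pd_bump])
  have "(\<lambda>n. (1 / real (Suc n)) *\<^sub>R x) \<longlonglongrightarrow> 0 *\<^sub>R x"
    using LIMSEQ_inverse_real_of_nat by (intro tendsto_intros) (simp add: divide_inverse)
  then have "(\<lambda>n. cutoff ((1 / real (Suc n)) *\<^sub>R x)) \<longlonglongrightarrow> cutoff (0 :: real^'n)"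
    by (intro continuous_on_tendsto_compose[OF c]) auto
  then show "(\<lambda>n. cutoff ((1 / real (Suc n)) *\<^sub>R x)) \<longlonglongrightarrow> 1"
    by (simp add: cutoff_def bump_def flat_def exp_minus)
qed

text \<open>Dilation by r makes the gradient of order r, uniformly in x and in the direction; for
  small r the cutoff therefore costs little kinetic energy.\<close>

lemma cutoff_scaled:
  obtains C :: real where "C > 0"
    "\<And>r j (x :: real^'n::finite). r > 0 \<Longrightarrow> has_pd j (\<lambda>x :: real^'n. cutoff (r *\<^sub>R x)) (\<lambda>x. r * (exp 1 * bump_pd 1 j (r *\<^sub>R x)))"
    "\<And>r j (x :: real^'n). r > 0 \<Longrightarrow> \<bar>r * (exp 1 * bump_pd 1 j (r *\<^sub>R x))\<bar> \<le> C * r"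
    "\<And>r. r > 0 \<Longrightarrow> cpt_supp (\<lambda>x :: real^'n. cutoff (r *\<^sub>R x))"
    "\<And>r. continuous_on UNIV (\<lambda>x :: real^'n. cutoff (r *\<^sub>R x))"
    "\<And>r j. continuous_on UNIV (\<lambda>x :: real^'n. r * (exp 1 * bump_pd 1 j (r *\<^sub>R x)))"
proof -
  have "\<exists>C>0. \<forall>x :: real^'n. \<bar>bump_pd 1 j x\<bar> \<le> C" for j
    using cpt_supp_bounded[OF continuous_bump(2) cpt_supp_bump(2)[OF zero_less_one], of j] by (metis real_norm_def)
  then obtain C where C: "\<And>j. C j > 0" "\<And>j (x :: real^'n). \<bar>bump_pd 1 j x\<bar> \<le> C j" by metis
  define B where "B = exp 1 * (\<Sum>j\<in>UNIV. C j)"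
  have B: "exp 1 * \<bar>bump_pd 1 j (x :: real^'n)\<bar> \<le> B" for j x
    unfolding B_def using member_le_sum[of j UNIV C] C by (intro mult_left_mono) (auto intro: order_trans less_imp_le)
  show thesis
  proof (rule that[of "B + 1"])
    show "B + 1 > 0" unfolding B_def using C(1) by (intro add_nonneg_pos mult_nonneg_nonneg sum_nonneg) (auto intro: less_imp_le)
    show "has_pd j (\<lambda>x :: real^'n. cutoff (r *\<^sub>R x)) (\<lambda>x. r * (exp 1 * bump_pd 1 j (r *\<^sub>R x)))" for r j
      using has_pd_scale[OF cutoff_props(5)[of j], of 1 r] by simp
    show "\<bar>r * (exp 1 * bump_pd 1 j (r *\<^sub>R x))\<bar> \<le> (B + 1) * r" if "r > 0" for r j and x :: "real^'n"
    proof -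
      have "\<bar>r * (exp 1 * bump_pd 1 j (r *\<^sub>R x))\<bar> = r * (exp 1 * \<bar>bump_pd 1 j (r *\<^sub>R x)\<bar>)" using that by (simp add: abs_mult)
      also have "\<dots> \<le> r * B" using B that by (intro mult_left_mono) auto
      finally show ?thesis using that by (simp add: algebra_simps)
    qed
    show "cpt_supp (\<lambda>x :: real^'n. cutoff (r *\<^sub>R x))" if "r > 0" for r
    proof -
      have "cutoff (r *\<^sub>R x) = 0" if "norm x > 1 / r" for x :: "real^'n"
      proof -
        have "norm (r *\<^sub>R x) \<ge> 1" using that \<open>r > 0\<close> by (simp add: field_simps)
        then show ?thesis using bump_supp(1)[of 1 "r *\<^sub>R x"] by (simp add: cutoff_def)
      qed
      then show ?thesis by (auto simp: cpt_supp_def)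
    qed
    show "continuous_on UNIV (\<lambda>x :: real^'n. cutoff (r *\<^sub>R x))" for r
      by (intro continuous_on_compose2[OF cutoff_props(3)] continuous_intros) auto
    show "continuous_on UNIV (\<lambda>x :: real^'n. r * (exp 1 * bump_pd 1 j (r *\<^sub>R x)))" for r j
      by (intro continuous_intros continuous_on_compose2[OF continuous_bump(2)[of UNIV]]) auto
  qed
qed

text \<open>The crude dimensional factor is harmless: the bound will be used only for x within a
  mollifier radius.\<close>

lemma norm_mag_potential_le:
  assumes "\<gamma> \<ge> 0"
  shows "norm (mag_potential \<gamma> a b (x :: real^'n::finite)) \<le> real CARD('n) * \<gamma> * norm x"
proof -
  have "\<bar>mag_potential \<gamma> a b x $ j\<bar> \<le> \<gamma> * norm x" for j
    using assms component_le_norm_cart[of x a] component_le_norm_cart[of x b]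
    by (auto simp: mag_potential_nth abs_mult intro!: mult_left_mono)
  then have "(\<Sum>j\<in>UNIV. \<bar>mag_potential \<gamma> a b x $ j\<bar>) \<le> (\<Sum>j\<in>(UNIV::'n set). \<gamma> * norm x)" by (intro sum_mono)
  then show ?thesis using norm_le_l1_cart[of "mag_potential \<gamma> a b x"] by simp
qed

lemma mag_potential_diff: "mag_potential \<gamma> a b (x - y) $ j = mag_potential \<gamma> a b x $ j - mag_potential \<gamma> a b y $ j"
  by (simp add: mag_potential_nth right_diff_distrib)

text \<open>The reflected mollifier is a test function. Testing the weak derivative with it moves
  the derivative from the kernel onto the function, so the classical derivative of the mollification
  is the mollified weak derivative.\<close>

lemma conv_weak_derivative:
  fixes \<phi> g :: "real^'n::finite \<Rightarrow> complex"
  assumes l: "loc_int \<phi>" "loc_int g" and e: "e > 0"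
    and w: "\<And>\<eta>. test_function \<eta> \<Longrightarrow> (LINT x|lborel. \<phi> x * partial_deriv j \<eta> x) = - (LINT x|lborel. g x * \<eta> x)"
  shows "has_pd j (conv (mollifier e) \<phi>) (conv (mollifier e) g)"
proof -
  have "conv (mollifier_pd e j) \<phi> x = conv (mollifier e) g x" for x
  proof -
    define k where "k = inverse (LINT y|lborel. bump e (y :: real^'n))"
    have "(LINT y|lborel. \<phi> y * (- complex_of_real (k * bump_pd e j (x - y)))) = - (LINT y|lborel. g y * complex_of_real (k * bump e (x - y)))"
      using w[OF shifted_bump(1)[OF e, of k x]] unfolding shifted_bump(2)[OF e] .
    moreover have "(LINT y|lborel. \<phi> y * (- complex_of_real (k * bump_pd e j (x - y)))) = - (LINT y|lborel. \<phi> y * complex_of_real (k * bump_pd e j (x - y)))"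
      by (simp only: mult_minus_right integral_minus)
    ultimately have "(LINT y|lborel. \<phi> y * complex_of_real (k * bump_pd e j (x - y))) = (LINT y|lborel. g y * complex_of_real (k * bump e (x - y)))"
      by simp
    then show ?thesis
      unfolding conv_def mollifier_def mollifier_pd_def k_def[symmetric] scaleR_conv_of_real by (simp only: mult.commute[of _ "complex_of_real _"])
  qed
  then have "conv (mollifier_pd e j) \<phi> = conv (mollifier e) g" by blast
  then show ?thesis
    using has_pd_conv[OF l(1) mollifier_props(3,5,7,4)[OF e]] by metis
qed

lemma integrable_vec:
  fixes F :: "'a \<Rightarrow> 'b::euclidean_space^'n::finite"
  assumes "\<And>j. integrable M (\<lambda>y. F y $ j)"
  shows "integrable M F"
proof -
  have b: "bounded_linear (\<lambda>z. axis j z :: 'b^'n)" for j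
    by (rule linear_conv_bounded_linear[THEN iffD1]) (auto intro!: linearI simp: axis_def vec_eq_iff)
  have "F = (\<lambda>y. \<Sum>j\<in>UNIV. axis j (F y $ j))"
    by (simp add: fun_eq_iff vec_eq_iff axis_def if_distrib cong: if_cong)
  moreover have "integrable M (\<lambda>y. \<Sum>j\<in>UNIV. axis j (F y $ j) :: 'b^'n)"
    by (intro Bochner_Integration.integrable_sum integrable_bounded_linear[OF b] assms)
  ultimately show ?thesis by simp
qed

text \<open>As \<open>A\<close> is linear, commuting it with the mollifier leaves \<open>A(x - y)\<close>, which is of order \<open>e\<close> on the support.\<close>

lemma conv_cov_deriv_bound:
  fixes \<phi> :: "real^'n::finite \<Rightarrow> complex" and g :: "'n \<Rightarrow> real^'n \<Rightarrow> complex" and a b :: 'n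
  assumes \<phi>: "loc_int \<phi>" and g: "\<And>j. loc_int (g j)" and e: "e > 0" and \<gamma>: "\<gamma> \<ge> 0"
  defines "N \<equiv> \<lambda>x. norm (\<chi> j. cov_deriv \<gamma> a b \<phi> g j x)"
  assumes N: "loc_int N"
  shows "norm (\<chi> j. cov_deriv \<gamma> a b (conv (mollifier e) \<phi>) (\<lambda>j. conv (mollifier e) (g j)) j x)
    \<le> (LINT y|lborel. mollifier e (x - y) * (N y + real CARD('n) * \<gamma> * e * norm (\<phi> y)))"
proof -
  let ?A = "mag_potential \<gamma> a b"
  note k = kernel_mollifier[OF e, where 'n='n]
  have kc: "continuous_on UNIV (mollifier e :: real^'n \<Rightarrow> real)" "cpt_supp (mollifier e :: real^'n \<Rightarrow> real)"
    using k by (auto simp: kernel_def)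
  \<comment> \<open>From \<open>A x = A y + A (x - y)\<close>: the covariant derivative with the
    potential frozen at x is the one at y minus the contribution of
    \<open>A (x - y)\<close>.\<close>
  define F where "F y = (\<chi> j. cov_deriv \<gamma> a b \<phi> g j y - \<i> * of_real (?A (x - y) $ j) * \<phi> y)" for y
  have Fj: "mollifier e (x - y) *\<^sub>R F y $ j = mollifier e (x - y) *\<^sub>R g j y - (\<i> * of_real (?A x $ j)) * (mollifier e (x - y) *\<^sub>R \<phi> y)" for y j
    by (simp add: F_def cov_deriv_def mag_potential_diff scaleR_conv_of_real algebra_simps)
  have iFj: "integrable lborel (\<lambda>y. mollifier e (x - y) *\<^sub>R F y $ j)" for j
    unfolding Fj by (intro Bochner_Integration.integrable_diff integrable_mult_right integrable_conv[OF g kc] integrable_conv[OF \<phi> kc])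
  have iF: "integrable lborel (\<lambda>y. mollifier e (x - y) *\<^sub>R F y)"
    by (rule integrable_vec) (use iFj in simp)
  have "(\<chi> j. cov_deriv \<gamma> a b (conv (mollifier e) \<phi>) (\<lambda>j. conv (mollifier e) (g j)) j x) = (LINT y|lborel. mollifier e (x - y) *\<^sub>R F y)"
  proof (rule vec_eq_iff[THEN iffD2], rule allI)
    fix j
    have "(LINT y|lborel. mollifier e (x - y) *\<^sub>R F y) $ j = (LINT y|lborel. mollifier e (x - y) *\<^sub>R F y $ j)"
      using integral_bounded_linear[OF bounded_linear_vec_nth[of j] iF] by simp
    also have "\<dots> = conv (mollifier e) (g j) x - \<i> * of_real (?A x $ j) * conv (mollifier e) \<phi> x"
      unfolding Fj conv_def
      by (simp only: Bochner_Integration.integral_diff[OF integrable_conv[OF g[of j] kc] integrable_mult_right[OF integrable_conv[OF \<phi> kc]]]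
          integral_mult_right_zero)
    finally show "(\<chi> j. cov_deriv \<gamma> a b (conv (mollifier e) \<phi>) (\<lambda>j. conv (mollifier e) (g j)) j x) $ j = (LINT y|lborel. mollifier e (x - y) *\<^sub>R F y) $ j"
      by (simp add: cov_deriv_def)
  qed
  then have "norm (\<chi> j. cov_deriv \<gamma> a b (conv (mollifier e) \<phi>) (\<lambda>j. conv (mollifier e) (g j)) j x) = norm (LINT y|lborel. mollifier e (x - y) *\<^sub>R F y)"
    by simp
  also have "\<dots> \<le> (LINT y|lborel. norm (mollifier e (x - y) *\<^sub>R F y))" by (rule integral_norm_bound)
  also have "\<dots> \<le> (LINT y|lborel. mollifier e (x - y) * (N y + real CARD('n) * \<gamma> * e * norm (\<phi> y)))"
  proof (rule integral_mono[OF integrable_norm[OF iF]])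
    show "integrable lborel (\<lambda>y. mollifier e (x - y) * (N y + real CARD('n) * \<gamma> * e * norm (\<phi> y)))"
      using integrable_conv[OF N kc, of x] integrable_mult_right[OF integrable_norm_conv[OF k \<phi>, of x], of "real CARD('n) * \<gamma> * e"]
      by (simp add: distrib_left mult.left_commute)
    fix y
    show "norm (mollifier e (x - y) *\<^sub>R F y) \<le> mollifier e (x - y) * (N y + real CARD('n) * \<gamma> * e * norm (\<phi> y))"
    proof (cases "norm (x - y) \<ge> e")
      case True then show ?thesis using mollifier_props(2)[OF e True] by simp
    next
      case False
      have "F y = (\<chi> j. cov_deriv \<gamma> a b \<phi> g j y) - (\<chi> j. \<i> * of_real (?A (x - y) $ j) * \<phi> y)"
        by (simp add: F_def vec_eq_iff)
      then have "norm (F y) \<le> N y + norm (\<chi> j. \<i> * of_real (?A (x - y) $ j) * \<phi> y)"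
        unfolding N_def by (simp only: norm_triangle_ineq4)
      moreover have "norm (\<chi> j. \<i> * of_real (?A (x - y) $ j) * \<phi> y) = norm (?A (x - y)) * norm (\<phi> y)"
      proof -
        have "(norm (\<chi> j. \<i> * of_real (?A (x - y) $ j) * \<phi> y))\<^sup>2 = (norm (?A (x - y)) * norm (\<phi> y))\<^sup>2"
          unfolding power_mult_distrib norm_vec_square by (simp add: norm_mult power_mult_distrib sum_distrib_right)
        then show ?thesis by (simp add: power2_eq_iff_nonneg)
      qed
      moreover have "norm (?A (x - y)) * norm (\<phi> y) \<le> real CARD('n) * \<gamma> * e * norm (\<phi> y)"
      proof (rule mult_right_mono)
        have "norm (?A (x - y)) \<le> real CARD('n) * \<gamma> * norm (x - y)" by (rule norm_mag_potential_le[OF \<gamma>])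
        also have "\<dots> \<le> real CARD('n) * \<gamma> * e" using False \<gamma> by (intro mult_left_mono) auto
        finally show "norm (?A (x - y)) \<le> real CARD('n) * \<gamma> * e" .
      qed simp
      ultimately have "norm (F y) \<le> N y + real CARD('n) * \<gamma> * e * norm (\<phi> y)" by linarith
      then show ?thesis using mollifier_props(1)[OF e, of "x - y"] by (simp add: mult_left_mono)
    qed
  qed
  finally show ?thesis .
qed

text \<open>The approximations are cutoffs of mollifications. Their mass does not exceed that of
  \<phi>, and their magnetic kinetic energy exceeds that of \<phi> at most by an error vanishing
  with \<kappa>. Convergence of the gradients is not part of the conclusion: an upper bound of the
  kinetic energy and pointwise convergence are what the limit argument takes.\<close>

lemma approximating_sequence:
  fixes \<phi> :: "real^'n::finite \<Rightarrow> complex" and g :: "'n \<Rightarrow> real^'n \<Rightarrow> complex" and a b :: 'n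
  assumes \<phi>: "\<phi> \<in> borel_measurable borel" "integrable lborel (\<lambda>x. (norm (\<phi> x))\<^sup>2)"
    and g: "\<And>j. loc_int (g j)" and \<gamma>: "\<gamma> \<ge> 0"
    and w: "\<And>j \<eta>. test_function \<eta> \<Longrightarrow> (LINT x|lborel. \<phi> x * partial_deriv j \<eta> x) = - (LINT x|lborel. g j x * \<eta> x)"
  defines "N \<equiv> \<lambda>x. norm (\<chi> j. cov_deriv \<gamma> a b \<phi> g j x)"
  assumes N: "N \<in> borel_measurable borel" "integrable lborel (\<lambda>x. (N x)\<^sup>2)"
  obtains f f' \<kappa> where "\<And>n j. has_pd j (f n) (f' n j)" "\<And>n::nat. continuous_on UNIV (f n)"
    "\<And>n j. continuous_on UNIV (f' n j)" "\<And>n. cpt_supp (f n)" "\<kappa> \<longlonglongrightarrow> (0::real)"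
    "\<And>n. (LINT x|lborel. (norm (f n x))\<^sup>2) \<le> (LINT x|lborel. (norm (\<phi> x))\<^sup>2)"
    "\<And>n. (LINT x|lborel. (\<Sum>j\<in>UNIV. (norm (cov_deriv \<gamma> a b (f n) (f' n) j x))\<^sup>2)) \<le>
        (1 + \<kappa> n) * (LINT x|lborel. (N x)\<^sup>2) + (\<kappa> n + (\<kappa> n)\<^sup>2) * (LINT x|lborel. (norm (\<phi> x))\<^sup>2)"
    "AE x in lborel. (\<lambda>n. f n x) \<longlonglongrightarrow> \<phi> x"
proof -
  have l\<phi>: "loc_int \<phi>" by (rule loc_int_square[OF \<phi>])
  have lN: "loc_int N" using loc_int_square[OF N(1)] N(2) by (simp add: N_def)
  define ct where "ct n x = cutoff ((1 / real (Suc n)) *\<^sub>R x)" for n and x :: "real^'n"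
  define ct' where "ct' n j x = (1 / real (Suc n)) * (exp 1 * bump_pd 1 j ((1 / real (Suc n)) *\<^sub>R x))" for n j and x :: "real^'n"
  obtain C where C0: "C > 0" and Cpd: "\<And>n j. has_pd j (ct n) (ct' n j)" and C: "\<And>n j x. \<bar>ct' n j x\<bar> \<le> C / real (Suc n)"
    and Cs: "\<And>n. cpt_supp (ct n)" and Cc: "\<And>n. continuous_on UNIV (ct n)" "\<And>n j. continuous_on UNIV (ct' n j)"
  proof (rule cutoff_scaled[where ?'n='n])
    fix C :: real
    assume 1: "C > 0"
    "\<And>r j (x :: real^'n). r > 0 \<Longrightarrow> has_pd j (\<lambda>x :: real^'n. cutoff (r *\<^sub>R x)) (\<lambda>x. r * (exp 1 * bump_pd 1 j (r *\<^sub>R x)))"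
    "\<And>r j (x :: real^'n). r > 0 \<Longrightarrow> \<bar>r * (exp 1 * bump_pd 1 j (r *\<^sub>R x))\<bar> \<le> C * r"
    "\<And>r. r > 0 \<Longrightarrow> cpt_supp (\<lambda>x :: real^'n. cutoff (r *\<^sub>R x))"
    "\<And>r. continuous_on UNIV (\<lambda>x :: real^'n. cutoff (r *\<^sub>R x))"
    "\<And>r j. continuous_on UNIV (\<lambda>x :: real^'n. r * (exp 1 * bump_pd 1 j (r *\<^sub>R x)))"
    have p: "1 / real (Suc n) > 0" for n by simp
    show thesis
    proof (rule that[OF 1(1)])
      show "has_pd j (ct n) (ct' n j)" for n j unfolding ct_def[abs_def] ct'_def[abs_def] by (rule 1(2)[OF p])
      show "\<bar>ct' n j x\<bar> \<le> C / real (Suc n)" for n j x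
        using 1(3)[OF p, of n j x] unfolding ct'_def by (simp only: times_divide_eq_right mult_1_right)
      show "cpt_supp (ct n)" for n unfolding ct_def[abs_def] by (rule 1(4)[OF p])
      show "continuous_on UNIV (ct n)" for n unfolding ct_def[abs_def] by (rule 1(5))
      show "continuous_on UNIV (ct' n j)" for n j unfolding ct'_def[abs_def] by (rule 1(6))
    qed
  qed
  show thesis
  proof (rule mollify_AE[OF l\<phi>])
    fix e :: "nat \<Rightarrow> real"
    assume e: "\<And>n. 0 < e n" "e \<longlonglongrightarrow> 0" and ae: "AE x in lborel. (\<lambda>n. conv (mollifier (e n)) \<phi> x) \<longlonglongrightarrow> \<phi> x"
    define \<psi> where "\<psi> n = conv (mollifier (e n)) \<phi>" for n
    define h where "h n j = conv (mollifier (e n)) (g j)" for n j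
    note k = kernel_mollifier[OF e(1), where 'n='n]
    have kc: "continuous_on UNIV (mollifier (e n) :: real^'n \<Rightarrow> real)" "cpt_supp (mollifier (e n) :: real^'n \<Rightarrow> real)" for n
      using k[of n] by (auto simp: kernel_def)
    have pd: "has_pd j (\<psi> n) (h n j)" for n j
      unfolding \<psi>_def h_def by (rule conv_weak_derivative[OF l\<phi> g e(1) w])
    have c: "continuous_on UNIV (\<psi> n)" "continuous_on UNIV (h n j)" for n j
      unfolding \<psi>_def h_def by (rule continuous_conv[OF l\<phi> kc] continuous_conv[OF g kc])+
    define f where "f n x = complex_of_real (ct n x) * \<psi> n x" for n x
    define f' where "f' n j x = complex_of_real (ct' n j x) * \<psi> n x + complex_of_real (ct n x) * h n j x" for n j x
    \<comment> \<open>The two error sources: commuting A with the mollifier of radius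
      \<open>e n\<close>, and the gradient of the cutoff.\<close>
    define \<kappa> where "\<kappa> n = real CARD('n) * \<gamma> * e n + real CARD('n) * (C / real (Suc n))" for n
    have \<kappa>0: "\<kappa> n \<ge> 0" for n unfolding \<kappa>_def using \<gamma> e(1)[of n] C0 by (intro add_nonneg_nonneg mult_nonneg_nonneg) auto
    have ch: "0 \<le> ct n x" "ct n x \<le> 1" for n x unfolding ct_def by (rule cutoff_props)+
    have bf: "norm (\<psi> n x) \<le> conv (mollifier (e n)) (\<lambda>y. norm (\<phi> y)) x" for n x
      unfolding \<psi>_def by (rule norm_conv_le[OF k l\<phi>])
    have bf2: "norm (f n x) \<le> conv (mollifier (e n)) (\<lambda>y. norm (\<phi> y)) x" for n x
    proof -
      have "norm (f n x) \<le> 1 * norm (\<psi> n x)" unfolding f_def norm_mult using ch by (intro mult_right_mono) auto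
      then show ?thesis using bf[of n x] by simp
    qed
    have pdf: "has_pd j (f n) (f' n j)" for n j
      unfolding f_def[abs_def] f'_def[abs_def]
      by (intro has_pd_mult has_pd_bounded_linear[OF bounded_linear_of_real] Cpd pd)
    have cf: "continuous_on UNIV (f n)" "continuous_on UNIV (f' n j)" for n j
      unfolding f_def[abs_def] f'_def[abs_def] by (intro continuous_intros c Cc)+
    have sf: "cpt_supp (f n)" for n
    proof -
      have "cpt_supp (\<lambda>x. complex_of_real (ct n x))" using Cs[of n] by (auto simp: cpt_supp_def)
      then show ?thesis unfolding f_def[abs_def] by (rule cpt_supp_mult)
    qed
    have nphi: "(\<lambda>y. norm (\<phi> y)) \<in> borel_measurable borel" using \<phi> by measurable
    have l2: "(\<lambda>y. norm (\<phi> y)) \<in> borel_measurable borel" "integrable lborel (\<lambda>y. (norm (\<phi> y))\<^sup>2)" using \<phi> nphi by auto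
    have mass_le: "(LINT x|lborel. (norm (f n x))\<^sup>2) \<le> (LINT x|lborel. (norm (\<phi> x))\<^sup>2)" for n
    proof -
      have "integrable lborel (\<lambda>x. (norm (f n x))\<^sup>2)"
      proof (rule integrable_cpt_supp)
        show "cpt_supp (\<lambda>x. (norm (f n x))\<^sup>2)" using sf[of n] by (auto simp: cpt_supp_def)
      qed (intro continuous_intros cf)
      then have "(LINT x|lborel. (norm (f n x))\<^sup>2) \<le> (LINT x|lborel. (conv (mollifier (e n)) (\<lambda>y. norm (\<phi> y)) x)\<^sup>2)"
        by (intro integral_mono conv_L2_bound(1)[OF k l2] power_mono bf2) auto
      then show ?thesis using conv_L2_bound(2)[OF k l2] by (rule order_trans)
    qed
    define F where "F n y = N y + \<kappa> n * norm (\<phi> y)" for n y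
    have Fm: "F n \<in> borel_measurable borel" for n unfolding F_def[abs_def] using N(1) nphi by measurable
    \<comment> \<open>The mixed term of the square is split by the arithmetic-geometric mean
      inequality, so that the coefficient of \<open>(N y)^2\<close> tends to 1 and that of the mass
      to 0.\<close>
    have Fsq: "(F n y)\<^sup>2 \<le> (1 + \<kappa> n) * (N y)\<^sup>2 + (\<kappa> n + (\<kappa> n)\<^sup>2) * (norm (\<phi> y))\<^sup>2" for n y
    proof -
      have "2 * (N y * norm (\<phi> y)) \<le> (N y)\<^sup>2 + (norm (\<phi> y))\<^sup>2"
        using zero_le_power2[of "N y - norm (\<phi> y)"] by (simp add: power2_eq_square algebra_simps)
      then have "\<kappa> n * (2 * (N y * norm (\<phi> y))) \<le> \<kappa> n * ((N y)\<^sup>2 + (norm (\<phi> y))\<^sup>2)" using \<kappa>0 by (rule mult_left_mono)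
      then show ?thesis by (simp add: F_def power2_eq_square algebra_simps)
    qed
    have iB: "integrable lborel (\<lambda>y. (1 + \<kappa> n) * (N y)\<^sup>2 + (\<kappa> n + (\<kappa> n)\<^sup>2) * (norm (\<phi> y))\<^sup>2)" for n
      using N(2) \<phi>(2) by simp
    have iF: "integrable lborel (\<lambda>y. (F n y)\<^sup>2)" for n
      by (rule Bochner_Integration.integrable_bound[OF iB[of n]])
         (use Fm in \<open>auto intro!: AE_I2 order_trans[OF Fsq abs_ge_self]\<close>)
    have covb: "norm (\<chi> j. cov_deriv \<gamma> a b (f n) (f' n) j x) \<le> conv (mollifier (e n)) (F n) x" for n x
    proof -
      \<comment> \<open>The product rule: the derivative of the cutoff multiplies
        \<open>\<psi> n\<close>, while the magnetic term joins the derivatives of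
        \<open>\<psi> n\<close>.\<close>
      have split: "(\<chi> j. cov_deriv \<gamma> a b (f n) (f' n) j x) = (\<chi> j. complex_of_real (ct' n j x) * \<psi> n x) + ct n x *\<^sub>R (\<chi> j. cov_deriv \<gamma> a b (\<psi> n) (h n) j x)"
        by (simp only: vec_eq_iff vec_lambda_beta vector_add_component vector_scaleR_component cov_deriv_def f_def f'_def)
           (simp add: scaleR_conv_of_real algebra_simps)
      have "norm (\<chi> j. complex_of_real (ct' n j x) * \<psi> n x) \<le> (\<Sum>j\<in>UNIV. norm ((\<chi> j. complex_of_real (ct' n j x) * \<psi> n x) $ j))"
        unfolding norm_vec_def by (rule L2_set_le_sum) simp
      also have "\<dots> \<le> (\<Sum>j\<in>(UNIV::'n set). C / real (Suc n) * norm (\<psi> n x))"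
        by (intro sum_mono) (simp only: vec_lambda_beta norm_mult norm_of_real, rule mult_right_mono[OF C norm_ge_zero])
      also have "\<dots> = real CARD('n) * (C / real (Suc n)) * norm (\<psi> n x)" by simp
      also have "\<dots> \<le> real CARD('n) * (C / real (Suc n)) * conv (mollifier (e n)) (\<lambda>y. norm (\<phi> y)) x"
        using C0 by (intro mult_left_mono bf) auto
      finally have 1: "norm (\<chi> j. complex_of_real (ct' n j x) * \<psi> n x) \<le> \<dots>" .
      have "norm (ct n x *\<^sub>R (\<chi> j. cov_deriv \<gamma> a b (\<psi> n) (h n) j x)) \<le> 1 * norm (\<chi> j. cov_deriv \<gamma> a b (\<psi> n) (h n) j x)"
        unfolding norm_scaleR using ch by (intro mult_right_mono) auto
      also have "\<dots> \<le> (LINT y|lborel. mollifier (e n) (x - y) * (N y + real CARD('n) * \<gamma> * e n * norm (\<phi> y)))"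
        using conv_cov_deriv_bound[where g=g and a=a and b=b and x=x, OF l\<phi> g e(1)[of n] \<gamma>] lN unfolding N_def \<psi>_def h_def by simp
      finally have 2: "norm (ct n x *\<^sub>R (\<chi> j. cov_deriv \<gamma> a b (\<psi> n) (h n) j x)) \<le> \<dots>" .
      have i1: "integrable lborel (\<lambda>y. mollifier (e n) (x - y) * N y)"
        using integrable_conv[OF lN kc, of n x] by simp
      have i2: "integrable lborel (\<lambda>y. mollifier (e n) (x - y) * norm (\<phi> y))" by (rule integrable_norm_conv[OF k l\<phi>])
      have lin: "(LINT y|lborel. mollifier (e n) (x - y) * (N y + s * norm (\<phi> y))) =
         (LINT y|lborel. mollifier (e n) (x - y) * N y) + s * conv (mollifier (e n)) (\<lambda>y. norm (\<phi> y)) x" for s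
      proof -
        have "(LINT y|lborel. mollifier (e n) (x - y) * (N y + s * norm (\<phi> y))) =
          (LINT y|lborel. mollifier (e n) (x - y) * N y + s * (mollifier (e n) (x - y) * norm (\<phi> y)))"
          by (intro Bochner_Integration.integral_cong) (auto simp: algebra_simps)
        also have "\<dots> = (LINT y|lborel. mollifier (e n) (x - y) * N y) + s * (LINT y|lborel. mollifier (e n) (x - y) * norm (\<phi> y))"
          using i1 i2 by simp
        finally show ?thesis by (simp add: conv_def)
      qed
      have "conv (mollifier (e n)) (F n) x = (LINT y|lborel. mollifier (e n) (x - y) * (N y + \<kappa> n * norm (\<phi> y)))"
        by (simp add: conv_def F_def)
      then show ?thesis
        using norm_triangle_ineq[of "\<chi> j. complex_of_real (ct' n j x) * \<psi> n x" "ct n x *\<^sub>R (\<chi> j. cov_deriv \<gamma> a b (\<psi> n) (h n) j x)"] 1 2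
        unfolding lin split \<kappa>_def by (simp add: distrib_right)
    qed
    have cA: "continuous_on UNIV (\<lambda>x. mag_potential \<gamma> a b x $ j)" for j
      by (intro continuous_intros continuous_confinement)
    have ccov: "continuous_on UNIV (cov_deriv \<gamma> a b (f n) (f' n) j)" for n j
      unfolding cov_deriv_def[abs_def] by (intro continuous_intros cf cA)
    have K_le: "(LINT x|lborel. (\<Sum>j\<in>UNIV. (norm (cov_deriv \<gamma> a b (f n) (f' n) j x))\<^sup>2)) \<le>
        (1 + \<kappa> n) * (LINT x|lborel. (N x)\<^sup>2) + (\<kappa> n + (\<kappa> n)\<^sup>2) * (LINT x|lborel. (norm (\<phi> x))\<^sup>2)" for n
    proof -
      have eq: "(\<Sum>j\<in>UNIV. (norm (cov_deriv \<gamma> a b (f n) (f' n) j x))\<^sup>2) = (norm (\<chi> j. cov_deriv \<gamma> a b (f n) (f' n) j x))\<^sup>2" for x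
        by (simp add: norm_vec_square)
      have mono: "(\<Sum>j\<in>UNIV. (norm (cov_deriv \<gamma> a b (f n) (f' n) j x))\<^sup>2) \<le> (conv (mollifier (e n)) (F n) x)\<^sup>2" for x
        unfolding eq by (intro power_mono covb) simp
      have meas: "(\<lambda>x. \<Sum>j\<in>UNIV. (norm (cov_deriv \<gamma> a b (f n) (f' n) j x))\<^sup>2) \<in> borel_measurable borel"
        by (intro borel_measurable_continuous_onI continuous_intros ccov)
      note cb = conv_L2_bound[OF k[of n] Fm[of n] iF[of n]]
      have "integrable lborel (\<lambda>x. \<Sum>j\<in>UNIV. (norm (cov_deriv \<gamma> a b (f n) (f' n) j x))\<^sup>2)"
        by (rule Bochner_Integration.integrable_bound[OF cb(1)])
           (use meas mono in \<open>auto simp: sum_nonneg\<close>)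
      then have "(LINT x|lborel. (\<Sum>j\<in>UNIV. (norm (cov_deriv \<gamma> a b (f n) (f' n) j x))\<^sup>2)) \<le> (LINT x|lborel. (conv (mollifier (e n)) (F n) x)\<^sup>2)"
        by (intro integral_mono cb(1) mono)
      also have "\<dots> \<le> (LINT x|lborel. (F n x)\<^sup>2)" by (rule cb(2))
      also have "\<dots> \<le> (LINT y|lborel. (1 + \<kappa> n) * (N y)\<^sup>2 + (\<kappa> n + (\<kappa> n)\<^sup>2) * (norm (\<phi> y))\<^sup>2)"
        by (intro integral_mono iF iB Fsq)
      also have "\<dots> = (1 + \<kappa> n) * (LINT x|lborel. (N x)\<^sup>2) + (\<kappa> n + (\<kappa> n)\<^sup>2) * (LINT x|lborel. (norm (\<phi> x))\<^sup>2)"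
        using N(2) \<phi>(2) by simp
      finally show ?thesis .
    qed
    have "(\<lambda>n. C / real (Suc n)) \<longlonglongrightarrow> C * 0"
      using LIMSEQ_inverse_real_of_nat by (simp only: divide_inverse) (intro tendsto_intros)
    then have "\<kappa> \<longlonglongrightarrow> real CARD('n) * \<gamma> * 0 + real CARD('n) * (C * 0)"
      unfolding \<kappa>_def[abs_def] by (intro tendsto_intros e(2))
    then have \<kappa>l: "\<kappa> \<longlonglongrightarrow> 0" by simp
    have lim: "AE x in lborel. (\<lambda>n. f n x) \<longlonglongrightarrow> \<phi> x"
      using ae
    proof eventually_elim
      case (elim x)
      have "(\<lambda>n. ct n x) \<longlonglongrightarrow> 1" unfolding ct_def by (rule cutoff_props(6))
      then have "(\<lambda>n. complex_of_real (ct n x) * \<psi> n x) \<longlonglongrightarrow> complex_of_real 1 * \<phi> x"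
        using elim unfolding \<psi>_def by (intro tendsto_intros)
      then show ?case by (simp add: f_def)
    qed
    show thesis by (rule that[OF pdf cf sf \<kappa>l mass_le K_le lim])
  qed
qed

lemma fatou_bound:
  assumes "\<And>n::nat. u n \<in> borel_measurable M" "\<And>n. (\<integral>\<^sup>+x. u n x \<partial>M) \<le> B" "AE x in M. (\<lambda>n. u n x) \<longlonglongrightarrow> v x"
  shows "(\<integral>\<^sup>+x. v x \<partial>M) \<le> B"
proof -
  have "(\<integral>\<^sup>+x. v x \<partial>M) = (\<integral>\<^sup>+x. liminf (\<lambda>n. u n x) \<partial>M)"
    using assms(3) by (intro nn_integral_cong_AE) (auto elim!: eventually_mono simp: lim_imp_Liminf)
  also have "\<dots> \<le> liminf (\<lambda>n. \<integral>\<^sup>+x. u n x \<partial>M)" by (rule nn_integral_liminf[OF assms(1)])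
  also have "\<dots> \<le> B" by (rule Liminf_le) (use assms(2) in auto)
  finally show ?thesis .
qed

text \<open>The hypothesis \<open>ineq\<close>, nonnegative field-free energy up to mass c, is
  applied to the regularized moduli of the approximations. Their kinetic energy lies below that of
  \<phi> by a fixed amount, so their nonlinear terms do too relative to it, and Fatou's lemma hands
  this bound to \<phi>.\<close>

lemma strict_energy_bound:
  fixes \<phi> :: "real^'n::finite \<Rightarrow> complex" and g :: "'n \<Rightarrow> real^'n \<Rightarrow> complex" and a b :: 'n
  assumes \<phi>: "\<phi> \<in> borel_measurable borel" "integrable lborel (\<lambda>x. (norm (\<phi> x))\<^sup>2)"
    and g: "\<And>j. loc_int (g j)" and \<gamma>: "\<gamma> > 0" and ab: "a \<noteq> b" and p: "p > 0"
    and w: "\<And>j \<eta>. test_function \<eta> \<Longrightarrow> (LINT x|lborel. \<phi> x * partial_deriv j \<eta> x) = - (LINT x|lborel. g j x * \<eta> x)"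
  defines "N \<equiv> \<lambda>x. norm (\<chi> j. cov_deriv \<gamma> a b \<phi> g j x)"
  defines "c \<equiv> (LINT x|lborel. (norm (\<phi> x))\<^sup>2)"
  assumes N: "N \<in> borel_measurable borel" "integrable lborel (\<lambda>x. (N x)\<^sup>2)" and c: "c > 0"
    and ineq: "\<And>(v :: real^'n \<Rightarrow> real) v'. admissible p v v' \<Longrightarrow> mass v \<le> c \<Longrightarrow> 2 / (p + 1) * nonlin p v \<le> 1/2 * kinetic v'"
  shows "2 / (p + 1) * (LINT x|lborel. norm (\<phi> x) powr (p + 1)) < 1/2 * (LINT x|lborel. (N x)\<^sup>2)"
proof -
  define K where "K = (LINT x|lborel. (N x)\<^sup>2)"
  have K0: "K \<ge> 0" unfolding K_def by (rule Bochner_Integration.integral_nonneg) simp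
  \<comment> \<open>Positive even if K is 0, and with room to bound the kinetic energies of all late
    approximations.\<close>
  define L where "L = K + 1"
  have L: "L > 0" using K0 by (simp add: L_def)
  \<comment> \<open>The guaranteed kinetic loss for an approximation of mass greater than
    \<open>c / 2\<close>.\<close>
  define \<mu> where "\<mu> = (\<gamma> * (c / 2))\<^sup>2 / L"
  have \<mu>: "\<mu> > 0" using \<gamma> c L by (simp add: \<mu>_def)
  show ?thesis
  proof (rule approximating_sequence[OF \<phi> g less_imp_le[OF \<gamma>] w N[unfolded N_def]])
    fix f f' \<kappa>
    assume f: "\<And>n j. has_pd j (f n) (f' n j)" "\<And>n::nat. continuous_on UNIV (f n)"
    "\<And>n j. continuous_on UNIV (f' n j)" "\<And>n. cpt_supp (f n)" and \<kappa>: "\<kappa> \<longlonglongrightarrow> (0::real)"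
    and "\<And>n. (LINT x|lborel. (norm (f n x))\<^sup>2) \<le> (LINT x|lborel. (norm (\<phi> x))\<^sup>2)"
    and "\<And>n. (LINT x|lborel. (\<Sum>j\<in>UNIV. (norm (cov_deriv \<gamma> a b (f n) (f' n) j x))\<^sup>2)) \<le>
        (1 + \<kappa> n) * (LINT x|lborel. (norm (\<chi> j. cov_deriv \<gamma> a b \<phi> g j x))\<^sup>2) + (\<kappa> n + (\<kappa> n)\<^sup>2) * (LINT x|lborel. (norm (\<phi> x))\<^sup>2)"
    and ae: "AE x in lborel. (\<lambda>n. f n x) \<longlonglongrightarrow> \<phi> x"
    define M where "M n = (LINT x|lborel. (norm (f n x))\<^sup>2)" for n
    define KA where "KA n = (LINT x|lborel. (\<Sum>j\<in>UNIV. (norm (cov_deriv \<gamma> a b (f n) (f' n) j x))\<^sup>2))" for n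
    have Mc: "M n \<le> c" for n unfolding M_def c_def by fact
    have KAb: "KA n \<le> (1 + \<kappa> n) * K + (\<kappa> n + (\<kappa> n)\<^sup>2) * c" for n unfolding KA_def K_def N_def c_def by fact
    \<comment> \<open>In the threshold \<open>min 1 (\<mu> / 2)\<close> below, 1 keeps the kinetic
      energies under L, and \<open>\<mu> / 2\<close> spends only half of the loss.\<close>
    have "(\<lambda>n. (1 + \<kappa> n) * K + (\<kappa> n + (\<kappa> n)\<^sup>2) * c) \<longlonglongrightarrow> (1 + 0) * K + (0 + 0\<^sup>2) * c"
      by (intro tendsto_intros \<kappa>)
    then have "\<forall>\<^sub>F n in sequentially. (1 + \<kappa> n) * K + (\<kappa> n + (\<kappa> n)\<^sup>2) * c < K + min 1 (\<mu> / 2)"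
      by (rule order_tendstoD) (use \<mu> in simp)
    then have ev1: "\<forall>\<^sub>F n in sequentially. KA n \<le> K + min 1 (\<mu> / 2)"
      by eventually_elim (use KAb in \<open>meson less_imp_le order_trans\<close>)
    have iM: "integrable lborel (\<lambda>x. (norm (f n x))\<^sup>2)" for n
    proof (rule integrable_cpt_supp)
      show "cpt_supp (\<lambda>x. (norm (f n x))\<^sup>2)" using f(4)[of n] by (auto simp: cpt_supp_def)
    qed (intro continuous_intros f)
    \<comment> \<open>Fatou prevents the mass from disappearing under cutoff and mollification;
      without a lower bound on it the kinetic loss could tend to 0.\<close>
    have ev2: "\<forall>\<^sub>F n in sequentially. c / 2 < M n"
    proof -
      have "ennreal (c / 2) < ennreal c" using c by (intro ennreal_lessI) auto
      also have "ennreal c = (\<integral>\<^sup>+x. ennreal ((norm (\<phi> x))\<^sup>2) \<partial>lborel)"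
        unfolding c_def using \<phi>(2) by (subst nn_integral_eq_integral) auto
      also have "\<dots> = (\<integral>\<^sup>+x. liminf (\<lambda>n. ennreal ((norm (f n x))\<^sup>2)) \<partial>lborel)"
      proof (rule nn_integral_cong_AE)
        show "AE x in lborel. ennreal ((norm (\<phi> x))\<^sup>2) = liminf (\<lambda>n. ennreal ((norm (f n x))\<^sup>2))"
          using ae
        proof eventually_elim
          case (elim x)
          then have "(\<lambda>n. ennreal ((norm (f n x))\<^sup>2)) \<longlonglongrightarrow> ennreal ((norm (\<phi> x))\<^sup>2)"
            by (intro tendsto_ennrealI tendsto_intros)
          then show ?case by (intro lim_imp_Liminf[symmetric]) simp_all
        qed
      qed
      also have "\<dots> \<le> liminf (\<lambda>n. \<integral>\<^sup>+x. ennreal ((norm (f n x))\<^sup>2) \<partial>lborel)"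
        using iM by (intro nn_integral_liminf) (auto dest: borel_measurable_integrable)
      also have "(\<lambda>n. \<integral>\<^sup>+x. ennreal ((norm (f n x))\<^sup>2) \<partial>lborel) = (\<lambda>n. ennreal (M n))"
        unfolding M_def using iM by (subst nn_integral_eq_integral) auto
      finally have "\<forall>\<^sub>F n in sequentially. ennreal (c / 2) < ennreal (M n)" by (rule less_LiminfD)
      then show ?thesis by eventually_elim (use c in \<open>simp add: ennreal_less_iff\<close>)
    qed
    obtain m where m: "\<And>n. n \<ge> m \<Longrightarrow> KA n \<le> K + min 1 (\<mu> / 2) \<and> c / 2 < M n"
      using eventually_conj[OF ev1 ev2] unfolding eventually_sequentially by blast
    define \<delta> where "\<delta> n = 1 / real (Suc n)" for n
    have \<delta>: "\<delta> n > 0" for n by (simp add: \<delta>_def)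
    have \<delta>0: "\<delta> \<longlonglongrightarrow> 0" unfolding \<delta>_def[abs_def] using LIMSEQ_inverse_real_of_nat by (simp add: divide_inverse)
    define v where "v n x = sqrt ((norm (f n x))\<^sup>2 + (\<delta> n)\<^sup>2) - \<delta> n" for n x
    define v' where "v' n j x = Re (cnj (f n x) * f' n j x) / sqrt ((norm (f n x))\<^sup>2 + (\<delta> n)\<^sup>2)" for n j x
    \<comment> \<open>The value at which \<open>2 / (p + 1) * B\<close> equals half of the reduced
      kinetic energy \<open>K - \<mu> / 2\<close>.\<close>
    define B where "B = (p + 1) / 4 * (K - \<mu> / 2)"
    have bound: "admissible p (v n) (v' n) \<and> nonlin p (v n) \<le> B" if n: "n \<ge> m" for n
    proof -
      have KL: "(LINT x|lborel. (\<Sum>j\<in>UNIV. (norm (cov_deriv \<gamma> a b (f n) (f' n) j x))\<^sup>2)) \<le> L"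
        using m[OF n] unfolding KA_def[symmetric] L_def by linarith
      note sd = strict_diamagnetic[where \<delta>="\<delta> n" and f="f n" and f'="f' n", OF f(1) f(2) f(3) f(4) ab \<gamma> \<delta> L p KL]
      have nv: "admissible p (v n) (v' n)" using sd(1) unfolding v_def[abs_def] v'_def[abs_def] .
      have mv: "mass (v n) \<le> M n" using sd(2) unfolding v_def[abs_def] M_def .
      have kv: "kinetic (v' n) \<le> KA n - (\<gamma> * M n)\<^sup>2 / L" using sd(3) unfolding v'_def[abs_def] M_def KA_def .
      have "\<mu> \<le> (\<gamma> * M n)\<^sup>2 / L" unfolding \<mu>_def using m[OF n] \<gamma> c L by (intro divide_right_mono power_mono mult_left_mono) auto
      then have kb: "kinetic (v' n) \<le> K - \<mu> / 2" using kv m[OF n] by linarith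
      have "2 / (p + 1) * nonlin p (v n) \<le> 1/2 * kinetic (v' n)"
        using mv Mc[of n] by (intro ineq[OF nv]) simp
      also have "\<dots> \<le> 1/2 * (K - \<mu> / 2)" using kb by (rule mult_left_mono) simp
      finally have "2 / (p + 1) * nonlin p (v n) \<le> 1/2 * (K - \<mu> / 2)" .
      then have "nonlin p (v n) \<le> B" using p by (simp add: B_def field_simps)
      then show ?thesis using nv by blast
    qed
    \<comment> \<open>Working in \<open>ennreal\<close> bounds the integral and shows its finiteness
      at the same time.\<close>
    have "(\<integral>\<^sup>+x. ennreal (norm (\<phi> x) powr (p + 1)) \<partial>lborel) \<le> ennreal B"
    proof (rule fatou_bound[where u="\<lambda>n x. ennreal (\<bar>v (n + m) x\<bar> powr (p + 1))"])
      show "(\<lambda>x. ennreal (\<bar>v (n + m) x\<bar> powr (p + 1))) \<in> borel_measurable lborel" for n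
        using bound[of "n + m"] by (auto simp: admissible_def dest: borel_measurable_integrable)
      show "(\<integral>\<^sup>+x. ennreal (\<bar>v (n + m) x\<bar> powr (p + 1)) \<partial>lborel) \<le> ennreal B" for n
        using bound[of "n + m"] by (subst nn_integral_eq_integral) (auto simp: admissible_def nonlin_def ennreal_leI)
      show "AE x in lborel. (\<lambda>n. ennreal (\<bar>v (n + m) x\<bar> powr (p + 1))) \<longlonglongrightarrow> ennreal (norm (\<phi> x) powr (p + 1))"
        using ae
      proof eventually_elim
        case (elim x)
        have "(\<lambda>n. v n x) \<longlonglongrightarrow> sqrt ((norm (\<phi> x))\<^sup>2 + 0\<^sup>2) - 0"
          unfolding v_def by (intro tendsto_intros elim \<delta>0)
        then have "(\<lambda>n. \<bar>v n x\<bar>) \<longlonglongrightarrow> \<bar>norm (\<phi> x)\<bar>" by (intro tendsto_rabs) simp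
        then have "(\<lambda>n. \<bar>v n x\<bar> powr (p + 1)) \<longlonglongrightarrow> \<bar>norm (\<phi> x)\<bar> powr (p + 1)"
          using p by (intro tendsto_powr' tendsto_const) auto
        then have "(\<lambda>n. ennreal (\<bar>v n x\<bar> powr (p + 1))) \<longlonglongrightarrow> ennreal (norm (\<phi> x) powr (p + 1))"
          by (intro tendsto_ennrealI) simp
        then show ?case by (rule LIMSEQ_ignore_initial_segment)
      qed
    qed
    moreover have B0: "B \<ge> 0" using bound[of m] nonlin_nonneg[of p "v m"] by (meson order_refl order_trans)
    ultimately have "(LINT x|lborel. norm (\<phi> x) powr (p + 1)) \<le> B"
      using \<phi>(1) by (subst integral_eq_nn_integral) (auto intro: enn2real_leI)
    then have "2 / (p + 1) * (LINT x|lborel. norm (\<phi> x) powr (p + 1)) \<le> 2 / (p + 1) * B"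
      using p by (intro mult_left_mono) auto
    also have "\<dots> = 1/2 * (K - \<mu> / 2)" using p by (simp add: B_def field_simps)
    also have "\<dots> < 1/2 * K" using \<mu> by simp
    finally show ?thesis by (simp add: K_def)
  qed
qed

section \<open>Radial integrals and the decay of the ground state\<close>

text \<open>The area of the sphere of radius r, as the derivative of the ball volume, set to 0 for
  negative r.\<close>

definition shell :: "'a::euclidean_space itself \<Rightarrow> real \<Rightarrow> real" where
  "shell _ r = indicator {0..} r * (unit_ball_vol (real DIM('a)) * (real DIM('a) * r ^ (DIM('a) - 1)))"

lemma shell_nonneg: "shell T r \<ge> 0"
  by (auto simp: shell_def indicator_def)

lemma shell_measurable: "shell T \<in> borel_measurable borel"
  unfolding shell_def[abs_def] by measurable

text \<open>Integration in polar coordinates for radial functions. Both measures give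
  \<open>{..a}\<close> the volume of the ball of radius a, and these half-lines are an
  intersection-stable generator of the Borel sets.\<close>

lemma distr_norm_lborel:
  "distr lborel borel (norm :: 'a::euclidean_space \<Rightarrow> real) = density lborel (\<lambda>r. ennreal (shell TYPE('a) r))"
    (is "?L = ?R")
proof (rule measure_eqI_generator_eq[where E="range atMost" and \<Omega>=UNIV and A="\<lambda>n. {..real n}"])
  let ?n = "DIM('a)"
  have nm: "(norm :: 'a \<Rightarrow> real) \<in> borel_measurable lborel" by measurable
  have sm: "(\<lambda>r. ennreal (shell TYPE('a) r)) \<in> borel_measurable lborel"
    using shell_measurable[of "TYPE('a)"] by measurable
  have L: "emeasure ?L {..a} = ennreal (if a \<ge> 0 then unit_ball_vol (real ?n) * a ^ ?n else 0)" for a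
  proof -
    have "emeasure ?L {..a} = emeasure lborel {x::'a. norm x \<le> a}"
      by (subst emeasure_distr[OF nm]) (auto simp: vimage_def)
    also have "{x::'a. norm x \<le> a} = (if a \<ge> 0 then cball 0 a else {})"
      by (auto intro: order_trans[OF norm_ge_zero])
    finally show ?thesis by (auto simp: emeasure_cball)
  qed
  have R: "emeasure ?R {..a} = ennreal (if a \<ge> 0 then unit_ball_vol (real ?n) * a ^ ?n else 0)" for a
  proof (cases "a \<ge> 0")
    case False
    have "emeasure ?R {..a} = (\<integral>\<^sup>+r. ennreal (shell TYPE('a) r) * indicator {..a} r \<partial>lborel)"
      using sm by (subst emeasure_density) auto
    also have "\<dots> = (\<integral>\<^sup>+(r::real). 0 \<partial>lborel)"
      using False by (intro nn_integral_cong) (auto simp: shell_def indicator_def)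
    finally show ?thesis using False by simp
  next
    case True
    have "emeasure ?R {..a} = (\<integral>\<^sup>+r. ennreal (shell TYPE('a) r) * indicator {..a} r \<partial>lborel)"
      using sm by (subst emeasure_density) auto
    also have "\<dots> = (\<integral>\<^sup>+r. ennreal (unit_ball_vol (real ?n) * (real ?n * r ^ (?n - 1))) * indicator {0..a} r \<partial>lborel)"
      by (intro nn_integral_cong) (auto simp: shell_def indicator_def)
    also have "\<dots> = ennreal (unit_ball_vol (real ?n) * a ^ ?n - unit_ball_vol (real ?n) * 0 ^ ?n)"
    proof (rule nn_integral_FTC_Icc)
      fix x :: real assume x: "x \<in> {0..a}"
      show "((\<lambda>r. unit_ball_vol (real ?n) * r ^ ?n) has_real_derivative unit_ball_vol (real ?n) * (real ?n * x ^ (?n - 1))) (at x)"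
        by (auto intro!: derivative_eq_intros)
      show "0 \<le> unit_ball_vol (real ?n) * (real ?n * x ^ (?n - 1))" using x by simp
    qed (use True in auto)
    finally show ?thesis using True by simp
  qed
  show "emeasure ?L X = emeasure ?R X" if "X \<in> range atMost" for X
    using that L R by auto
  show "emeasure ?L {..real n} \<noteq> \<infinity>" for n by (simp add: L)
  show "Int_stable (range (atMost :: real \<Rightarrow> _))" by (auto simp: Int_stable_def)
  show "(\<Union>n. {..real n}) = UNIV" using real_arch_simple by auto
  have "sets (borel :: real measure) = sigma_sets UNIV (range atMost)"
    unfolding borel_eq_atMost by (subst sets_measure_of) auto
  then show "sets ?L = sigma_sets UNIV (range atMost)" "sets ?R = sigma_sets UNIV (range atMost)" by auto
qed auto

lemma radial_integral:
  fixes h :: "real \<Rightarrow> real"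
  assumes h: "h \<in> borel_measurable borel"
  shows "integrable lborel (\<lambda>x::'a::euclidean_space. h (norm x)) \<longleftrightarrow> integrable lborel (\<lambda>r. shell TYPE('a) r * h r)"
    and "(LINT x|lborel. h (norm (x::'a))) = (LINT r|lborel. shell TYPE('a) r * h r)"
proof -
  have nm: "(norm :: 'a \<Rightarrow> real) \<in> lborel \<rightarrow>\<^sub>M borel" by measurable
  have sm: "shell TYPE('a) \<in> borel_measurable lborel" "AE x in lborel. 0 \<le> shell TYPE('a) x"
    using shell_measurable[of "TYPE('a)"] shell_nonneg[of "TYPE('a)"] by auto
  show "integrable lborel (\<lambda>x::'a. h (norm x)) \<longleftrightarrow> integrable lborel (\<lambda>r. shell TYPE('a) r * h r)"
    using integrable_distr_eq[OF nm h] integrable_density[of h lborel "shell TYPE('a)"] h sm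
    unfolding distr_norm_lborel by simp
  show "(LINT x|lborel. h (norm (x::'a))) = (LINT r|lborel. shell TYPE('a) r * h r)"
    using integral_distr[OF nm h] integral_density[of h lborel "shell TYPE('a)"] h sm
    unfolding distr_norm_lborel by simp
qed

text \<open>The integrand of the Gamma function at \<open>k + 1\<close>, transferred from complex
  powers.\<close>

lemma integrable_power_exp: "integrable lborel (\<lambda>r. indicator {0..} r * (r ^ k * exp (- r) :: real))"
proof -
  have "set_integrable lebesgue {0<..} (\<lambda>t. complex_of_real t powr (of_nat (Suc k) - 1) / of_real (exp t))"
    by (rule absolutely_integrable_Gamma_integral') simp
  then have 1: "integrable lebesgue (\<lambda>t. norm (indicator {0<..} t *\<^sub>R (complex_of_real t powr (of_nat (Suc k) - 1) / of_real (exp t))))"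
    unfolding set_integrable_def by (rule integrable_norm)
  have 2: "norm (indicator {0<..} t *\<^sub>R (complex_of_real t powr (of_nat (Suc k) - 1) / of_real (exp t))) = indicator {0<..} t * (t ^ k * exp (- t))" for t
  proof (cases "t > 0")
    case True
    then have "complex_of_real t powr (of_nat (Suc k) - 1) = complex_of_real t ^ k"
      using powr_nat'[of "complex_of_real t" k] by simp
    then show ?thesis using True by (simp add: norm_divide norm_power exp_minus divide_inverse norm_mult norm_inverse)
  qed simp
  have "integrable lborel (\<lambda>t. indicator {0<..} t * (t ^ k * exp (- t) :: real))"
    using 1 unfolding 2 by (subst (asm) integrable_completion) auto
  moreover
  have "AE t in lborel. indicator {0<..} t * (t ^ k * exp (- t)) = indicator {0..} t * (t ^ k * exp (- t) :: real)"
    using AE_lborel_singleton[of "0::real"] by eventually_elim (auto simp: indicator_def)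
  then have "integrable lborel (\<lambda>t. indicator {0<..} t * (t ^ k * exp (- t) :: real)) \<longleftrightarrow> integrable lborel (\<lambda>r. indicator {0..} r * (r ^ k * exp (- r) :: real))"
    by (rule integrable_cong_AE[rotated 2]) measurable
  ultimately show ?thesis by simp
qed

lemma integrable_exp_norm: "integrable lborel (\<lambda>x::'a::euclidean_space. exp (- norm x))"
proof -
  have "(\<lambda>r. shell TYPE('a) r * exp (- r)) = (\<lambda>r. (unit_ball_vol (real DIM('a)) * real DIM('a)) * (indicator {0..} r * (r ^ (DIM('a) - 1) * exp (- r))))"
    by (auto simp: shell_def)
  then have "integrable lborel (\<lambda>r. shell TYPE('a) r * exp (- r))"
    using integrable_power_exp[of "DIM('a) - 1"] by simp
  then show ?thesis using radial_integral(1)[of "\<lambda>r. exp (- r)", where 'a='a] by simp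
qed

text \<open>Where \<open>q\<close> is small, \<open>q'\<close> is negative and \<open>w = q' + q\<close> satisfies \<open>w' \<ge> w\<close>; a positive \<open>w\<close> would grow exponentially, so \<open>q' \<le> -q\<close>.\<close>

lemma radial_ode_decay:
  fixes q q' q'' :: "real \<Rightarrow> real" and d s :: real
  assumes q: "\<And>r. (q has_real_derivative q' r) (at r)" and q': "\<And>r. (q' has_real_derivative q'' r) (at r)"
    and pos: "\<And>r. q r > 0" and lim: "(q \<longlongrightarrow> 0) at_top" and d: "d \<ge> 0" and s: "s > 0"
    and ode: "\<And>r. r > 0 \<Longrightarrow> q'' r + d / r * q' r = 2 * (q r - q r powr s * q r)"
  obtains C where "C > 0" "\<And>r. r \<ge> 0 \<Longrightarrow> q r \<le> C * exp (- r)" "\<And>r. r \<ge> 0 \<Longrightarrow> \<bar>q' r\<bar> \<le> C * exp (- r)"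
proof -
  \<comment> \<open>Below \<beta> the nonlinear term is at most \<open>q / 2\<close>, so the right
    side of the equation is at least q.\<close>
  define \<beta> where "\<beta> = (1/2 :: real) powr (1 / s)"
  have \<beta>: "\<beta> > 0" "\<beta> powr s = 1/2" using s by (simp_all add: \<beta>_def powr_powr)
  have "\<forall>\<^sub>F r in at_top. q r < \<beta>" using lim \<beta>(1) by (rule order_tendstoD)
  then obtain R1 where "\<And>r. r \<ge> R1 \<Longrightarrow> q r < \<beta>" by (auto simp: eventually_at_top_linorder)
  define R where "R = max 1 R1"
  have R: "R > 0" "\<And>r. r \<ge> R \<Longrightarrow> q r < \<beta>" unfolding R_def using \<open>\<And>r. r \<ge> R1 \<Longrightarrow> q r < \<beta>\<close> by auto
  have rhs: "2 * (q r - q r powr s * q r) \<ge> q r" if "r \<ge> R" for r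
  proof -
    have "q r powr s \<le> \<beta> powr s" using R(2)[OF that] pos[of r] s by (intro powr_mono2) auto
    then have "q r powr s * q r \<le> 1/2 * q r" using pos[of r] \<beta>(2) by (intro mult_right_mono) auto
    moreover have "q r \<le> 2 * (q r - y)" if "y \<le> 1/2 * q r" for y using that by simp
    ultimately show ?thesis by blast
  qed
  \<comment> \<open>If \<open>q'\<close> were positive at some r, then \<open>r^d q'\<close> would
    be nondecreasing from there on, since its derivative is \<open>r^d\<close> times the right side
    of the equation. So q would increase forever from a positive value, contradicting its limit
    0.\<close>
  have dneg: "q' r \<le> 0" if r: "r \<ge> R" for r
  proof (rule ccontr)
    assume "\<not> q' r \<le> 0"
    then have qr: "q' r > 0" by simp
    have dpos: "q' t > 0" if t: "t \<ge> r" for t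
    proof -
      have "r powr d * q' r \<le> t powr d * q' t"
      proof (rule DERIV_nonneg_imp_nondecreasing[OF t])
        fix x assume x: "r \<le> x" "x \<le> t"
        have x0: "x > 0" using x r R by linarith
        have "((\<lambda>x. x powr d * q' x) has_real_derivative x powr d * (q'' x + d / x * q' x)) (at x)"
          using x0 by (auto intro!: derivative_eq_intros q' simp: powr_diff field_simps)
        moreover have "x powr d * (q'' x + d / x * q' x) \<ge> 0"
          using ode[OF x0] rhs[of x] pos[of x] x r by (intro mult_nonneg_nonneg) auto
        ultimately show "\<exists>y. ((\<lambda>x. x powr d * q' x) has_real_derivative y) (at x) \<and> 0 \<le> y" by blast
      qed
      moreover have "r powr d * q' r > 0" using qr r R by simp
      ultimately have "t powr d * q' t > 0" by linarith
      then show ?thesis by (simp add: zero_less_mult_iff)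
    qed
    have "q r \<le> q t" if "t \<ge> r" for t
      by (rule DERIV_nonneg_imp_nondecreasing[OF that]) (use q dpos in \<open>meson less_imp_le\<close>)
    then have "\<forall>\<^sub>F t in at_top. q r \<le> q t" by (auto simp: eventually_at_top_linorder)
    then have "q r \<le> 0" by (rule tendsto_lowerbound[OF lim]) simp
    then show False using pos[of r] by simp
  qed
  have conv: "q'' r \<ge> q r" if r: "r \<ge> R" for r
  proof -
    have "d / r * q' r \<le> 0" using dneg[OF r] d r R by (intro mult_nonneg_nonpos) auto
    moreover have "r > 0" using r R by linarith
    ultimately show ?thesis using ode[of r] rhs[OF r] by linarith
  qed
  have w: "q' r + q r \<le> 0" if r: "r \<ge> R" for r
  proof (rule ccontr)
    assume "\<not> q' r + q r \<le> 0"
    then have wr: "q' r + q r > 0" by simp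
    have mono: "exp (- r) * (q' r + q r) \<le> exp (- t) * (q' t + q t)" if t: "t \<ge> r" for t
    proof (rule DERIV_nonneg_imp_nondecreasing[OF t])
      fix x assume x: "r \<le> x" "x \<le> t"
      have "((\<lambda>x. exp (- x) * (q' x + q x)) has_real_derivative exp (- x) * (q'' x - q x)) (at x)"
        by (auto intro!: derivative_eq_intros q q' simp: algebra_simps)
      moreover have "exp (- x) * (q'' x - q x) \<ge> 0" using conv[of x] x r by simp
      ultimately show "\<exists>y. ((\<lambda>x. exp (- x) * (q' x + q x)) has_real_derivative y) (at x) \<and> 0 \<le> y" by blast
    qed
    have "exp (- r) * (q' r + q r) \<le> exp (- t) * \<beta>" if t: "t \<ge> r" for t
    proof -
      have "q' t + q t \<le> \<beta>" using dneg[of t] R(2)[of t] t r by linarith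
      then have "exp (- t) * (q' t + q t) \<le> exp (- t) * \<beta>" by (intro mult_left_mono) auto
      then show ?thesis using mono[OF t] by linarith
    qed
    then have ev: "\<forall>\<^sub>F t in at_top. exp (- r) * (q' r + q r) \<le> exp (- t) * \<beta>" by (auto simp: eventually_at_top_linorder)
    have "((\<lambda>t. exp (- t) * \<beta>) \<longlongrightarrow> 0 * \<beta>) at_top"
      by (intro tendsto_intros filterlim_compose[OF exp_at_bot filterlim_uminus_at_bot_at_top])
    then have "exp (- r) * (q' r + q r) \<le> 0 * \<beta>" using ev by (rule tendsto_lowerbound) simp
    then show False using wr by (simp add: mult_le_0_iff)
  qed
  have qdec: "exp r * q r \<le> exp R * q R" if r: "r \<ge> R" for r
  proof (rule DERIV_nonpos_imp_nonincreasing[OF r])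
    fix x assume x: "R \<le> x" "x \<le> r"
    have "((\<lambda>x. exp x * q x) has_real_derivative exp x * (q' x + q x)) (at x)"
      by (auto intro!: derivative_eq_intros q simp: algebra_simps)
    moreover have "exp x * (q' x + q x) \<le> 0" using w[OF x(1)] by (simp add: mult_le_0_iff)
    ultimately show "\<exists>y. ((\<lambda>x. exp x * q x) has_real_derivative y) (at x) \<and> y \<le> 0" by blast
  qed
  have q'mono: "q' x \<le> q' r" if "R \<le> x" "x \<le> r" for x r
    by (rule DERIV_nonneg_imp_nondecreasing[OF that(2)])
       (use q' conv pos that(1) in \<open>meson less_imp_le order_trans\<close>)
  \<comment> \<open>Beyond R, q is convex, so the slope at r is at least the mean slope over the
    preceding unit interval. This turns decay of q into decay of \<open>q'\<close> at the cost of a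
    shift by 1, hence the intervals up to \<open>R + 1\<close>.\<close>
  have dq: "- q' r \<le> q (r - 1)" if r: "r \<ge> R + 1" for r
  proof -
    obtain x where x: "r - 1 < x" "x < r" "q r - q (r - 1) = (r - (r - 1)) * q' x"
      using MVT2[of "r - 1" r q q'] q by auto
    then have "q' x \<le> q' r" using r by (intro q'mono) auto
    then show ?thesis using x(3) pos[of r] by simp
  qed
  have "isCont q r" "isCont q' r" for r using q q' DERIV_isCont by blast+
  then have "continuous_on {0..R+1} (\<lambda>r. q r + \<bar>q' r\<bar>)"
    by (intro continuous_at_imp_continuous_on ballI isCont_add continuous_rabs) auto
  then obtain B where B: "\<And>r. r \<in> {0..R+1} \<Longrightarrow> q r + \<bar>q' r\<bar> \<le> B"
    using compact_continuous_image[of "{0..R+1}" "\<lambda>r. q r + \<bar>q' r\<bar>"] compact_imp_bounded bounded_real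
    by (metis (no_types, lifting) abs_le_D1 compact_Icc imageI)
  have B0: "B \<ge> 0" using B[of 0] pos[of 0] R(1) by (simp add: order_trans[OF add_nonneg_nonneg])
  define D where "D = exp R * q R"
  have D0: "D > 0" using pos by (simp add: D_def)
  \<comment> \<open>The first summand covers the compact interval up to \<open>R + 1\<close>, the
    second the tail, with a factor \<open>exp 1\<close> for the unit shift in the bound of
    \<open>q'\<close>.\<close>
  define C where "C = B * exp (R + 1) + D * exp 1"
  have "1 \<le> exp (1::real)" by simp
  then have CD: "D \<le> C" unfolding C_def using B0 D0 mult_left_mono[of 1 "exp 1" D]
    by (simp add: add_increasing)
  have CD2: "D * exp 1 \<le> C" unfolding C_def using B0 by simp
  have Csmall: "B \<le> C * exp (- r)" if "r \<le> R + 1" for r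
  proof -
    have "B * 1 \<le> B * exp (R + 1 - r)" using that B0 by (intro mult_left_mono) auto
    also have "\<dots> = B * exp (R + 1) * exp (- r)" by (simp add: exp_diff exp_minus divide_inverse)
    also have "\<dots> \<le> C * exp (- r)" unfolding C_def using D0 by (intro mult_right_mono) auto
    finally show ?thesis by simp
  qed
  show thesis
  proof (rule that[of C])
    show "C > 0" using CD D0 by simp
    show "q r \<le> C * exp (- r)" if "r \<ge> 0" for r
    proof (cases "r \<le> R + 1")
      case True then show ?thesis using B[of r] Csmall[OF True] that by auto
    next
      case False
      have "q r = exp r * q r * exp (- r)" by (simp add: exp_minus)
      also have "\<dots> \<le> D * exp (- r)" using qdec[of r] False unfolding D_def by (intro mult_right_mono) auto
      also have "\<dots> \<le> C * exp (- r)" using CD by (intro mult_right_mono) auto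
      finally show ?thesis .
    qed
    show "\<bar>q' r\<bar> \<le> C * exp (- r)" if "r \<ge> 0" for r
    proof (cases "r \<le> R + 1")
      case True then show ?thesis using B[of r] Csmall[OF True] that pos[of r] by auto
    next
      case False
      have "\<bar>q' r\<bar> \<le> q (r - 1)" using dq[of r] dneg[of r] False by simp
      also have "\<dots> = (exp (r - 1) * exp (- (r - 1))) * q (r - 1)" by (simp only: exp_add[symmetric]) simp
      also have "\<dots> = exp (r - 1) * q (r - 1) * exp (- (r - 1))" by (simp only: mult_ac)
      also have "\<dots> \<le> D * exp (- (r - 1))" using qdec[of "r - 1"] False unfolding D_def by (intro mult_right_mono) auto
      also have "\<dots> = D * exp 1 * exp (- r)" by (simp add: exp_diff exp_minus divide_inverse)
      also have "\<dots> \<le> C * exp (- r)" using CD2 by (intro mult_right_mono) auto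
      finally show ?thesis .
    qed
  qed
qed

section \<open>The Pohozaev identity\<close>

lemma square_le_exp: "r \<ge> 0 \<Longrightarrow> r\<^sup>2 \<le> 2 * exp (r::real)"
  using exp_lower_Taylor_quadratic[of r] by simp

lemma integrable_exp_bound:
  fixes f :: "'a::euclidean_space \<Rightarrow> real"
  assumes "f \<in> borel_measurable borel" "AE x in lborel. \<bar>f x\<bar> \<le> D * exp (- norm x)"
  shows "integrable lborel f"
  by (rule Bochner_Integration.integrable_bound[OF integrable_mult_right[OF integrable_exp_norm, of D]])
     (use assms in \<open>auto elim: eventually_mono intro: order_trans[OF _ abs_ge_self]\<close>)

text \<open>The integrand is the derivative of \<open>P\<close> below, which arises by multiplying the equation with the generator \<open>r\<^sup>n q' + (n/2) r\<^sup>n\<^sup>-\<^sup>1 q\<close> of the mass-preserving scaling.\<close>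

lemma pohozaev_radial:
  fixes q q' q'' :: "real \<Rightarrow> real" and d :: nat and p C :: real
  assumes q: "\<And>r. (q has_real_derivative q' r) (at r)" and q': "\<And>r. (q' has_real_derivative q'' r) (at r)"
    and pos: "\<And>r. q r > 0" and d: "d \<ge> 1" and p: "p = 1 + 4 / real (Suc d)"
    and ode: "\<And>r. r > 0 \<Longrightarrow> q'' r + real d / r * q' r = 2 * (q r - q r powr (4 / real (Suc d)) * q r)"
    and C: "C > 0" "\<And>r. r \<ge> 0 \<Longrightarrow> q r \<le> C * exp (- r)" "\<And>r. r \<ge> 0 \<Longrightarrow> \<bar>q' r\<bar> \<le> C * exp (- r)"
  shows "(LINT r|lborel. indicator {0..} r * (r ^ d * (1/2 * (q' r)\<^sup>2 - 2 / (p + 1) * q r powr (p + 1)))) = 0"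
proof -
  define n where "n = Suc d"
  have p1: "p > 1" using p by simp
  have cq: "isCont q r" "isCont q' r" for r using q q' DERIV_isCont by blast+
  define f where "f r = r ^ d * (1/2 * (q' r)\<^sup>2 - 2 / (p + 1) * q r powr (p + 1))" for r
  define G where "G r = (q r)\<^sup>2 / 2 - q r powr (p + 1) / (p + 1)" for r
  define P where "P r = r ^ n * (1/4 * (q' r)\<^sup>2 - G r) + real n / 4 * (r ^ d * (q r * q' r))" for r
  have dP: "(P has_real_derivative f r) (at r)" if r: "r > 0" for r
  proof -
    define y where "y = q r powr (4 / real n)"
    have e1: "q r powr (p + 1) = y * (q r)\<^sup>2"
    proof -
      have "q r powr (p + 1) = q r powr (4 / real n + 2)" by (simp add: p n_def add.commute)
      also have "\<dots> = y * q r powr 2" by (simp add: powr_add y_def)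
      finally show ?thesis using pos[of r] by simp
    qed
    have e2: "q r powr p = y * q r"
    proof -
      have "q r powr p = q r powr (4 / real n + 1)" by (simp add: p n_def add.commute)
      also have "\<dots> = y * q r powr 1" by (simp add: powr_add y_def)
      finally show ?thesis using pos[of r] by simp
    qed
    have dG: "(G has_real_derivative (q r - q r powr p) * q' r) (at r)"
    proof -
      have pw: "((\<lambda>r. q r powr (p + 1)) has_real_derivative ((p + 1) * q r powr (p + 1 - 1)) * q' r) (at r)"
        by (rule DERIV_chain2[OF has_real_derivative_powr[OF pos] q])
      have sq: "((\<lambda>r. (q r)\<^sup>2) has_real_derivative 2 * q r * q' r) (at r)"
        by (auto intro!: derivative_eq_intros q)
      have "(G has_real_derivative (2 * q r * q' r) / 2 - ((p + 1) * q r powr (p + 1 - 1)) * q' r / (p + 1)) (at r)"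
        unfolding G_def[abs_def] by (intro DERIV_diff DERIV_cdivide sq pw)
      moreover have "(2 * q r * q' r) / 2 - ((p + 1) * q r powr (p + 1 - 1)) * q' r / (p + 1) = (q r - q r powr p) * q' r"
        using p1 by (simp add: left_diff_distrib)
      ultimately show ?thesis by simp
    qed
    have dn: "((\<lambda>r. r ^ n) has_real_derivative real n * r ^ d) (at r)"
    proof -
      have "n - Suc 0 = d" by (simp add: n_def)
      with DERIV_pow[of n r UNIV] show ?thesis by (simp only:)
    qed
    have dd: "((\<lambda>r. r ^ d) has_real_derivative real d * r ^ d / r) (at r)"
    proof -
      have "real d * r ^ d / r = real d * r ^ (d - Suc 0)" using r d by (cases d) auto
      with DERIV_pow[of d r UNIV] show ?thesis by (simp only:)
    qed
    have D: "(P has_real_derivative (real n * r ^ d) * (1/4 * (q' r)\<^sup>2 - G r) + (1/4 * (2 * q' r * q'' r) - (q r - q r powr p) * q' r) * r ^ n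
        + real n / 4 * ((real d * r ^ d / r) * (q r * q' r) + (q' r * q' r + q'' r * q r) * r ^ d)) (at r)"
    proof -
      have sq: "((\<lambda>r. (q' r)\<^sup>2) has_real_derivative 2 * q' r * q'' r) (at r)"
        by (auto intro!: derivative_eq_intros q')
      show ?thesis unfolding P_def[abs_def]
        by (rule DERIV_add[OF DERIV_mult[OF dn DERIV_diff[OF DERIV_cmult[OF sq] dG]]
              DERIV_cmult[OF DERIV_mult[OF dd DERIV_mult[OF q q']]]])
    qed
    have q2: "q'' r = 2 * (q r - y * q r) - real d / r * q' r"
      using ode[OF r] by (simp add: y_def n_def)
    have rn: "r ^ n = r * r ^ d" by (simp add: n_def)
    have nd: "real n = real d + 1" by (simp add: n_def)
    have "(real n * r ^ d) * (1/4 * (q' r)\<^sup>2 - G r) + (1/4 * (2 * q' r * q'' r) - (q r - q r powr p) * q' r) * r ^ n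
        + real n / 4 * ((real d * r ^ d / r) * (q r * q' r) + (q' r * q' r + q'' r * q r) * r ^ d)
      = r ^ d * (1/2 * (q' r)\<^sup>2 + real n * (1 / (p + 1) - 1/2) * (y * (q r)\<^sup>2))"
      unfolding G_def e1 e2 q2 rn nd using r by (simp add: power2_eq_square field_simps)
    \<comment> \<open>The place where mass-criticality enters: \<open>n (p - 1) = 4\<close> turns
      the coefficient into that of the energy.\<close>
    also have "real n * (1 / (p + 1) - 1/2) = - 2 / (p + 1)"
    proof -
      have "p * real n = real n + 4" using p by (simp add: n_def field_simps)
      then show ?thesis using p1 by (simp add: field_simps)
    qed
    finally show ?thesis using D by (simp add: f_def e1)
  qed
  have cf: "isCont f r" for r
    unfolding f_def using pos[of r] by (intro continuous_intros cq) auto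
  have cP: "isCont P r" for r
  proof -
    have "isCont G r" unfolding G_def[abs_def]
      using pos[of r] p1 by (intro continuous_divide continuous_intros cq) simp_all
    then show ?thesis unfolding P_def[abs_def] by (intro continuous_intros cq)
  qed
  have fm: "f \<in> borel_measurable borel"
    using cf by (intro borel_measurable_continuous_onI continuous_at_imp_continuous_on) auto
  have qp: "q r powr (p + 1) \<le> C powr (p + 1) * exp (- r)" if r: "r \<ge> 0" for r
  proof -
    have "q r powr (p + 1) \<le> (C * exp (- r)) powr (p + 1)" using C(2)[OF r] pos[of r] p1 by (intro powr_mono2) auto
    also have "\<dots> = C powr (p + 1) * exp (- r * (p + 1))" using C by (simp add: powr_mult exp_powr_real)
    also have "\<dots> \<le> C powr (p + 1) * exp (- r)"
      using r p1 mult_left_mono[of 1 "p + 1" r] by (intro mult_left_mono) auto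
    finally show ?thesis .
  qed
  have e2: "(C * exp (- r))\<^sup>2 \<le> C\<^sup>2 * exp (- r)" if "r \<ge> 0" for r
  proof -
    have "exp (- r) * exp (- r) \<le> exp (- r) * 1" using that by (intro mult_left_mono) auto
    then have "C\<^sup>2 * (exp (- r) * exp (- r)) \<le> C\<^sup>2 * (exp (- r) * 1)" by (rule mult_left_mono) simp
    then show ?thesis by (simp only: power_mult_distrib power2_eq_square[of "exp (- r)"] mult_1_right)
  qed
  have q2: "(q r)\<^sup>2 \<le> C\<^sup>2 * exp (- r)" "(q' r)\<^sup>2 \<le> C\<^sup>2 * exp (- r)" "\<bar>q r * q' r\<bar> \<le> C\<^sup>2 * exp (- r)" if r: "r \<ge> 0" for r
  proof -
    have 1: "\<bar>q r\<bar> \<le> C * exp (- r)" using C(2)[OF r] pos[of r] by simp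
    note 2 = C(3)[OF r]
    have "(q r)\<^sup>2 \<le> (C * exp (- r))\<^sup>2" "(q' r)\<^sup>2 \<le> (C * exp (- r))\<^sup>2"
      using power_mono[OF 1, of 2] power_mono[OF 2, of 2] by auto
    moreover have "\<bar>q r * q' r\<bar> \<le> (C * exp (- r))\<^sup>2"
      unfolding abs_mult power2_eq_square using 1 2 by (intro mult_mono) auto
    ultimately show "(q r)\<^sup>2 \<le> C\<^sup>2 * exp (- r)" "(q' r)\<^sup>2 \<le> C\<^sup>2 * exp (- r)" "\<bar>q r * q' r\<bar> \<le> C\<^sup>2 * exp (- r)"
      using e2[OF r] by linarith+
  qed
  define E where "E = C\<^sup>2 + C powr (p + 1)"
  have E0: "E \<ge> 0" by (simp add: E_def)
  have fb: "\<bar>f r\<bar> \<le> E * (r ^ d * exp (- r))" if r: "r \<ge> 0" for r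
  proof -
    have "\<bar>1/2 * (q' r)\<^sup>2 - 2 / (p + 1) * q r powr (p + 1)\<bar> \<le> (q' r)\<^sup>2 + q r powr (p + 1)"
    proof -
      have "2 / (p + 1) * q r powr (p + 1) \<le> 1 * q r powr (p + 1)" using p1 by (intro mult_right_mono) auto
      moreover have "2 / (p + 1) * q r powr (p + 1) \<ge> 0" using p1 by simp
      ultimately show ?thesis using zero_le_power2[of "q' r"] powr_ge_zero[of "q r" "p + 1"]
        unfolding abs_le_iff by (simp only: mult_1) linarith
    qed
    also have "\<dots> \<le> E * exp (- r)" using q2(2)[OF r] qp[OF r] by (simp add: E_def distrib_right)
    finally have "r ^ d * \<bar>1/2 * (q' r)\<^sup>2 - 2 / (p + 1) * q r powr (p + 1)\<bar> \<le> r ^ d * (E * exp (- r))"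
      using r by (intro mult_left_mono) auto
    then show ?thesis using r by (simp add: f_def abs_mult mult_ac)
  qed
  have int: "integrable lborel (\<lambda>r. indicator {0<..} r *\<^sub>R f r)"
  proof (rule Bochner_Integration.integrable_bound[OF integrable_mult_right[OF integrable_power_exp[of d], of E]])
    show "(\<lambda>r. indicator {0<..} r *\<^sub>R f r) \<in> borel_measurable lborel" using fm by measurable
    show "AE r in lborel. norm (indicator {0<..} r *\<^sub>R f r) \<le> norm (E * (indicator {0..} r * (r ^ d * exp (- r))))"
      using fb E0 by (auto simp: indicator_def abs_mult intro!: AE_I2)
  qed
  have "(LBINT r=0..\<infinity>. f r) = 0 - 0"
  proof (rule interval_integral_FTC_integrable[where F=P])
    show "(P has_vector_derivative f x) (at x)" if "0 < ereal x" for x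
      using dP[of x] that by (simp add: has_real_derivative_iff_has_vector_derivative)
    show "isCont f x" for x by (rule cf)
    have "einterval 0 \<infinity> = {0<..}" by (auto simp: einterval_def)
    then show "set_integrable lborel (einterval 0 \<infinity>) f" using int by (simp add: set_integrable_def)
    \<comment> \<open>Both parts of P contain a positive power of r, as d is at least 1, so there is
      no boundary term at the origin.\<close>
    have "P 0 = 0" using d by (simp add: P_def n_def power_0_left)
    then have "(P \<longlongrightarrow> 0) (at_right 0)" using cP[of 0] by (auto simp: isCont_def intro: tendsto_mono[OF at_le])
    then show "((P \<circ> real_of_ereal) \<longlongrightarrow> 0) (at_right 0)"
      unfolding zero_ereal_def by (simp add: ereal_tendsto_simps)
    have Pb: "\<forall>\<^sub>F r in at_top. \<bar>P r\<bar> \<le> (2 * E + real n * E) * (r ^ n / exp r)"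
      using eventually_ge_at_top[of 1]
    proof eventually_elim
      case (elim r)
      then have r: "r \<ge> 0" by simp
      have "\<bar>1/4 * (q' r)\<^sup>2 - G r\<bar> \<le> 1/4 * (q' r)\<^sup>2 + (q r)\<^sup>2 / 2 + q r powr (p + 1) / (p + 1)"
        using p1 by (auto simp: G_def abs_le_iff)
      also have "\<dots> \<le> (q' r)\<^sup>2 + (q r)\<^sup>2 + q r powr (p + 1)"
      proof (intro add_mono)
        have "q r powr (p + 1) / (p + 1) \<le> q r powr (p + 1) / 1" using p1 by (intro divide_left_mono) auto
        then show "q r powr (p + 1) / (p + 1) \<le> q r powr (p + 1)" by simp
      qed auto
      also have "\<dots> \<le> 2 * E * exp (- r)"
      proof -
        have "0 \<le> C powr (p + 1) * exp (- r)" by simp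
        moreover have "2 * E * exp (- r) = 2 * (C\<^sup>2 * exp (- r)) + 2 * (C powr (p + 1) * exp (- r))"
          by (simp add: E_def distrib_right)
        ultimately show ?thesis using q2(1,2)[OF r] qp[OF r] by linarith
      qed
      finally have 1: "r ^ n * \<bar>1/4 * (q' r)\<^sup>2 - G r\<bar> \<le> r ^ n * (2 * E * exp (- r))" using r by (intro mult_left_mono) auto
      have "C\<^sup>2 * exp (- r) \<le> E * exp (- r)" unfolding E_def by (intro mult_right_mono) auto
      then have "\<bar>q r * q' r\<bar> \<le> E * exp (- r)" using q2(3)[OF r] by linarith
      moreover have "r ^ d \<le> r ^ n" using elim by (intro power_increasing) (auto simp: n_def)
      ultimately have "r ^ d * \<bar>q r * q' r\<bar> \<le> r ^ n * (E * exp (- r))" using r by (intro mult_mono) auto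
      then have 2: "real n / 4 * (r ^ d * \<bar>q r * q' r\<bar>) \<le> real n * (r ^ n * (E * exp (- r)))"
      proof -
        have "real n / 4 * (r ^ d * \<bar>q r * q' r\<bar>) \<le> real n * (r ^ d * \<bar>q r * q' r\<bar>)"
          using r by (intro mult_right_mono) auto
        also have "\<dots> \<le> real n * (r ^ n * (E * exp (- r)))"
          using \<open>r ^ d * \<bar>q r * q' r\<bar> \<le> r ^ n * (E * exp (- r))\<close> by (rule mult_left_mono) simp
        finally show ?thesis .
      qed
      have "\<bar>P r\<bar> \<le> r ^ n * \<bar>1/4 * (q' r)\<^sup>2 - G r\<bar> + real n / 4 * (r ^ d * \<bar>q r * q' r\<bar>)"
        unfolding P_def using r by (intro order_trans[OF abs_triangle_ineq]) (simp add: abs_mult)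
      also have "\<dots> \<le> r ^ n * (2 * E * exp (- r)) + real n * (r ^ n * (E * exp (- r)))" using 1 2 by linarith
      also have "\<dots> = (2 * E + real n * E) * (r ^ n / exp r)" by (simp add: exp_minus field_simps)
      finally show ?case .
    qed
    have "((\<lambda>r. (2 * E + real n * E) * (r ^ n / exp r)) \<longlongrightarrow> (2 * E + real n * E) * 0) at_top"
      by (intro tendsto_intros tendsto_power_div_exp_0)
    then have "(P \<longlongrightarrow> 0) at_top"
      by (intro Lim_null_comparison[OF Pb[folded real_norm_def]]) simp
    then show "((P \<circ> real_of_ereal) \<longlongrightarrow> 0) (at_left \<infinity>)"
      by (simp add: ereal_tendsto_simps)
  qed simp
  moreover have "(LBINT r=0..\<infinity>. f r) = (LINT r|lborel. indicator {0<..} r * f r)"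
  proof -
    have "einterval 0 \<infinity> = {0<..}" by (auto simp: einterval_def)
    then show ?thesis by (simp add: interval_lebesgue_integral_def set_lebesgue_integral_def)
  qed
  moreover have "(LINT r|lborel. indicator {0<..} r * f r) = (LINT r|lborel. indicator {0..} r * f r)"
  proof (rule integral_cong_AE)
    show "AE r in lborel. indicator {0<..} r * f r = indicator {0..} r * f r"
      using AE_lborel_singleton[of "0::real"] by eventually_elim (auto simp: indicator_def)
  qed (use fm in measurable)
  ultimately show ?thesis by (simp add: f_def)
qed

section \<open>The radial profile of the ground state\<close>

lemma ground_state_derivatives:
  fixes Q :: "real^'n::finite \<Rightarrow> real"
  assumes Q: "ground_state Q"
  shows "has_pd j Q (partial_deriv j Q)" "continuous_on UNIV Q" "continuous_on UNIV (partial_deriv j Q)"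
    "has_pd i (partial_deriv j Q) (partial_deriv i (partial_deriv j Q))"
proof -
  have C: "C_k (Suc (Suc 0)) Q" using Q by (simp add: ground_state_def numeral_2_eq_2)
  then have d: "Q differentiable (at x)" "partial_deriv j Q differentiable (at x)" for x j by auto
  show "has_pd j Q (partial_deriv j Q)" "has_pd i (partial_deriv j Q) (partial_deriv i (partial_deriv j Q))"
    by (intro has_pd_partial_deriv d)+
  show "continuous_on UNIV Q" "continuous_on UNIV (partial_deriv j Q)"
    by (intro continuous_at_imp_continuous_on ballI differentiable_imp_continuous_within d)+
qed

text \<open>The profile is read off on one coordinate axis. There the second derivative along the
  axis is \<open>q''\<close>, and each of the others equals \<open>q' / r\<close>, which gives the
  radial form of the Laplacian without general polar coordinates.\<close>

lemma ground_state_profile: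
  fixes Q :: "real^'n::finite \<Rightarrow> real" and i :: 'n
  assumes Q: "ground_state Q"
  defines "q \<equiv> \<lambda>r. Q (r *\<^sub>R axis i 1)" and "q' \<equiv> \<lambda>r. partial_deriv i Q (r *\<^sub>R axis i 1)"
    and "q'' \<equiv> \<lambda>r. partial_deriv i (partial_deriv i Q) (r *\<^sub>R axis i 1)"
  shows "(q has_real_derivative q' r) (at r)" "(q' has_real_derivative q'' r) (at r)"
    and "Q x = q (norm x)" and "(q \<longlongrightarrow> 0) at_top" and "q r > 0"
    and "x \<noteq> 0 \<Longrightarrow> partial_deriv j Q x = q' (norm x) * (x $ j / norm x)"
    and "r > 0 \<Longrightarrow> q'' r + real (CARD('n) - 1) / r * q' r = 2 * (q r - q r powr (4 / real CARD('n)) * q r)"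
proof -
  note D = ground_state_derivatives[OF Q]
  let ?e = "axis i (1::real) :: real^'n"
  show q: "(q has_real_derivative q' r) (at r)" for r
    using has_pd_at[OF D(1)[of i], of 0 r UNIV] by (simp add: q_def q'_def has_real_derivative_iff_has_vector_derivative)
  show q': "(q' has_real_derivative q'' r) (at r)" for r
    using has_pd_at[OF D(4)[of i i], of 0 r UNIV] by (simp add: q'_def q''_def has_real_derivative_iff_has_vector_derivative)
  have rad: "Q x = Q y" if "norm x = norm y" for x y using Q that unfolding ground_state_def by blast
  show Qq: "Q x = q (norm x)" for x unfolding q_def by (rule rad) simp
  have "filterlim (\<lambda>r::real. r *\<^sub>R ?e) at_infinity at_top"
    unfolding filterlim_at_infinity_conv_norm_at_top by (simp add: filterlim_abs_real)
  moreover have "(Q \<longlongrightarrow> 0) at_infinity" using Q by (simp add: ground_state_def)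
  ultimately show "(q \<longlongrightarrow> 0) at_top" unfolding q_def by (rule filterlim_compose[rotated])
  show pos: "q r > 0" for r using Q by (simp add: q_def ground_state_def)
  show pdj: "partial_deriv j Q x = q' (norm x) * (x $ j / norm x)" if x: "x \<noteq> 0" for x j
  proof -
    have A: "((\<lambda>t. x + t *\<^sub>R axis j 1) has_vector_derivative axis j 1) (at 0)"
      by (auto intro!: derivative_eq_intros)
    have B: "(norm has_derivative (\<lambda>h. x \<bullet> h / norm x)) (at ((\<lambda>t::real. x + t *\<^sub>R axis j 1) 0))"
      using has_derivative_norm[OF x] x by (simp add: sgn_div_norm inner_commute divide_inverse mult.commute)
    have "((\<lambda>t. norm (x + t *\<^sub>R axis j 1)) has_vector_derivative (x \<bullet> axis j 1 / norm x)) (at 0)"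
      using vector_derivative_diff_chain_within[OF A has_derivative_at_withinI[OF B]] by (simp add: o_def)
    then have n: "((\<lambda>t. norm (x + t *\<^sub>R axis j 1)) has_real_derivative (x $ j / norm x)) (at 0)"
      by (simp add: has_real_derivative_iff_has_vector_derivative inner_axis)
    have "(q has_real_derivative q' (norm x)) (at (norm (x + 0 *\<^sub>R axis j 1)))" using q[of "norm x"] by simp
    from DERIV_chain2[OF this n]
    have "((\<lambda>t. Q (x + t *\<^sub>R axis j 1)) has_vector_derivative q' (norm x) * (x $ j / norm x)) (at 0)"
      by (simp add: Qq has_real_derivative_iff_has_vector_derivative)
    moreover have "((\<lambda>t. Q (x + t *\<^sub>R axis j 1)) has_vector_derivative partial_deriv j Q x) (at 0)"
      using D(1)[of j] by (simp add: has_pd_def)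
    ultimately show ?thesis by (rule vector_derivative_unique_at[symmetric])
  qed
  show "q'' r + real (CARD('n) - 1) / r * q' r = 2 * (q r - q r powr (4 / real CARD('n)) * q r)" if r: "r > 0" for r
  proof -
    \<comment> \<open>On the line through \<open>r *\<^sub>R ?e\<close> in direction j, the j-th
      partial derivative is \<open>t * m t\<close>, so its derivative at 0 is \<open>m 0\<close>.
      Only continuity of m is used, hence only of \<open>q'\<close>.\<close>
    have off: "partial_deriv j (partial_deriv j Q) (r *\<^sub>R ?e) = q' r / r" if j: "j \<noteq> i" for j
    proof -
      let ?x = "\<lambda>t. r *\<^sub>R ?e + t *\<^sub>R axis j (1::real)"
      have comp: "?x t $ j = t" "?x t $ i = r" for t using j by (simp_all add: axis_def)
      have nz: "?x t \<noteq> 0" for t using comp(2)[of t] r by (metis less_irrefl zero_index)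
      define m where "m t = q' (norm (?x t)) / norm (?x t)" for t
      have F: "partial_deriv j Q (?x t) = t * m t" for t
        using pdj[OF nz[of t], of j] comp(1)[of t] by (simp add: m_def)
      have "((\<lambda>h. (partial_deriv j Q (?x h) - partial_deriv j Q (?x 0)) /\<^sub>R h) \<longlongrightarrow> partial_deriv j (partial_deriv j Q) (r *\<^sub>R ?e)) (at 0)"
        using D(4)[of j j] by (intro has_vector_derivative_0D) (auto simp: has_pd_def)
      moreover have "\<forall>\<^sub>F h in at 0. (partial_deriv j Q (?x h) - partial_deriv j Q (?x 0)) /\<^sub>R h = m h"
        unfolding F by (auto simp: eventually_at_filter)
      ultimately have 1: "(m \<longlongrightarrow> partial_deriv j (partial_deriv j Q) (r *\<^sub>R ?e)) (at 0)"
        by (rule Lim_transform_eventually)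
      have cq': "isCont q' s" for s using q' DERIV_isCont by blast
      have "isCont m 0" unfolding m_def
        using nz[of 0] r by (intro continuous_intros isCont_o2[OF _ cq']) auto
      then have 2: "(m \<longlongrightarrow> m 0) (at 0)" by (simp add: isCont_def)
      have "partial_deriv j (partial_deriv j Q) (r *\<^sub>R ?e) = m 0" by (rule LIM_unique[OF 1 2])
      also have "m 0 = q' r / r" using r by (simp add: m_def)
      finally show ?thesis .
    qed
    have "laplacian Q (r *\<^sub>R ?e) = q'' r + (\<Sum>j\<in>UNIV - {i}. partial_deriv j (partial_deriv j Q) (r *\<^sub>R ?e))"
      unfolding laplacian_def q''_def by (rule sum.remove) auto
    also have "(\<Sum>j\<in>UNIV - {i}. partial_deriv j (partial_deriv j Q) (r *\<^sub>R ?e)) = (\<Sum>j\<in>UNIV - {i}. q' r / r)"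
      by (rule sum.cong) (auto simp: off)
    also have "\<dots> = real (CARD('n) - 1) / r * q' r" by (simp add: card_Diff_singleton)
    finally have lap: "laplacian Q (r *\<^sub>R ?e) = q'' r + real (CARD('n) - 1) / r * q' r" .
    have "- (1/2) * laplacian Q (r *\<^sub>R ?e) + Q (r *\<^sub>R ?e) - \<bar>Q (r *\<^sub>R ?e)\<bar> powr (4 / real CARD('n)) * Q (r *\<^sub>R ?e) = 0"
      using Q unfolding ground_state_def by blast
    then have "- (1/2) * (q'' r + real (CARD('n) - 1) / r * q' r) + q r - q r powr (4 / real CARD('n)) * q r = 0"
      unfolding lap using pos[of r] by (simp add: q_def)
    then show ?thesis by (simp add: field_simps)
  qed
qed

text \<open>Exponential decay of profile and slope makes Q admissible; the radial Pohozaev identity,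
  integrated over spheres, makes its field-free energy vanish.\<close>

lemma ground_state_energy:
  fixes Q :: "real^'n::finite \<Rightarrow> real"
  assumes Q: "ground_state Q" and N: "CARD('n) \<ge> 2" and p: "p = 1 + 4 / real CARD('n)"
  shows "admissible p Q (\<lambda>j. partial_deriv j Q)" "mass Q > 0" "L2_norm_sq Q = mass Q"
    "1/2 * kinetic (\<lambda>j. partial_deriv j Q) = 2 / (p + 1) * nonlin p Q"
proof -
  \<comment> \<open>Any coordinate axis will do.\<close>
  define i :: 'n where "i = undefined"
  define q where "q r = Q (r *\<^sub>R axis i 1)" for r
  define q' where "q' r = partial_deriv i Q (r *\<^sub>R axis i 1)" for r
  define q'' where "q'' r = partial_deriv i (partial_deriv i Q) (r *\<^sub>R axis i 1)" for r
  note P = ground_state_profile[where i=i, OF Q, folded q_def q'_def q''_def]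
  note D = ground_state_derivatives[OF Q]
  define d where "d = CARD('n) - 1"
  have d: "d \<ge> 1" "CARD('n) = Suc d" using N by (auto simp: d_def)
  have p1: "p > 1" using p by simp
  have ode: "q'' r + real d / r * q' r = 2 * (q r - q r powr (4 / real (Suc d)) * q r)" if "r > 0" for r
    using P(7)[OF that] unfolding d(2) by (simp only: diff_Suc_1)
  have "\<exists>C>0. (\<forall>r\<ge>0. q r \<le> C * exp (- r)) \<and> (\<forall>r\<ge>0. \<bar>q' r\<bar> \<le> C * exp (- r))"
    by (rule radial_ode_decay[OF P(1) P(2) P(5) P(4) _ _ ode]) auto
  then obtain C where C: "C > 0" "\<And>r. r \<ge> 0 \<Longrightarrow> q r \<le> C * exp (- r)" "\<And>r. r \<ge> 0 \<Longrightarrow> \<bar>q' r\<bar> \<le> C * exp (- r)"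
    by blast
  have Qb: "0 < Q x" "Q x \<le> C * exp (- norm x)" for x using P(3)[of x] P(5) C(2)[of "norm x"] by auto
  \<comment> \<open>The radial formula for the gradient is available off the origin, a null set;
    this is why the estimates below hold almost everywhere.\<close>
  have sum2: "(\<Sum>j\<in>UNIV. (partial_deriv j Q x)\<^sup>2) = (q' (norm x))\<^sup>2" if x: "x \<noteq> 0" for x
  proof -
    have "(\<Sum>j\<in>UNIV. (partial_deriv j Q x)\<^sup>2) = (\<Sum>j\<in>UNIV. (q' (norm x))\<^sup>2 / (norm x)\<^sup>2 * (x $ j)\<^sup>2)"
      unfolding P(6)[OF x] by (intro sum.cong) (auto simp: power_mult_distrib power_divide)
    also have "\<dots> = (q' (norm x))\<^sup>2 / (norm x)\<^sup>2 * (norm x)\<^sup>2"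
      unfolding sum_distrib_left[symmetric] norm_vec_square[of x] by simp
    finally show ?thesis using x by simp
  qed
  have pdb: "\<bar>partial_deriv j Q x\<bar> \<le> C * exp (- norm x)" if x: "x \<noteq> 0" for j x
  proof -
    have "(partial_deriv j Q x)\<^sup>2 \<le> (\<Sum>j\<in>UNIV. (partial_deriv j Q x)\<^sup>2)" by (rule member_le_sum) auto
    then have "\<bar>partial_deriv j Q x\<bar> \<le> \<bar>q' (norm x)\<bar>" unfolding sum2[OF x] by (rule abs_le_square_iff[THEN iffD2])
    then show ?thesis using C(3)[of "norm x"] by simp
  qed
  have e2: "(C * exp (- r))\<^sup>2 = C\<^sup>2 * exp (- r) * exp (- r)" for r by (simp add: power2_eq_square)
  have e3: "exp (- norm x) \<le> (1::real)" for x :: "real^'n" by simp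
  have mQ: "Q \<in> borel_measurable borel" "partial_deriv j Q \<in> borel_measurable borel" for j
    using D(2,3) borel_measurable_continuous_onI by blast+
  have Q2: "(Q x)\<^sup>2 \<le> C\<^sup>2 * exp (- norm x) * exp (- norm x)" for x
    unfolding e2[symmetric] using Qb[of x] by (intro power_mono) auto
  show n: "admissible p Q (\<lambda>j. partial_deriv j Q)"
    unfolding admissible_def
  proof (intro conjI allI D)
    show "integrable lborel (\<lambda>x. (partial_deriv j Q x)\<^sup>2)" for j
    proof (rule integrable_exp_bound[where D="C\<^sup>2"])
      show "AE x in lborel. \<bar>(partial_deriv j Q x)\<^sup>2\<bar> \<le> C\<^sup>2 * exp (- norm x)"
        using AE_lborel_singleton[of "0 :: real^'n"]
      proof eventually_elim
        case (elim x)
        have "(partial_deriv j Q x)\<^sup>2 \<le> (C * exp (- norm x))\<^sup>2" using power_mono[OF pdb[OF elim, of j], of 2] by simp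
        also have "\<dots> \<le> C\<^sup>2 * exp (- norm x) * 1" unfolding e2 using e3 by (intro mult_left_mono) auto
        finally show ?case by simp
      qed
    qed (use mQ in measurable)
    show "integrable lborel (\<lambda>x. (Q x)\<^sup>2)"
    proof (rule integrable_exp_bound[where D="C\<^sup>2"])
      have "(Q x)\<^sup>2 \<le> C\<^sup>2 * exp (- norm x) * 1" for x
        using Q2[of x] by (rule order_trans) (intro mult_left_mono e3, simp)
      then show "AE x in lborel. \<bar>(Q x)\<^sup>2\<bar> \<le> C\<^sup>2 * exp (- norm x)" by auto
    qed (use mQ in measurable)
    show "integrable lborel (\<lambda>x. (norm x)\<^sup>2 * (Q x)\<^sup>2)"
    proof (rule integrable_exp_bound[where D="2 * C\<^sup>2"])
      \<comment> \<open>The square of Q decays like \<open>exp (- 2 * norm x)\<close>; half of this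
        decay pays for the weight.\<close>
      have "(norm x)\<^sup>2 * (Q x)\<^sup>2 \<le> (2 * exp (norm x)) * (C\<^sup>2 * exp (- norm x) * exp (- norm x))" for x
        by (intro mult_mono square_le_exp Q2) auto
      also have "(2 * exp (norm x)) * (C\<^sup>2 * exp (- norm x) * exp (- norm x)) = 2 * C\<^sup>2 * exp (- norm x)" for x :: "real^'n"
        by (simp add: exp_minus)
      finally show "AE x in lborel. \<bar>(norm x)\<^sup>2 * (Q x)\<^sup>2\<bar> \<le> 2 * C\<^sup>2 * exp (- norm x)" by auto
    qed (use mQ in measurable)
    show "integrable lborel (\<lambda>x. \<bar>Q x\<bar> powr (p + 1))"
    proof (rule integrable_exp_bound[where D="C powr (p + 1)"])
      have "\<bar>Q x\<bar> powr (p + 1) \<le> C powr (p + 1) * exp (- norm x)" for x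
      proof -
        have "\<bar>Q x\<bar> powr (p + 1) \<le> (C * exp (- norm x)) powr (p + 1)" using Qb[of x] p1 by (intro powr_mono2) auto
        also have "\<dots> = C powr (p + 1) * exp (- norm x * (p + 1))" using C by (simp add: powr_mult exp_powr_real)
        also have "\<dots> \<le> C powr (p + 1) * exp (- norm x)"
          using p1 mult_left_mono[of 1 "p + 1" "norm x"] by (intro mult_left_mono) auto
        finally show ?thesis .
      qed
      then show "AE x in lborel. \<bar>\<bar>Q x\<bar> powr (p + 1)\<bar> \<le> C powr (p + 1) * exp (- norm x)" by auto
    qed (use mQ in measurable)
  qed
  show "mass Q > 0" unfolding mass_def
    using n Qb(1)[of 0] D(2) by (intro integral_continuous_pos[where a=0]) (auto simp: admissible_def intro!: continuous_intros)
  show "L2_norm_sq Q = mass Q"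
    using mQ by (simp add: L2_norm_sq_def mass_def integral_completion)
  define h where "h r = 1/2 * (q' r)\<^sup>2 - 2 / (p + 1) * q r powr (p + 1)" for r
  have "q' \<in> borel_measurable borel" "q \<in> borel_measurable borel"
    using P(1,2) by (auto intro!: borel_measurable_continuous_onI continuous_at_imp_continuous_on DERIV_isCont)
  then have mh: "h \<in> borel_measurable borel" unfolding h_def[abs_def] by measurable
  have iK: "integrable lborel (\<lambda>x. \<Sum>j\<in>UNIV. (partial_deriv j Q x)\<^sup>2)" and iN: "integrable lborel (\<lambda>x. \<bar>Q x\<bar> powr (p + 1))"
    using n by (auto simp: admissible_def)
  have "1/2 * kinetic (\<lambda>j. partial_deriv j Q) - 2 / (p + 1) * nonlin p Q =
     (LINT x|lborel. 1/2 * (\<Sum>j\<in>UNIV. (partial_deriv j Q x)\<^sup>2) - 2 / (p + 1) * \<bar>Q x\<bar> powr (p + 1))"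
    unfolding kinetic_def nonlin_def
    by (simp only: Bochner_Integration.integral_diff[OF integrable_mult_right[OF iK] integrable_mult_right[OF iN]] integral_mult_right_zero)
  also have "\<dots> = (LINT x|lborel. h (norm (x :: real^'n)))"
  proof (rule integral_cong_AE)
    show "AE x in lborel. 1/2 * (\<Sum>j\<in>UNIV. (partial_deriv j Q x)\<^sup>2) - 2 / (p + 1) * \<bar>Q x\<bar> powr (p + 1) = h (norm x)"
      using AE_lborel_singleton[of "0 :: real^'n"]
    proof eventually_elim
      case (elim x)
      show ?case unfolding h_def sum2[OF elim] P(3)[of x] using P(5)[of "norm x"] by simp
    qed
  qed (use mQ mh in measurable)
  also have "\<dots> = (LINT r|lborel. shell TYPE(real^'n) r * h r)" by (rule radial_integral(2)[OF mh])
  also have "\<dots> = (LINT r|lborel. (unit_ball_vol (real CARD('n)) * real CARD('n)) * (indicator {0..} r * (r ^ d * h r)))"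
    by (intro Bochner_Integration.integral_cong) (auto simp: shell_def d_def)
  also have "\<dots> = (unit_ball_vol (real CARD('n)) * real CARD('n)) * (LINT r|lborel. indicator {0..} r * (r ^ d * h r))"
    by (rule integral_mult_right_zero)
  also have "(LINT r|lborel. indicator {0..} r * (r ^ d * h r)) = 0"
    unfolding h_def using p d by (intro pohozaev_radial[OF P(1) P(2) P(5) d(1) _ ode C]) auto
  finally show "1/2 * kinetic (\<lambda>j. partial_deriv j Q) = 2 / (p + 1) * nonlin p Q" by simp
qed

section \<open>Nonexistence of minimizers\<close>

text \<open>Excludes functions of mass 0 as competitors with negative field-free energy; they could
  not be rescaled to mass c.\<close>

lemma nonlin_eq_0:
  assumes n: "admissible p v v'" and m: "mass v = 0"
  shows "nonlin p v = 0"
proof -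
  have "AE x in lborel. (v x)\<^sup>2 = 0"
    using n m integral_nonneg_eq_0_iff_AE[of lborel "\<lambda>x. (v x)\<^sup>2"] by (auto simp: admissible_def mass_def)
  then have "AE x in lborel. \<bar>v x\<bar> powr (p + 1) = 0" by eventually_elim simp
  then show ?thesis
    using n integral_nonneg_eq_0_iff_AE[of lborel "\<lambda>x. \<bar>v x\<bar> powr (p + 1)"] by (auto simp: admissible_def nonlin_def)
qed

text \<open>An energy bounded below on the sphere excludes negative field-free energy up to mass c,
  since concentration would amplify it without limit. This is the hypothesis of the strict bound,
  which makes magnetic kinetic minus nonlinear energy positive; the trap only adds to it. No
  minimality of \<phi> is involved, only membership in the sphere.\<close>

lemma energy_pos_if_bounded_below:
  fixes \<phi> :: "real^'n::finite \<Rightarrow> complex"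
  assumes \<phi>: "\<phi> \<in> mass_sphere \<gamma> g a b c" and c: "c > 0" and \<gamma>: "\<gamma> > 0" and ab: "a \<noteq> b"
    and p: "p \<ge> 1 + 4 / real CARD('n)"
    and min: "\<And>f. f \<in> mass_sphere \<gamma> g a b c \<Longrightarrow> B \<le> energy \<gamma> g a b p f"
  shows "energy \<gamma> g a b p \<phi> > 0"
proof -
  let ?w = "\<lambda>j. weak_pderiv j \<phi>"
  have p1: "p > 1" using p by (rule less_le_trans[rotated]) auto
  have sq: "square_integrable \<phi>" and ex: "\<And>j. \<exists>h. has_weak_pderiv j \<phi> h" and sg: "square_integrable (mag_grad \<gamma> a b \<phi>)"
    and M: "L2_norm_sq \<phi> = c"
    using \<phi> by (auto simp: mass_sphere_def Sigma_space_def H1_mag_def)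
  have w: "has_weak_pderiv j \<phi> (?w j)" for j
    unfolding weak_pderiv_def using ex[of j] by (rule someI_ex)
  have lw: "locally_integrable (?w j)" for j using w[of j] by (simp add: has_weak_pderiv_def)
  have m\<phi>: "\<phi> \<in> borel_measurable lebesgue" using sq by (simp add: square_integrable_def)
  obtain \<psi> where \<psi>: "\<psi> \<in> borel_measurable borel" "AE x in lborel. \<phi> x = \<psi> x"
    by (rule borel_representative[OF m\<phi>])
  have "\<exists>h. h \<in> borel_measurable borel \<and> (AE x in lborel. ?w j x = h x)" for j
    by (rule borel_representative[OF locally_integrable_measurable[OF lw]]) blast
  then obtain h where h: "\<And>j. h j \<in> borel_measurable borel" "\<And>j. AE x in lborel. ?w j x = h j x" by metis
  have lh: "loc_int (h j)" for j by (rule locally_integrable_rep[OF lw h])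
  have weak: "(LINT x|lborel. \<psi> x * partial_deriv j \<eta> x) = - (LINT x|lborel. h j x * \<eta> x)" if "test_function \<eta>" for j \<eta>
    by (rule weak_pderiv_borel[OF w \<psi> h that])
  define D where "D x = (\<chi> j. cov_deriv \<gamma> a b \<psi> h j x)" for x
  have AED: "AE x in lborel. mag_grad \<gamma> a b \<phi> x = D x"
  proof -
    have "AE x in lborel. \<forall>j\<in>UNIV. ?w j x = h j x" using h(2) by (intro AE_finite_allI) auto
    then show ?thesis using \<psi>(2) by eventually_elim (simp add: mag_grad_def D_def cov_deriv_def)
  qed
  have mA: "(\<lambda>x. mag_potential \<gamma> a b x $ j) \<in> borel_measurable borel" for j
    by (intro borel_measurable_continuous_onI continuous_intros continuous_confinement)
  have mc: "(\<lambda>x. cov_deriv \<gamma> a b \<psi> h j x) \<in> borel_measurable borel" for j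
    unfolding cov_deriv_def using mA[of j] \<psi>(1) h(1)[of j] by measurable
  have nD: "(norm (D x))\<^sup>2 = (\<Sum>j\<in>UNIV. (norm (cov_deriv \<gamma> a b \<psi> h j x))\<^sup>2)" for x
    by (simp add: D_def norm_vec_square)
  have mD2: "(\<lambda>x. (norm (D x))\<^sup>2) \<in> borel_measurable borel" unfolding nD using mc by measurable
  have mD: "(\<lambda>x. norm (D x)) \<in> borel_measurable borel"
  proof -
    have "(\<lambda>x. sqrt ((norm (D x))\<^sup>2)) \<in> borel_measurable borel" using mD2 by measurable
    then show ?thesis by simp
  qed
  have ml: "(\<lambda>x. (norm (mag_grad \<gamma> a b \<phi> x))\<^sup>2) \<in> borel_measurable lebesgue" "(\<lambda>x. (norm (\<phi> x))\<^sup>2) \<in> borel_measurable lebesgue"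
    "(\<lambda>x. norm (\<phi> x) powr (p + 1)) \<in> borel_measurable lebesgue"
    using sg m\<phi> by (auto simp: square_integrable_def)
  have ae: "AE x in lborel. (norm (mag_grad \<gamma> a b \<phi> x))\<^sup>2 = (norm (D x))\<^sup>2" "AE x in lborel. (norm (\<phi> x))\<^sup>2 = (norm (\<psi> x))\<^sup>2"
    "AE x in lborel. norm (\<phi> x) powr (p + 1) = norm (\<psi> x) powr (p + 1)"
    using AED \<psi>(2) by (auto elim: eventually_mono)
  have mb: "(\<lambda>x. (norm (\<psi> x))\<^sup>2) \<in> borel_measurable borel" "(\<lambda>x. norm (\<psi> x) powr (p + 1)) \<in> borel_measurable borel"
    using \<psi>(1) by measurable
  note rD = lebesgue_borel_rep[OF ml(1) mD2 ae(1)] and r\<phi> = lebesgue_borel_rep[OF ml(2) mb(1) ae(2)]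
    and rN = lebesgue_borel_rep[OF ml(3) mb(2) ae(3)]
  have c': "(LINT x|lborel. (norm (\<psi> x))\<^sup>2) = c" using M r\<phi>(2) by (simp add: L2_norm_sq_def)
  have ineq: "2 / (p + 1) * nonlin p v \<le> 1/2 * kinetic v'" if n: "admissible p v v'" and m: "mass v \<le> c"
    for v :: "real^'n \<Rightarrow> real" and v'
  proof (rule ccontr)
    assume neg: "\<not> 2 / (p + 1) * nonlin p v \<le> 1/2 * kinetic v'"
    have "mass v \<ge> 0" unfolding mass_def by (rule Bochner_Integration.integral_nonneg) simp
    moreover have "mass v \<noteq> 0" using nonlin_eq_0[OF n] neg kinetic_nonneg[of v'] by auto
    ultimately have "mass v > 0" by simp
    from energy_unbounded_below[OF n this m p, of \<gamma> g a b B] neg min show False by fastforce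
  qed
  have gap: "2 / (p + 1) * (LINT x|lborel. norm (\<psi> x) powr (p + 1)) < 1/2 * (LINT x|lborel. (norm (D x))\<^sup>2)"
    unfolding D_def
  proof (rule strict_energy_bound[OF \<psi>(1) _ lh \<gamma> ab _ weak])
    show "integrable lborel (\<lambda>x. (norm (\<psi> x))\<^sup>2)" using sq r\<phi>(1) by (simp add: square_integrable_def)
    show "(\<lambda>x. norm (\<chi> j. cov_deriv \<gamma> a b \<psi> h j x)) \<in> borel_measurable borel" using mD unfolding D_def .
    show "integrable lborel (\<lambda>x. (norm (\<chi> j. cov_deriv \<gamma> a b \<psi> h j x))\<^sup>2)"
      using sg rD(1) unfolding D_def by (simp add: square_integrable_def)
  qed (use p1 c c' ineq in auto)
  have "(LINT x|lebesgue. V_trap g a b x * (norm (\<phi> x))\<^sup>2) \<ge> 0"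
    by (intro Bochner_Integration.integral_nonneg mult_nonneg_nonneg V_trap_nonneg) auto
  then show ?thesis using gap rD(2) rN(2) by (simp add: energy_def L2_norm_sq_def)
qed

theorem proposition1p3:
  fixes a b :: "'n::finite" and \<gamma> p c :: real and g :: "'n \<Rightarrow> real"
  assumes "CARD('n) \<ge> 2"
    and "a \<noteq> b"
    and "\<gamma> > 0"
    and "\<And>j. g j > 0"
    and "g a = \<gamma>" and "g b = \<gamma>"
    and "(p = 1 + 4 / real CARD('n) \<and>
            (\<exists>Q :: real^'n \<Rightarrow> real. ground_state Q \<and> c \<ge> L2_norm_sq Q))
         \<or> (1 + 4 / real CARD('n) < p \<and> ereal p < energy_critical_exponent CARD('n) \<and> c > 0)"
  shows "\<not> (\<exists>\<phi> \<in> mass_sphere \<gamma> g a b c. ereal (energy \<gamma> g a b p \<phi>) = min_energy \<gamma> g a b p c)"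
proof
  assume "\<exists>\<phi> \<in> mass_sphere \<gamma> g a b c. ereal (energy \<gamma> g a b p \<phi>) = min_energy \<gamma> g a b p c"
  then obtain \<phi> where \<phi>: "\<phi> \<in> mass_sphere \<gamma> g a b c" "ereal (energy \<gamma> g a b p \<phi>) = min_energy \<gamma> g a b p c" by blast
  have min: "energy \<gamma> g a b p \<phi> \<le> energy \<gamma> g a b p f" if "f \<in> mass_sphere \<gamma> g a b c" for f
  proof -
    have "min_energy \<gamma> g a b p c \<le> ereal (energy \<gamma> g a b p f)" unfolding min_energy_def using that by (rule INF_lower)
    then show ?thesis using \<phi>(2) by (metis ereal_less_eq(3))
  qed
  from assms(7) show False
  proof
    assume "1 + 4 / real CARD('n) < p \<and> ereal p < energy_critical_exponent CARD('n) \<and> c > 0"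
    then obtain f where "f \<in> mass_sphere \<gamma> g a b c" "energy \<gamma> g a b p f < energy \<gamma> g a b p \<phi>"
      using energy_unbounded_supercritical by blast
    then show False using min by fastforce
  next
    assume "p = 1 + 4 / real CARD('n) \<and> (\<exists>Q :: real^'n \<Rightarrow> real. ground_state Q \<and> c \<ge> L2_norm_sq Q)"
    then obtain Q :: "real^'n \<Rightarrow> real" where p: "p = 1 + 4 / real CARD('n)" and Q: "ground_state Q" "c \<ge> L2_norm_sq Q" by blast
    note gs = ground_state_energy[OF Q(1) assms(1) p]
    have m: "mass Q \<le> c" using Q(2) gs(3) by simp
    have "c > 0" using m gs(2) by simp
    \<comment> \<open>The energy of the minimizer itself serves as the lower bound, so that energy
      is positive; rescaled multiples of Q then undercut it.\<close>
    then have pos: "energy \<gamma> g a b p \<phi> > 0"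
      using p by (intro energy_pos_if_bounded_below[OF \<phi>(1) _ assms(3,2) _ min]) auto
    obtain f where "f \<in> mass_sphere \<gamma> g a b c" "energy \<gamma> g a b p f < energy \<gamma> g a b p \<phi>"
      using energy_inf_le_0[OF gs(1,2) m eq_refl[OF p[symmetric]] eq_refl[OF gs(4)] pos] by blast
    then show False using min by fastforce
  qed
qed

end
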